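(* Let $\pi:M\to S$ be a principal $A$-bundle with $A=\mathbb R$ or $S^1$. There is a natural one-to-one correspondence between the Robinson-Trautman (RT) structures $(\mathcal W,[h])$ on the total space $M$ and the subconformal structures $(\mathcal D,[g^{\mathcal D}])$ on the base manifold $S$. It associates with an RT structure $(\mathcal W,[h])$ the projected pair $(\mathcal D=\pi_*(\mathcal W),[g^{\mathcal D}]=\pi_*([h]))$ and, inversely, with a subconformal structure $(\mathcal D,[g^{\mathcal D}])$ the pair $(\mathcal W=\pi_*^{-1}(\mathcal D),[h]=\pi^*[g^{\mathcal D}])$.
   Context: A shearfree structure on $M$ is a pair $(\mathcal W,[h])$ of a codimension one distribution $\mathcal W\subset TM$ and a conformal class $[h]$ of semipositive degenerate metrics on $\mathcal W$ with one-dimensional kernel $\mathcal K_h=\ker h\subset\mathcal W$, such that one (hence each) nowhere vanishing vector field $\mathrm p$ in $\mathcal K_h$ satisfies $\mathcal L_{\mathrm p}\mathcal W\subset\mathcal W$ and $\mathcal L_{\mathrm p}[h]=[h]$ (i.e. $\mathcal L_{\mathrm p}h=fh$ for some function $f$). A shearfree structure $(\mathcal W,[h])$ on the total space of a principal $A$-bundle $\pi:M\to S$, $A=\mathbb R$ or $S^1$, is a Robinson-Trautman (RT) structure if it is $A$-invariant and $\mathcal K_h$ coincides with the vertical distribution $T^{\mathrm v}M=\ker\pi_*$. A subconformal structure on $S$ is a codimension one distribution $\mathcal D\subset TS$ (not necessarily contact) equipped with a conformal class $[g^{\mathcal D}]$ of positive definite metrics on $\mathcal D$. *)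

theory Defs
  imports "HOL-Analysis.Analysis" "HOL-Library.Function_Algebras" "HOL-Algebra.Group"
begin

section \<open>Smooth manifolds\<close>

primrec Ck_on :: "nat \<Rightarrow> ('a::euclidean_space \<Rightarrow> 'b::euclidean_space) \<Rightarrow> 'a set \<Rightarrow> bool" where
  "Ck_on 0 f S \<longleftrightarrow> continuous_on S f"
| "Ck_on (Suc k) f S \<longleftrightarrow>
     (\<forall>x\<in>S. f differentiable at x) \<and> (\<forall>v. Ck_on k (\<lambda>x. frechet_derivative f (at x) v) S)"

text \<open>Only used for open sets \<open>S\<close>.\<close>

definition smooth_on :: "'a::euclidean_space set \<Rightarrow> ('a \<Rightarrow> 'b::euclidean_space) \<Rightarrow> bool" where
  "smooth_on S f \<longleftrightarrow> (\<forall>k. Ck_on k f S)"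

type_synonym ('m, 'e) chart = "'m set \<times> ('m \<Rightarrow> 'e)"

definition is_chart :: "('m::topological_space, 'e::euclidean_space) chart \<Rightarrow> bool" where
  "is_chart c \<longleftrightarrow> (case c of (U, \<phi>) \<Rightarrow>
     open U \<and> open (\<phi> ` U) \<and> homeomorphism U (\<phi> ` U) \<phi> (inv_into U \<phi>))"

text \<open>A manifold is a whole type, with the topology of that type (Hausdorff and second countable)
  and the smooth structure generated by an atlas, which need not be maximal.\<close>

definition smooth_manifold ::
    "('m::{t2_space,second_countable_topology}, 'e::euclidean_space) chart set \<Rightarrow> bool" where
  "smooth_manifold \<A> \<longleftrightarrow>
     (\<forall>c\<in>\<A>. is_chart c) \<and> \<Union> (fst ` \<A>) = UNIV \<and>
     (\<forall>(U, \<phi>)\<in>\<A>. \<forall>(V, \<psi>)\<in>\<A>. smooth_on (\<phi> ` (U \<inter> V)) (\<psi> \<circ> inv_into U \<phi>))"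

text \<open>Smoothness of \<open>F\<close> on an open subset \<open>W\<close> of the first manifold.\<close>

definition smooth_map_on ::
    "('m::topological_space, 'e::euclidean_space) chart set \<Rightarrow>
     ('n::topological_space, 'd::euclidean_space) chart set \<Rightarrow> 'm set \<Rightarrow> ('m \<Rightarrow> 'n) \<Rightarrow> bool" where
  "smooth_map_on \<A> \<B> W F \<longleftrightarrow>
     continuous_on W F \<and>
     (\<forall>(U, \<phi>)\<in>\<A>. \<forall>(V, \<psi>)\<in>\<B>.
        smooth_on (\<phi> ` (U \<inter> W \<inter> F -` V)) (\<psi> \<circ> F \<circ> inv_into U \<phi>))"

definition diffeomorphism_on ::
    "('m::topological_space, 'e::euclidean_space) chart set \<Rightarrow>
     ('n::topological_space, 'd::euclidean_space) chart set \<Rightarrow>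
     'm set \<Rightarrow> 'n set \<Rightarrow> ('m \<Rightarrow> 'n) \<Rightarrow> bool" where
  "diffeomorphism_on \<A> \<B> U V F \<longleftrightarrow>
     bij_betw F U V \<and> smooth_map_on \<A> \<B> U F \<and> smooth_map_on \<B> \<A> V (inv_into U F)"

definition euclidean_atlas :: "('e::euclidean_space, 'e) chart set" where
  "euclidean_atlas = {(UNIV, \<lambda>x. x)}"

definition prod_atlas ::
    "('m, 'e) chart set \<Rightarrow> ('n, 'd) chart set \<Rightarrow> ('m \<times> 'n, 'e \<times> 'd) chart set" where
  "prod_atlas \<A> \<B> = {(U \<times> V, map_prod \<phi> \<psi>) | U \<phi> V \<psi>. (U, \<phi>) \<in> \<A> \<and> (V, \<psi>) \<in> \<B>}"

definition smooth_fun_on ::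
    "('m::topological_space, 'e::euclidean_space) chart set \<Rightarrow> 'm set \<Rightarrow> ('m \<Rightarrow> real) \<Rightarrow> bool" where
  "smooth_fun_on \<A> U f \<longleftrightarrow> smooth_map_on \<A> euclidean_atlas U f"

abbreviation smooth_fun ::
    "('m::topological_space, 'e::euclidean_space) chart set \<Rightarrow> ('m \<Rightarrow> real) \<Rightarrow> bool" where
  "smooth_fun \<A> \<equiv> smooth_fun_on \<A> UNIV"


section \<open>Tangent vectors, vector fields and distributions\<close>

instantiation "fun" :: (type, real_vector) real_vector
begin

definition scaleR_fun :: "real \<Rightarrow> ('a \<Rightarrow> 'b) \<Rightarrow> 'a \<Rightarrow> 'b" where
  "scaleR_fun c f = (\<lambda>x. c *\<^sub>R f x)"

instance
  by standard (auto simp: scaleR_fun_def fun_eq_iff scaleR_add_right scaleR_add_left)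

end

type_synonym 'm tvec = "('m \<Rightarrow> real) \<Rightarrow> real"

text \<open>Tangent vectors at \<open>x\<close> are the derivations at \<open>x\<close> of the algebra of smooth functions. They are
  extended by \<open>0\<close> to all functions, so that equality of tangent vectors is equality of functionals.\<close>

definition tangent_space ::
    "('m::topological_space, 'e::euclidean_space) chart set \<Rightarrow> 'm \<Rightarrow> 'm tvec set" where
  "tangent_space \<A> x = {v.
     (\<forall>f g. smooth_fun \<A> f \<longrightarrow> smooth_fun \<A> g \<longrightarrow> v (\<lambda>y. f y + g y) = v f + v g) \<and>
     (\<forall>c f. smooth_fun \<A> f \<longrightarrow> v (\<lambda>y. c * f y) = c * v f) \<and>
     (\<forall>f g. smooth_fun \<A> f \<longrightarrow> smooth_fun \<A> g \<longrightarrow> v (\<lambda>y. f y * g y) = f x * v g + g x * v f) \<and>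
     (\<forall>f. \<not> smooth_fun \<A> f \<longrightarrow> v f = 0)}"

text \<open>The differential of \<open>F\<close>; the atlas is the one of the target manifold.\<close>

definition push ::
    "('n::topological_space, 'd::euclidean_space) chart set \<Rightarrow> ('m \<Rightarrow> 'n) \<Rightarrow> 'm tvec \<Rightarrow> 'n tvec" where
  "push \<B> F v = (\<lambda>f. if smooth_fun \<B> f then v (f \<circ> F) else 0)"

definition smooth_vector_field_on ::
    "('m::topological_space, 'e::euclidean_space) chart set \<Rightarrow> 'm set \<Rightarrow> ('m \<Rightarrow> 'm tvec) \<Rightarrow> bool" where
  "smooth_vector_field_on \<A> U X \<longleftrightarrow>
     (\<forall>x\<in>U. X x \<in> tangent_space \<A> x) \<and>
     (\<forall>f. smooth_fun \<A> f \<longrightarrow> smooth_fun_on \<A> U (\<lambda>x. X x f))"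

definition bracket :: "('m \<Rightarrow> 'm tvec) \<Rightarrow> ('m \<Rightarrow> 'm tvec) \<Rightarrow> 'm \<Rightarrow> 'm tvec" where
  "bracket X Y x = (\<lambda>f. X x (\<lambda>y. Y y f) - Y x (\<lambda>y. X y f))"

text \<open>A distribution of codimension one; smoothness means that it has smooth local frames.\<close>

definition codim1_distribution ::
    "('m::topological_space, 'e::euclidean_space) chart set \<Rightarrow> ('m \<Rightarrow> 'm tvec set) \<Rightarrow> bool" where
  "codim1_distribution \<A> W \<longleftrightarrow>
     (\<forall>x. subspace (W x) \<and> W x \<subseteq> tangent_space \<A> x \<and> dim (W x) + 1 = dim (tangent_space \<A> x)) \<and>
     (\<forall>x. \<exists>U X. open U \<and> x \<in> U \<and>
        (\<forall>i<dim (W x). smooth_vector_field_on \<A> U (X i)) \<and>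
        (\<forall>y\<in>U. W y = span ((\<lambda>i. X i y) ` {..<dim (W x)})))"

definition vsections ::
    "('m::topological_space, 'e::euclidean_space) chart set \<Rightarrow> ('m \<Rightarrow> 'm tvec set) \<Rightarrow>
     ('m \<Rightarrow> 'm tvec) set" where
  "vsections \<A> W = {X. smooth_vector_field_on \<A> UNIV X \<and> (\<forall>x. X x \<in> W x)}"


section \<open>Metrics on distributions and conformal classes\<close>

type_synonym 'm form = "'m \<Rightarrow> 'm tvec \<Rightarrow> 'm tvec \<Rightarrow> real"

text \<open>Smooth fields of symmetric bilinear forms on the fibres of \<open>W\<close>. They are extended by \<open>0\<close> outside
  \<open>W\<close>, so that equality of forms on \<open>W\<close> is equality of functions.\<close>

definition symmetric_form ::
    "('m::topological_space, 'e::euclidean_space) chart set \<Rightarrow> ('m \<Rightarrow> 'm tvec set) \<Rightarrow> 'm form \<Rightarrow> bool"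
  where
  "symmetric_form \<A> W h \<longleftrightarrow>
     (\<forall>x. \<forall>u\<in>W x. \<forall>v\<in>W x. h x u v = h x v u) \<and>
     (\<forall>x. \<forall>u\<in>W x. \<forall>v\<in>W x. \<forall>w\<in>W x. h x (u + v) w = h x u w + h x v w) \<and>
     (\<forall>x c. \<forall>u\<in>W x. \<forall>v\<in>W x. h x (c *\<^sub>R u) v = c * h x u v) \<and>
     (\<forall>x u v. u \<notin> W x \<or> v \<notin> W x \<longrightarrow> h x u v = 0) \<and>
     (\<forall>X\<in>vsections \<A> W. \<forall>Y\<in>vsections \<A> W. smooth_fun \<A> (\<lambda>x. h x (X x) (Y x)))"

definition form_kernel :: "('m \<Rightarrow> 'm tvec set) \<Rightarrow> 'm form \<Rightarrow> 'm \<Rightarrow> 'm tvec set" where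
  "form_kernel W h x = {u \<in> W x. \<forall>v\<in>W x. h x u v = 0}"

definition positive_definite_metric ::
    "('m::topological_space, 'e::euclidean_space) chart set \<Rightarrow> ('m \<Rightarrow> 'm tvec set) \<Rightarrow> 'm form \<Rightarrow> bool"
  where
  "positive_definite_metric \<A> W g \<longleftrightarrow>
     symmetric_form \<A> W g \<and> (\<forall>x. \<forall>u\<in>W x. u \<noteq> 0 \<longrightarrow> g x u u > 0)"

definition semipositive_metric ::
    "('m::topological_space, 'e::euclidean_space) chart set \<Rightarrow> ('m \<Rightarrow> 'm tvec set) \<Rightarrow> 'm form \<Rightarrow> bool"
  where
  "semipositive_metric \<A> W h \<longleftrightarrow>
     symmetric_form \<A> W h \<and> (\<forall>x. \<forall>u\<in>W x. h x u u \<ge> 0) \<and> (\<forall>x. dim (form_kernel W h x) = 1)"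

definition conformal_class ::
    "('m::topological_space, 'e::euclidean_space) chart set \<Rightarrow> 'm form \<Rightarrow> 'm form set" where
  "conformal_class \<A> h =
     {\<lambda>x u v. \<phi> x * h x u v | \<phi>. smooth_fun \<A> \<phi> \<and> (\<forall>x. \<phi> x > 0)}"

text \<open>\<open>(\<L>\<^sub>p h)(X, Y) = p (h(X, Y)) - h([p, X], Y) - h(X, [p, Y])\<close>, where \<open>X\<close> and \<open>Y\<close> are sections of
  a distribution that is preserved by \<open>p\<close>.\<close>

definition lie_derivative_form ::
    "('m \<Rightarrow> 'm tvec) \<Rightarrow> 'm form \<Rightarrow> ('m \<Rightarrow> 'm tvec) \<Rightarrow> ('m \<Rightarrow> 'm tvec) \<Rightarrow> 'm \<Rightarrow> real" where
  "lie_derivative_form p h X Y x =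
     p x (\<lambda>y. h y (X y) (Y y)) - h x (bracket p X x) (Y x) - h x (X x) (bracket p Y x)"


section \<open>Shearfree and subconformal structures\<close>

definition shearfree_structure ::
    "('m::topological_space, 'e::euclidean_space) chart set \<Rightarrow>
     ('m \<Rightarrow> 'm tvec set) \<times> 'm form set \<Rightarrow> bool" where
  "shearfree_structure \<A> P \<longleftrightarrow> (case P of (W, C) \<Rightarrow>
     codim1_distribution \<A> W \<and>
     (\<exists>h. semipositive_metric \<A> W h \<and> C = conformal_class \<A> h) \<and>
     (\<exists>p. smooth_vector_field_on \<A> UNIV p \<and>
        (\<forall>h\<in>C. \<forall>x. p x \<in> form_kernel W h x) \<and> (\<forall>x. p x \<noteq> 0) \<and>
        (\<forall>X\<in>vsections \<A> W. bracket p X \<in> vsections \<A> W) \<and>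
        (\<forall>h\<in>C. \<exists>f. smooth_fun \<A> f \<and>
           (\<forall>X\<in>vsections \<A> W. \<forall>Y\<in>vsections \<A> W. \<forall>x.
              lie_derivative_form p h X Y x = f x * h x (X x) (Y x)))))"

definition subconformal_structure ::
    "('m::topological_space, 'e::euclidean_space) chart set \<Rightarrow>
     ('m \<Rightarrow> 'm tvec set) \<times> 'm form set \<Rightarrow> bool" where
  "subconformal_structure \<A> P \<longleftrightarrow> (case P of (D, C) \<Rightarrow>
     codim1_distribution \<A> D \<and>
     (\<exists>g. positive_definite_metric \<A> D g \<and> C = conformal_class \<A> g))"


section \<open>Lie groups and principal bundles\<close>

definition lie_group ::
    "'g::{t2_space,second_countable_topology} monoid \<Rightarrow> ('g, 'd::euclidean_space) chart set \<Rightarrow> bool"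
  where
  "lie_group G \<G> \<longleftrightarrow>
     group G \<and> carrier G = UNIV \<and> smooth_manifold \<G> \<and>
     smooth_map_on (prod_atlas \<G> \<G>) \<G> UNIV (\<lambda>(a, b). a \<otimes>\<^bsub>G\<^esub> b) \<and>
     smooth_map_on \<G> \<G> UNIV (m_inv G)"

definition lie_group_isomorphic ::
    "'g::topological_space monoid \<Rightarrow> ('g, 'd::euclidean_space) chart set \<Rightarrow>
     'h::topological_space monoid \<Rightarrow> ('h, 'c::euclidean_space) chart set \<Rightarrow> bool" where
  "lie_group_isomorphic G \<G> H \<H> \<longleftrightarrow>
     (\<exists>F. F \<in> iso G H \<and> diffeomorphism_on \<G> \<H> UNIV UNIV F)"

definition real_group :: "real monoid" where
  "real_group = \<lparr>carrier = UNIV, mult = (+), one = 0\<rparr>"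

typedef circle = "sphere (0::complex) 1"
  by (rule exI[of _ 1]) simp

instantiation circle :: topological_space
begin

definition open_circle :: "circle set \<Rightarrow> bool" where
  "open_circle U \<longleftrightarrow> (\<exists>V. open V \<and> U = Rep_circle -` V)"

instance
proof
  show "open (UNIV :: circle set)"
    unfolding open_circle_def by (rule exI[of _ UNIV]) simp
next
  fix S T :: "circle set"
  assume "open S" "open T"
  then show "open (S \<inter> T)"
    unfolding open_circle_def by (metis open_Int vimage_Int)
next
  fix K :: "circle set set"
  assume "\<forall>S\<in>K. open S"
  then obtain V where V: "\<And>S. S \<in> K \<Longrightarrow> open (V S) \<and> S = Rep_circle -` V S"
    unfolding open_circle_def by metis
  then have "open (\<Union>(V ` K))" "\<Union>K = Rep_circle -` (\<Union>(V ` K))"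
    by blast+
  then show "open (\<Union>K)"
    unfolding open_circle_def by blast
qed

end

instance circle :: t2_space
proof
  fix x y :: circle
  assume "x \<noteq> y"
  then have "Rep_circle x \<noteq> Rep_circle y"
    by (simp add: Rep_circle_inject)
  then obtain U V where "open U" "open V" "Rep_circle x \<in> U" "Rep_circle y \<in> V" "U \<inter> V = {}"
    by (metis hausdorff)
  then show "\<exists>U V. open U \<and> open V \<and> x \<in> U \<and> y \<in> V \<and> U \<inter> V = {}"
    by (intro exI[of _ "Rep_circle -` U"] exI[of _ "Rep_circle -` V"])
       (auto simp: open_circle_def)
qed

instance circle :: second_countable_topology
proof
  obtain B :: "complex set set" where B: "countable B" "topological_basis B"
    using ex_countable_basis by auto
  have "topological_basis ((\<lambda>V. Rep_circle -` V) ` B)"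
  proof (rule topological_basisI)
    fix U assume "U \<in> (\<lambda>V. Rep_circle -` V) ` B"
    then show "open U"
      using topological_basis_open[OF B(2)] by (auto simp: open_circle_def)
  next
    fix U and x :: circle assume "open U" "x \<in> U"
    then obtain V where V: "open V" "U = Rep_circle -` V"
      by (auto simp: open_circle_def)
    then obtain V' where "V' \<in> B" "Rep_circle x \<in> V'" "V' \<subseteq> V"
      using topological_basisE[OF B(2) V(1), of "Rep_circle x"] \<open>x \<in> U\<close> by auto
    with V show "\<exists>B'\<in>(\<lambda>V. Rep_circle -` V) ` B. x \<in> B' \<and> B' \<subseteq> U"
      by auto
  qed
  then show "\<exists>B::circle set set. countable B \<and> open = generate_topology B"
    using B(1) topological_basis_imp_subbasis by blast
qed

definition circle_group :: "circle monoid" where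
  "circle_group =
     \<lparr>carrier = UNIV, mult = (\<lambda>z w. Abs_circle (Rep_circle z * Rep_circle w)), one = Abs_circle 1\<rparr>"

text \<open>Angular charts: for every \<open>w\<close> the complement of \<open>- w\<close>, with the angle measured from \<open>w\<close>.\<close>

definition circle_atlas :: "(circle, real) chart set" where
  "circle_atlas =
     range (\<lambda>w. ({z. Rep_circle z \<noteq> - Rep_circle w}, \<lambda>z. Arg (Rep_circle z / Rep_circle w)))"

text \<open>A principal bundle with right action \<open>act\<close>: around every point there is an equivariant local
  trivialization \<open>x \<mapsto> (\<pi> x, \<tau> x)\<close>. Freeness of the action and its transitivity on the fibres
  follow.\<close>

definition principal_bundle ::
    "('m::{t2_space,second_countable_topology}, 'e::euclidean_space) chart set \<Rightarrow>
     ('s::{t2_space,second_countable_topology}, 'f::euclidean_space) chart set \<Rightarrow>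
     'g::{t2_space,second_countable_topology} monoid \<Rightarrow> ('g, 'd::euclidean_space) chart set \<Rightarrow>
     ('m \<Rightarrow> 's) \<Rightarrow> ('m \<Rightarrow> 'g \<Rightarrow> 'm) \<Rightarrow> bool" where
  "principal_bundle \<A> \<S> G \<G> \<pi> act \<longleftrightarrow>
     smooth_manifold \<A> \<and> smooth_manifold \<S> \<and> lie_group G \<G> \<and>
     smooth_map_on \<A> \<S> UNIV \<pi> \<and>
     smooth_map_on (prod_atlas \<A> \<G>) \<A> UNIV (\<lambda>(x, a). act x a) \<and>
     (\<forall>x. act x \<one>\<^bsub>G\<^esub> = x) \<and> (\<forall>x a b. act (act x a) b = act x (a \<otimes>\<^bsub>G\<^esub> b)) \<and>
     (\<forall>x a. \<pi> (act x a) = \<pi> x) \<and>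
     (\<forall>s. \<exists>U \<tau>. open U \<and> s \<in> U \<and>
        diffeomorphism_on \<A> (prod_atlas \<S> \<G>) (\<pi> -` U) (U \<times> UNIV) (\<lambda>x. (\<pi> x, \<tau> x)) \<and>
        (\<forall>x\<in>\<pi> -` U. \<forall>a. \<tau> (act x a) = \<tau> x \<otimes>\<^bsub>G\<^esub> a))"


section \<open>Robinson--Trautman structures, projection and pullback\<close>

definition vertical_space ::
    "('m::topological_space, 'e::euclidean_space) chart set \<Rightarrow>
     ('s::topological_space, 'f::euclidean_space) chart set \<Rightarrow> ('m \<Rightarrow> 's) \<Rightarrow> 'm \<Rightarrow> 'm tvec set" where
  "vertical_space \<A> \<S> \<pi> x = {v \<in> tangent_space \<A> x. push \<S> \<pi> v = 0}"

text \<open>\<open>F\<^sup>* h\<close> restricted to the distribution \<open>W\<close> on the source of \<open>F\<close>.\<close>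

definition pullback_form ::
    "('n::topological_space, 'd::euclidean_space) chart set \<Rightarrow> ('m \<Rightarrow> 'n) \<Rightarrow>
     ('m \<Rightarrow> 'm tvec set) \<Rightarrow> 'n form \<Rightarrow> 'm form" where
  "pullback_form \<B> F W h =
     (\<lambda>x u v. if u \<in> W x \<and> v \<in> W x then h (F x) (push \<B> F u) (push \<B> F v) else 0)"

definition invariant_structure ::
    "('m::topological_space, 'e::euclidean_space) chart set \<Rightarrow> ('m \<Rightarrow> 'g \<Rightarrow> 'm) \<Rightarrow>
     ('m \<Rightarrow> 'm tvec set) \<times> 'm form set \<Rightarrow> bool" where
  "invariant_structure \<A> act P \<longleftrightarrow> (case P of (W, C) \<Rightarrow>
     \<forall>a. (\<forall>x. push \<A> (\<lambda>y. act y a) ` W x = W (act x a)) \<and>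
         pullback_form \<A> (\<lambda>y. act y a) W ` C = C)"

definition rt_structure ::
    "('m::topological_space, 'e::euclidean_space) chart set \<Rightarrow>
     ('s::topological_space, 'f::euclidean_space) chart set \<Rightarrow> ('m \<Rightarrow> 's) \<Rightarrow> ('m \<Rightarrow> 'g \<Rightarrow> 'm) \<Rightarrow>
     ('m \<Rightarrow> 'm tvec set) \<times> 'm form set \<Rightarrow> bool" where
  "rt_structure \<A> \<S> \<pi> act P \<longleftrightarrow>
     shearfree_structure \<A> P \<and> invariant_structure \<A> act P \<and>
     (case P of (W, C) \<Rightarrow> \<forall>h\<in>C. \<forall>x. form_kernel W h x = vertical_space \<A> \<S> \<pi> x)"

definition push_distribution ::
    "('s::topological_space, 'f::euclidean_space) chart set \<Rightarrow> ('m \<Rightarrow> 's) \<Rightarrow>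
     ('m \<Rightarrow> 'm tvec set) \<Rightarrow> 's \<Rightarrow> 's tvec set" where
  "push_distribution \<S> \<pi> W s = {push \<S> \<pi> v | x v. \<pi> x = s \<and> v \<in> W x}"

definition pull_distribution ::
    "('m::topological_space, 'e::euclidean_space) chart set \<Rightarrow>
     ('s::topological_space, 'f::euclidean_space) chart set \<Rightarrow> ('m \<Rightarrow> 's) \<Rightarrow>
     ('s \<Rightarrow> 's tvec set) \<Rightarrow> 'm \<Rightarrow> 'm tvec set" where
  "pull_distribution \<A> \<S> \<pi> D x = {v \<in> tangent_space \<A> x. push \<S> \<pi> v \<in> D (\<pi> x)}"

text \<open>A metric \<open>h\<close> on \<open>W\<close> is projectable if it is \<open>\<pi>\<^sup>* g\<close> for a metric \<open>g\<close> on \<open>\<pi>\<^sub>* W\<close>, i.e.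
  \<open>h(u, v) = g(\<pi>\<^sub>* u, \<pi>\<^sub>* v)\<close>; then \<open>g\<close> is its projection. The projection of a conformal class \<open>C\<close>
  consists of the projections of all its projectable members (not every member is projectable).\<close>

definition rt_projection ::
    "('s::topological_space, 'f::euclidean_space) chart set \<Rightarrow> ('m \<Rightarrow> 's) \<Rightarrow>
     ('m \<Rightarrow> 'm tvec set) \<times> 'm form set \<Rightarrow> ('s \<Rightarrow> 's tvec set) \<times> 's form set" where
  "rt_projection \<S> \<pi> P = (case P of (W, C) \<Rightarrow>
     (push_distribution \<S> \<pi> W,
      {g. positive_definite_metric \<S> (push_distribution \<S> \<pi> W) g \<and> pullback_form \<S> \<pi> W g \<in> C}))"

text \<open>The pullbacks of the members of a conformal class on the base do not exhaust a conformal class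
  on the total space, since the conformal factors there need not be constant along the fibres;
  \<open>\<pi>\<^sup>* C\<close> is the conformal class that they generate.\<close>

definition rt_pullback ::
    "('m::topological_space, 'e::euclidean_space) chart set \<Rightarrow>
     ('s::topological_space, 'f::euclidean_space) chart set \<Rightarrow> ('m \<Rightarrow> 's) \<Rightarrow>
     ('s \<Rightarrow> 's tvec set) \<times> 's form set \<Rightarrow> ('m \<Rightarrow> 'm tvec set) \<times> 'm form set" where
  "rt_pullback \<A> \<S> \<pi> Q = (case Q of (D, C) \<Rightarrow>
     (pull_distribution \<A> \<S> \<pi> D,
      \<Union>g\<in>C. conformal_class \<A> (pullback_form \<S> \<pi> (pull_distribution \<A> \<S> \<pi> D) g)))"

end

theory Submission
  imports Defs
begin

text \<open>The differential of \<pi> maps each tangent space of \<open>M\<close> onto one of \<open>S\<close>, with the line of vertical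
  vectors as kernel. Hence a distribution on \<open>M\<close> that contains the vertical vectors and is invariant
  under the group is the preimage of its image, and the image has codimension one again
  (\<open>codim1_push_distribution\<close>, \<open>pull_codim1\<close>, \<open>push_pull_distribution\<close>). The content of the theorem
  lies in the metrics.

  \<^item> From \<open>S\<close> to \<open>M\<close>. A vertical field \<open>p\<close> annihilates all functions \<open>f \<circ> \<pi>\<close>, so
    \<open>L\<^sub>p (\<pi>\<^sup>* g) = 0\<close> and \<open>L\<^sub>p (\<phi> \<pi>\<^sup>* g) = (p \<phi> / \<phi>) \<phi> \<pi>\<^sup>* g\<close>
    (\<open>lie_derivative_pull_form\<close>, \<open>shearfree_pullback\<close>). A vertical field without zeros is given by the
    velocities of the orbits along a fixed tangent vector of the group (\<open>vertical_vector_field\<close>).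

  \<^item> From \<open>M\<close> to \<open>S\<close>. Since its kernel is vertical, \<open>h\<close> induces from each \<open>x\<close> a positive definite form
    on \<open>D (\<pi> x)\<close> (\<open>induced_form\<close>), and since \<open>[h]\<close> is invariant, the forms induced from the points of one
    fibre are positive multiples of each other. They therefore span a ray in the forms on \<open>D s\<close>, of which
    local sections of \<pi> provide smooth local choices. A ray is convex, so a partition of unity glues these
    choices to a metric \<open>g\<close> (\<open>glue_cone_sections\<close>). Then \<open>\<pi>\<^sup>* g = \<lambda> h\<close> with a positive factor \<lambda>
    at every point, and \<lambda> is smooth because it is a quotient of values on a section that is not null
    (\<open>pointwise_proportional_conformal\<close>); if \<open>D\<close> is zero, then so is \<open>h\<close>, and \<open>\<lambda> = 1\<close> serves. So every Robinson--Trautman structure is a pullback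
    (\<open>rt_structure_is_pullback\<close>).

  \<^item> If \<open>\<pi>\<^sup>* g'\<close> is conformal to \<open>\<pi>\<^sup>* g\<close>, then \<open>g'\<close> and \<open>g\<close> are proportional at every point of
    \<open>S\<close> and hence, by the same quotient, conformal (\<open>pull_form_conformal_iff\<close>). So projection undoes
    pullback, and with the preceding item the two maps are inverse to each other.

  Smoothness needs some care. A form is smooth if its values on global sections are, but the image under
  \<pi> of a section over \<open>M\<close> is not a section over \<open>S\<close>. A \<open>generating_family\<close> bridges this: over a small
  open set it expands every vector \<open>d\<close> of \<open>D\<close> in finitely many global sections, with coefficients
  \<open>d (\<kappa> b)\<close> for fixed smooth functions \<open>\<kappa> b\<close>, which makes sense along \<pi> as well. As tangent vectors
  are derivations, all this rests on the lemma of Hadamard, which identifies them with vectors in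
  coordinates (\<open>tangent_space_eq_coord_vec\<close>).\<close>

section \<open>Smooth maps between Euclidean spaces\<close>

lemma Ck_on_subset: "Ck_on k f S \<Longrightarrow> T \<subseteq> S \<Longrightarrow> Ck_on k f T"
proof (induction k arbitrary: f)
  case 0
  then show ?case using continuous_on_subset by auto
next
  case (Suc k)
  then show ?case by auto
qed

lemma frechet_derivative_cong_open:
  assumes "open S" "x \<in> S" "\<And>y. y \<in> S \<Longrightarrow> f y = g y"
  shows "frechet_derivative f (at x) = frechet_derivative g (at x)"
proof -
  have "(f has_derivative D) (at x) \<longleftrightarrow> (g has_derivative D) (at x)" for D
    using has_derivative_transform_within_open[of f D x UNIV S g]
      has_derivative_transform_within_open[of g D x UNIV S f] assms by auto
  then show ?thesis by (simp add: frechet_derivative_def)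
qed

lemma differentiable_cong_open:
  assumes "open S" "x \<in> S" "\<And>y. y \<in> S \<Longrightarrow> f y = g y" "f differentiable (at x)"
  shows "g differentiable (at x)"
proof -
  obtain D where "(f has_derivative D) (at x)" using assms(4) differentiable_def by blast
  from has_derivative_transform_within_open[OF this assms(1,2)] assms(3)
  show ?thesis unfolding differentiable_def by auto
qed

lemma Ck_on_cong:
  assumes "open S" "\<And>y. y \<in> S \<Longrightarrow> f y = g y" "Ck_on k f S"
  shows "Ck_on k g S"
  using assms(2,3)
proof (induction k arbitrary: f g)
  case 0
  then show ?case by (simp add: continuous_on_cong[of S S f g])
next
  case (Suc k)
  have "Ck_on k (\<lambda>x. frechet_derivative g (at x) v) S" for v
  proof (rule Suc.IH)
    show "Ck_on k (\<lambda>x. frechet_derivative f (at x) v) S" using Suc.prems by simp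
    show "frechet_derivative f (at y) v = frechet_derivative g (at y) v" if "y \<in> S" for y
      using frechet_derivative_cong_open[OF assms(1) that, of f g] Suc.prems(1) by simp
  qed
  moreover have "g differentiable at x" if "x \<in> S" for x
    using differentiable_cong_open[OF assms(1) that, of f g] Suc.prems that by auto
  ultimately show ?case by simp
qed

lemma Ck_on_Suc_imp: "Ck_on (Suc k) f S \<Longrightarrow> Ck_on k f S"
proof (induction k arbitrary: f)
  case 0
  then show ?case
    by (auto intro!: continuous_at_imp_continuous_on differentiable_imp_continuous_within)
next
  case (Suc k)
  have "Ck_on k (\<lambda>x. frechet_derivative f (at x) v) S" for v
    by (rule Suc.IH) (use Suc.prems in simp)
  then show ?case using Suc.prems by simp
qed

lemma Ck_on_local:
  assumes "\<And>x. x \<in> S \<Longrightarrow> \<exists>T. open T \<and> x \<in> T \<and> Ck_on k f T"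
  shows "Ck_on k f S"
  using assms
proof (induction k arbitrary: f)
  case 0
  have "continuous (at x) f" if "x \<in> S" for x
    using 0[OF that] continuous_on_eq_continuous_at by auto
  then show ?case by (simp add: continuous_at_imp_continuous_on)
next
  case (Suc k)
  have "Ck_on k (\<lambda>x. frechet_derivative f (at x) v) S" for v
  proof (rule Suc.IH)
    fix x assume "x \<in> S"
    from Suc.prems[OF this] show "\<exists>T. open T \<and> x \<in> T \<and> Ck_on k (\<lambda>x. frechet_derivative f (at x) v) T"
      by auto
  qed
  moreover have "f differentiable at x" if "x \<in> S" for x
    using Suc.prems[OF that] by auto
  ultimately show ?case by simp
qed

lemma Ck_on_SucI:
  assumes "open S" "\<And>x. x \<in> S \<Longrightarrow> (f has_derivative D x) (at x)" "\<And>v. Ck_on k (\<lambda>x. D x v) S"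
  shows "Ck_on (Suc k) f S"
proof -
  have "Ck_on k (\<lambda>x. frechet_derivative f (at x) v) S" for v
    using frechet_derivative_at[OF assms(2)] by (intro Ck_on_cong[OF assms(1) _ assms(3)]) simp
  moreover have "f differentiable at x" if "x \<in> S" for x
    using assms(2)[OF that] differentiableI by blast
  ultimately show ?thesis by simp
qed

lemma Ck_on_has_derivative:
  assumes "Ck_on (Suc k) f S" "x \<in> S"
  shows "(f has_derivative frechet_derivative f (at x)) (at x)"
  using assms frechet_derivative_works by auto

lemma Ck_on_const: "open S \<Longrightarrow> Ck_on k (\<lambda>x. c) S"
proof (induction k arbitrary: c)
  case (Suc k)
  show ?case by (rule Ck_on_SucI[where D = "\<lambda>x v. 0"]) (use Suc in auto)
qed simp

lemma Ck_on_ident: "open S \<Longrightarrow> Ck_on k (\<lambda>x. x) S"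
proof (induction k)
  case (Suc k)
  show ?case
    by (rule Ck_on_SucI[where D = "\<lambda>x v. v"]) (use Suc Ck_on_const in \<open>auto intro: has_derivative_ident\<close>)
qed (simp add: continuous_on_id)

lemma Ck_on_linear:
  assumes "open S" "bounded_linear L"
  shows "Ck_on k f S \<Longrightarrow> Ck_on k (\<lambda>x. L (f x)) S"
proof (induction k arbitrary: f)
  case 0
  then show ?case using assms(2) linear_continuous_on_compose[of S f L]
    by (simp add: bounded_linear.linear)
next
  case (Suc k)
  show ?case
  proof (rule Ck_on_SucI[OF assms(1)])
    show "((\<lambda>x. L (f x)) has_derivative (\<lambda>v. L (frechet_derivative f (at x) v))) (at x)" if "x \<in> S" for x
      using bounded_linear.has_derivative[OF assms(2) Ck_on_has_derivative[OF Suc.prems that]] .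
    show "Ck_on k (\<lambda>x. L (frechet_derivative f (at x) v)) S" for v
      using Suc by auto
  qed
qed

lemma Ck_on_add:
  assumes "open S"
  shows "Ck_on k f S \<Longrightarrow> Ck_on k g S \<Longrightarrow> Ck_on k (\<lambda>x. f x + g x) S"
proof (induction k arbitrary: f g)
  case 0
  then show ?case by (simp add: continuous_on_add)
next
  case (Suc k)
  show ?case
  proof (rule Ck_on_SucI[OF assms(1)])
    show "((\<lambda>x. f x + g x) has_derivative (\<lambda>v. frechet_derivative f (at x) v + frechet_derivative g (at x) v)) (at x)"
      if "x \<in> S" for x
      using has_derivative_add Ck_on_has_derivative[OF Suc.prems(1) that] Ck_on_has_derivative[OF Suc.prems(2) that]
      by blast
    show "Ck_on k (\<lambda>x. frechet_derivative f (at x) v + frechet_derivative g (at x) v) S" for v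
      using Suc by auto
  qed
qed

lemma Ck_on_bilinear:
  assumes "open S" "bounded_bilinear B"
  shows "Ck_on k f S \<Longrightarrow> Ck_on k g S \<Longrightarrow> Ck_on k (\<lambda>x. B (f x) (g x)) S"
proof (induction k arbitrary: f g)
  case 0
  then show ?case using bounded_bilinear.continuous_on[OF assms(2)] by auto
next
  case (Suc k)
  show ?case
  proof (rule Ck_on_SucI[OF assms(1)])
    show "((\<lambda>x. B (f x) (g x)) has_derivative
        (\<lambda>v. B (f x) (frechet_derivative g (at x) v) + B (frechet_derivative f (at x) v) (g x))) (at x)"
      if "x \<in> S" for x
      using bounded_bilinear.FDERIV[OF assms(2)] Ck_on_has_derivative[OF Suc.prems(1) that]
        Ck_on_has_derivative[OF Suc.prems(2) that] by blast
    have "Ck_on k f S" "Ck_on k g S" using Suc.prems Ck_on_Suc_imp by auto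
    then show "Ck_on k (\<lambda>x. B (f x) (frechet_derivative g (at x) v) + B (frechet_derivative f (at x) v) (g x)) S" for v
      using Suc by (intro Ck_on_add[OF assms(1)] Suc.IH) auto
  qed
qed

lemma Ck_on_sum:
  assumes "open S" "finite I" "\<And>i. i \<in> I \<Longrightarrow> Ck_on k (f i) S"
  shows "Ck_on k (\<lambda>x. \<Sum>i\<in>I. f i x) S"
  using assms(2,3)
  by (induction I rule: finite_induct) (auto simp: assms(1) Ck_on_const Ck_on_add)

lemma linear_Basis_expansion:
  assumes "linear L"
  shows "L w = (\<Sum>b\<in>Basis. (w \<bullet> b) *\<^sub>R L b)"
proof -
  have "L (\<Sum>b\<in>Basis. (w \<bullet> b) *\<^sub>R b) = (\<Sum>b\<in>Basis. L ((w \<bullet> b) *\<^sub>R b))"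
    by (rule linear_sum[OF assms])
  also have "\<dots> = (\<Sum>b\<in>Basis. (w \<bullet> b) *\<^sub>R L b)"
    by (intro sum.cong refl linear_scale[OF assms])
  finally show ?thesis by (simp add: euclidean_representation)
qed

text \<open>The chain rule is expanded in an orthonormal basis, because \<open>Ck_on\<close> speaks of derivatives in fixed
  directions only, whereas the chain rule differentiates \<open>g\<close> in a direction that varies with \<open>x\<close>.\<close>

lemma Ck_on_compose:
  assumes "open S" "open T" "f ` S \<subseteq> T"
  shows "Ck_on k f S \<Longrightarrow> Ck_on k g T \<Longrightarrow> Ck_on k (\<lambda>x. g (f x)) S"
proof (induction k arbitrary: g)
  case 0
  then show ?case using assms continuous_on_compose2[of T g S f] by auto
next
  case (Suc k)
  let ?D = "\<lambda>x v. \<Sum>b\<in>Basis. (frechet_derivative f (at x) v \<bullet> b) *\<^sub>R frechet_derivative g (at (f x)) b"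
  show ?case
  proof (rule Ck_on_SucI[OF assms(1)])
    fix x assume x: "x \<in> S"
    have f: "(f has_derivative frechet_derivative f (at x)) (at x)"
      and g: "(g has_derivative frechet_derivative g (at (f x))) (at (f x))"
      using Ck_on_has_derivative[OF Suc.prems(1) x] Ck_on_has_derivative[OF Suc.prems(2)] x assms(3) by auto
    have lin: "linear (frechet_derivative g (at (f x)))"
      using g has_derivative_linear by blast
    have "(\<lambda>v. frechet_derivative g (at (f x)) (frechet_derivative f (at x) v)) = ?D x"
      by (rule ext) (rule linear_Basis_expansion[OF lin])
    then show "((\<lambda>x. g (f x)) has_derivative ?D x) (at x)"
      using has_derivative_compose[OF f g] by simp
  next
    fix v
    have f: "Ck_on k f S" using Suc.prems Ck_on_Suc_imp by auto
    show "Ck_on k (\<lambda>x. ?D x v) S"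
    proof (rule Ck_on_sum[OF assms(1) finite_Basis])
      fix b :: 'b assume "b \<in> Basis"
      have 1: "Ck_on k (\<lambda>x. frechet_derivative g (at (f x)) b) S"
        using Suc.IH[OF f, of "\<lambda>y. frechet_derivative g (at y) b"] Suc.prems by simp
      have 2: "Ck_on k (\<lambda>x. frechet_derivative f (at x) v \<bullet> b) S"
        by (rule Ck_on_linear[OF assms(1) bounded_linear_inner_left]) (use Suc.prems in simp)
      show "Ck_on k (\<lambda>x. (frechet_derivative f (at x) v \<bullet> b) *\<^sub>R frechet_derivative g (at (f x)) b) S"
        by (rule Ck_on_bilinear[OF assms(1) bounded_bilinear_scaleR 2 1])
    qed
  qed
qed

lemma Ck_on_inverse: "Ck_on k (inverse :: real \<Rightarrow> real) (- {0})"
proof (induction k)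
  case 0
  then show ?case by (auto intro!: continuous_intros)
next
  case (Suc k)
  have o: "open (- {0::real})" by auto
  show ?case
  proof (rule Ck_on_SucI[OF o])
    show "(inverse has_derivative (\<lambda>v. - (inverse x * v * inverse x))) (at x)" if "x \<in> - {0}" for x :: real
      using has_derivative_inverse'[of x UNIV] that by auto
    show "Ck_on k (\<lambda>x. - (inverse x * v * inverse x)) (- {0})" for v :: real
      by (intro Ck_on_linear[OF o bounded_linear_minus[OF bounded_linear_ident]]
            Ck_on_bilinear[OF o bounded_bilinear_mult] Suc Ck_on_const[OF o])
  qed
qed


lemma smooth_on_subset: "smooth_on S f \<Longrightarrow> T \<subseteq> S \<Longrightarrow> smooth_on T f"
  using Ck_on_subset smooth_on_def by metis

lemma smooth_on_cong:
  "smooth_on S f \<Longrightarrow> open S \<Longrightarrow> (\<And>y. y \<in> S \<Longrightarrow> f y = g y) \<Longrightarrow> smooth_on S g"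
  using Ck_on_cong smooth_on_def by metis

lemma smooth_on_local:
  assumes "\<And>x. x \<in> S \<Longrightarrow> \<exists>T. open T \<and> x \<in> T \<and> smooth_on T f"
  shows "smooth_on S f"
  unfolding smooth_on_def
proof
  fix k show "Ck_on k f S" by (rule Ck_on_local) (use assms smooth_on_def in metis)
qed

lemma smooth_on_imp_continuous_on: "smooth_on S f \<Longrightarrow> continuous_on S f"
  unfolding smooth_on_def using Ck_on.simps(1) by blast

lemma smooth_on_has_derivative:
  "smooth_on S f \<Longrightarrow> x \<in> S \<Longrightarrow> (f has_derivative frechet_derivative f (at x)) (at x)"
  unfolding smooth_on_def using Ck_on_has_derivative by blast

lemma smooth_on_frechet_derivative:
  "smooth_on S f \<Longrightarrow> smooth_on S (\<lambda>x. frechet_derivative f (at x) v)"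
  unfolding smooth_on_def using Ck_on.simps(2) by blast

lemma smooth_on_const: "open S \<Longrightarrow> smooth_on S (\<lambda>x. c)"
  by (simp add: smooth_on_def Ck_on_const)

lemma smooth_on_ident: "open S \<Longrightarrow> smooth_on S (\<lambda>x. x)"
  by (simp add: smooth_on_def Ck_on_ident)

lemma smooth_on_linear:
  "open S \<Longrightarrow> bounded_linear L \<Longrightarrow> smooth_on S f \<Longrightarrow> smooth_on S (\<lambda>x. L (f x))"
  by (simp add: smooth_on_def Ck_on_linear)

lemma smooth_on_add:
  "open S \<Longrightarrow> smooth_on S f \<Longrightarrow> smooth_on S g \<Longrightarrow> smooth_on S (\<lambda>x. f x + g x)"
  by (simp add: smooth_on_def Ck_on_add)

lemma smooth_on_bilinear:
  "open S \<Longrightarrow> bounded_bilinear B \<Longrightarrow> smooth_on S f \<Longrightarrow> smooth_on S g \<Longrightarrow> smooth_on S (\<lambda>x. B (f x) (g x))"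
  by (simp add: smooth_on_def Ck_on_bilinear)

lemmas smooth_on_mult = smooth_on_bilinear[OF _ bounded_bilinear_mult]
lemmas smooth_on_scaleR = smooth_on_bilinear[OF _ bounded_bilinear_scaleR]
lemmas smooth_on_inner = smooth_on_bilinear[OF _ bounded_bilinear_inner]

lemma smooth_on_sum:
  "open S \<Longrightarrow> finite I \<Longrightarrow> (\<And>i. i \<in> I \<Longrightarrow> smooth_on S (f i)) \<Longrightarrow> smooth_on S (\<lambda>x. \<Sum>i\<in>I. f i x)"
  by (simp add: smooth_on_def Ck_on_sum)

lemma smooth_on_compose:
  "smooth_on T g \<Longrightarrow> smooth_on S f \<Longrightarrow> f ` S \<subseteq> T \<Longrightarrow> open S \<Longrightarrow> open T \<Longrightarrow> smooth_on S (\<lambda>x. g (f x))"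
  by (simp add: smooth_on_def Ck_on_compose)

lemma smooth_on_minus: "open S \<Longrightarrow> smooth_on S f \<Longrightarrow> smooth_on S (\<lambda>x. - f x)"
  by (rule smooth_on_linear[OF _ bounded_linear_minus[OF bounded_linear_ident]])

lemma smooth_on_diff:
  "open S \<Longrightarrow> smooth_on S f \<Longrightarrow> smooth_on S g \<Longrightarrow> smooth_on S (\<lambda>x. f x - g x)"
  using smooth_on_add[OF _ _ smooth_on_minus, of S f g] by simp

lemma smooth_on_divide:
  fixes f g :: "'a::euclidean_space \<Rightarrow> real"
  assumes "open S" "smooth_on S f" "smooth_on S g" "\<And>x. x \<in> S \<Longrightarrow> g x \<noteq> 0"
  shows "smooth_on S (\<lambda>x. f x / g x)"
proof -
  have "smooth_on S (\<lambda>x. inverse (g x))"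
    by (rule smooth_on_compose[of "- {0}"]) (use assms Ck_on_inverse smooth_on_def in auto)
  then show ?thesis using smooth_on_mult[OF assms(1,2)] by (simp add: divide_inverse)
qed

lemma smooth_on_Pair:
  assumes "open S" "smooth_on S f" "smooth_on S g"
  shows "smooth_on S (\<lambda>x. (f x, g x))"
proof -
  have "smooth_on S (\<lambda>x. (f x, 0) + (0, g x))"
    by (intro smooth_on_add assms smooth_on_linear[where L = "\<lambda>x. (x, 0)"] smooth_on_linear[where L = "\<lambda>x. (0, x)"]
        bounded_linear_Pair bounded_linear_ident bounded_linear_zero)
  then show ?thesis by simp
qed

section \<open>Bump functions and the lemma of Hadamard\<close>

text \<open>Derivatives of \<open>exp (- 1 / t)\<close> at \<open>t > 0\<close> are polynomials in \<open>1 / t\<close> times \<open>exp (- 1 / t)\<close>. With the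
  polynomial as a parameter the family is closed under differentiation, so that smoothness at \<open>0\<close> is an
  induction on the order for all polynomials at once.\<close>

definition flat_exp :: "real poly \<Rightarrow> real \<Rightarrow> real" where
  "flat_exp p t = (if t > 0 then poly p (1 / t) * exp (- (1 / t)) else 0)"

lemma poly_times_exp_minus_tendsto_0:
  fixes p :: "real poly"
  shows "((\<lambda>u. u ^ n * poly p u * exp (- u)) \<longlongrightarrow> 0) at_top"
proof (induction p arbitrary: n)
  case 0
  then show ?case by simp
next
  case (pCons a p)
  have "((\<lambda>u::real. a * (u ^ n / exp u) + u ^ Suc n * poly p u * exp (- u)) \<longlongrightarrow> a * 0 + 0) at_top"
    by (intro tendsto_intros tendsto_power_div_exp_0 pCons.IH)
  moreover have "(\<lambda>u::real. a * (u ^ n / exp u) + u ^ Suc n * poly p u * exp (- u)) =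
      (\<lambda>u. u ^ n * poly (pCons a p) u * exp (- u))"
    by (auto simp: fun_eq_iff exp_minus field_simps)
  ultimately show ?case by simp
qed

lemma flat_exp_tendsto_0: "((flat_exp p) \<longlongrightarrow> 0) (at 0)"
proof -
  have "((\<lambda>t. inverse t ^ 0 * poly p (inverse t) * exp (- inverse t)) \<longlongrightarrow> 0) (at_right 0)"
    by (rule filterlim_compose[OF poly_times_exp_minus_tendsto_0 filterlim_inverse_at_top_right])
  then have "((flat_exp p) \<longlongrightarrow> 0) (at_right 0)"
    by (rule Lim_transform_eventually)
       (auto simp: eventually_at_right_field flat_exp_def inverse_eq_divide intro: exI[of _ 1])
  moreover have "((flat_exp p) \<longlongrightarrow> 0) (at_left 0)"
    by (rule Lim_transform_eventually[OF tendsto_const])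
       (auto simp: eventually_at_left_field flat_exp_def intro: exI[of _ "-1"])
  ultimately show ?thesis by (simp add: filterlim_split_at)
qed

text \<open>With \<open>u = 1 / t\<close>, differentiation turns \<open>p u * exp (- u)\<close> into \<open>u\<^sup>2 * (p u - p' u) * exp (- u)\<close>. At \<open>0\<close>
  the difference quotient is the member of the family with polynomial \<open>u * p u\<close>, which tends to \<open>0\<close>.\<close>

lemma flat_exp_has_derivative:
  "(flat_exp p has_real_derivative flat_exp ([:0, 0, 1:] * (p - pderiv p)) t) (at t)"
proof -
  consider "t > 0" | "t < 0" | "t = 0" by linarith
  then show ?thesis
  proof cases
    case 1
    have "((\<lambda>t. poly p (1 / t) * exp (- (1 / t))) has_real_derivative
        flat_exp ([:0, 0, 1:] * (p - pderiv p)) t) (at t)"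
      using 1 by (auto intro!: derivative_eq_intros poly_DERIV[THEN DERIV_chain2] simp: flat_exp_def field_simps power2_eq_square)
    then show ?thesis
      by (rule has_field_derivative_transform_within_open[of _ _ _ "{0<..}"])
         (use 1 in \<open>auto simp: flat_exp_def\<close>)
  next
    case 2
    have "((\<lambda>t. 0) has_real_derivative flat_exp ([:0, 0, 1:] * (p - pderiv p)) t) (at t)"
      using 2 by (auto simp: flat_exp_def)
    then show ?thesis
      by (rule has_field_derivative_transform_within_open[of _ _ _ "{..<0}"])
         (use 2 in \<open>auto simp: flat_exp_def\<close>)
  next
    case 3
    have "((\<lambda>h. (flat_exp p (0 + h) - flat_exp p 0) / h) \<longlongrightarrow> 0) (at 0)"
      by (rule Lim_transform_eventually[OF flat_exp_tendsto_0[of "pCons 0 p"]])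
         (auto simp: flat_exp_def eventually_at_filter)
    then show ?thesis using 3 by (auto simp: DERIV_def flat_exp_def)
  qed
qed

lemma smooth_on_flat_exp: "smooth_on UNIV (flat_exp p)"
  unfolding smooth_on_def
proof
  fix k show "Ck_on k (flat_exp p) UNIV"
  proof (induction k arbitrary: p)
    case 0
    then show ?case using flat_exp_has_derivative DERIV_isCont continuous_at_imp_continuous_on
      by (metis Ck_on.simps(1))
  next
    case (Suc k)
    show ?case
      by (rule Ck_on_SucI[where D = "\<lambda>x v. flat_exp ([:0, 0, 1:] * (p - pderiv p)) x * v"])
         (use flat_exp_has_derivative[THEN has_field_derivative_imp_has_derivative]
          in \<open>auto intro!: Ck_on_bilinear[OF _ bounded_bilinear_mult] Suc Ck_on_const simp del: mult_pCons_left\<close>)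
  qed
qed

text \<open>With \<open>e t = exp (- 1 / t)\<close> for \<open>t > 0\<close>, the bump is
  \<open>e (R\<^sup>2 - |y - x|\<^sup>2) / (e (R\<^sup>2 - |y - x|\<^sup>2) + e (|y - x|\<^sup>2 - r\<^sup>2))\<close>; since \<open>r < R\<close>, the two summands
  of the denominator never vanish together.\<close>

lemma euclidean_bump_exists:
  fixes x :: "'e::euclidean_space"
  assumes "0 < r" "r < R"
  obtains \<beta> :: "'e \<Rightarrow> real" where "smooth_on UNIV \<beta>" "\<And>y. 0 \<le> \<beta> y" "\<And>y. \<beta> y \<le> 1"
    "\<And>y. y \<in> cball x r \<Longrightarrow> \<beta> y = 1" "\<And>y. y \<notin> ball x R \<Longrightarrow> \<beta> y = 0"
proof -
  define e where "e = flat_exp 1"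
  have e: "smooth_on UNIV e" "\<And>t. t > 0 \<Longrightarrow> e t > 0" "\<And>t. t \<le> 0 \<Longrightarrow> e t = 0" "\<And>t. 0 \<le> e t"
    unfolding e_def using smooth_on_flat_exp by (auto simp: flat_exp_def)
  define q where "q y = (y - x) \<bullet> (y - x)" for y
  have q: "smooth_on UNIV q"
    unfolding q_def by (intro smooth_on_inner smooth_on_diff smooth_on_ident smooth_on_const open_UNIV)
  have q_norm: "q y = (dist x y)\<^sup>2" for y
    by (metis q_def dist_norm dist_commute power2_norm_eq_inner)
  have rR: "r\<^sup>2 < R\<^sup>2" using assms by (simp add: power_strict_mono)
  define n where "n y = e (R\<^sup>2 - q y)" for y
  define d where "d y = e (q y - r\<^sup>2)" for y
  have nd: "smooth_on UNIV n" "smooth_on UNIV d"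
    unfolding n_def d_def
    by (rule smooth_on_compose[OF e(1)]; auto intro!: smooth_on_diff smooth_on_const q)+
  have pos: "n y + d y > 0" for y
  proof (cases "q y < R\<^sup>2")
    case True
    then show ?thesis using e(2)[of "R\<^sup>2 - q y"] e(4)[of "q y - r\<^sup>2"] unfolding n_def d_def by linarith
  next
    case False
    then show ?thesis using rR e(4)[of "R\<^sup>2 - q y"] e(2)[of "q y - r\<^sup>2"] unfolding n_def d_def by linarith
  qed
  have ge: "0 \<le> n y" "0 \<le> d y" for y using e(4) n_def d_def by auto
  show thesis
  proof (rule that[of "\<lambda>y. n y / (n y + d y)"])
    show "smooth_on UNIV (\<lambda>y. n y / (n y + d y))"
      using pos by (intro smooth_on_divide smooth_on_add nd open_UNIV) (metis less_irrefl)
    show "0 \<le> n y / (n y + d y)" for y using pos ge by (simp add: less_imp_le)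
    show "n y / (n y + d y) \<le> 1" for y using pos[of y] ge(2)[of y] by (simp add: divide_le_eq)
    show "n y / (n y + d y) = 1" if "y \<in> cball x r" for y
    proof -
      have "q y \<le> r\<^sup>2" using that by (simp add: q_norm power_mono)
      then have "d y = 0" using e(3) d_def by simp
      then show ?thesis using pos[of y] by simp
    qed
    show "n y / (n y + d y) = 0" if "y \<notin> ball x R" for y
    proof -
      have "R\<^sup>2 \<le> q y" using that assms by (simp add: q_norm power_mono)
      then have "n y = 0" using e(3) n_def by simp
      then show ?thesis by simp
    qed
  qed
qed

lemma has_derivative_partial:
  assumes "smooth_on UNIV H"
  shows "((\<lambda>y. H (y, t)) has_derivative (\<lambda>v. frechet_derivative H (at (y, t)) (v, 0))) (at y)"
proof -
  have "((\<lambda>y. (y, t)) has_derivative (\<lambda>v. (v, 0))) (at y)"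
    by (auto intro!: derivative_eq_intros)
  from has_derivative_compose[OF this smooth_on_has_derivative[OF assms]] show ?thesis by simp
qed

text \<open>The derivative in a direction \<open>v\<close> is the integral of the partial derivative of \<open>H\<close> in the direction
  \<open>(v, 0)\<close>, which is again an integral of this form. This is why the induction is over all \<open>H\<close>.\<close>

lemma Ck_on_param_integral:
  fixes H :: "'e::euclidean_space \<times> real \<Rightarrow> real"
  assumes "smooth_on UNIV H"
  shows "Ck_on k (\<lambda>y. integral {0..1} (\<lambda>t. H (y, t))) UNIV"
  using assms
proof (induction k arbitrary: H)
  case 0
  have "continuous_on (UNIV \<times> cbox 0 1) (\<lambda>(y, t). H (y, t))"
    using smooth_on_imp_continuous_on[OF 0] continuous_on_subset by auto
  from integral_continuous_on_param[OF this] show ?case by simp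
next
  case (Suc k)
  define H' where "H' v = (\<lambda>z. frechet_derivative H (at z) (v, 0))" for v
  have H': "smooth_on UNIV (H' v)" for v
    unfolding H'_def by (rule smooth_on_frechet_derivative[OF Suc.prems])
  define B where "B y t = Blinfun (\<lambda>v. H' v (y, t))" for y t
  have B: "blinfun_apply (B y t) = (\<lambda>v. H' v (y, t))" for y t
    unfolding B_def H'_def
    using bounded_linear_Blinfun_apply has_derivative_bounded_linear[OF has_derivative_partial[OF Suc.prems]] by blast
  have contB: "continuous_on UNIV (\<lambda>z. B (fst z) (snd z))"
    by (rule continuous_on_blinfun_componentwise) (simp add: B smooth_on_imp_continuous_on H')
  have "((\<lambda>y. integral {0..1} (\<lambda>t. H (y, t))) has_derivative (\<lambda>v. integral {0..1} (\<lambda>t. H' v (y, t)))) (at y)" for y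
  proof -
    have "((\<lambda>y. integral (cbox 0 1) (\<lambda>t. H (y, t))) has_derivative integral (cbox 0 1) (B y)) (at y within UNIV)"
    proof (rule leibniz_rule)
      show "((\<lambda>x. H (x, t)) has_derivative blinfun_apply (B x t)) (at x within UNIV)" for x t
        unfolding B unfolding H'_def using has_derivative_partial[OF Suc.prems] by simp
      show "(\<lambda>t. H (x, t)) integrable_on cbox 0 1" for x
        by (intro integrable_continuous continuous_on_compose2[OF smooth_on_imp_continuous_on[OF Suc.prems]] continuous_intros) auto
      show "continuous_on (UNIV \<times> cbox 0 1) (\<lambda>(x, t). B x t)"
        using continuous_on_subset[OF contB] by (auto simp: split_beta)
    qed auto
    moreover have "blinfun_apply (integral (cbox 0 1) (B y)) = (\<lambda>v. integral {0..1} (\<lambda>t. H' v (y, t)))"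
    proof
      fix v
      have "B y integrable_on cbox 0 1"
      proof (rule integrable_continuous)
        have "continuous_on (cbox 0 1) (\<lambda>t. (y, t))" by (intro continuous_intros)
        from continuous_on_compose2[OF contB this] show "continuous_on (cbox 0 1) (B y)" by simp
      qed
      from blinfun_apply_integral[OF this, of v]
      show "integral (cbox 0 1) (B y) v = integral {0..1} (\<lambda>t. H' v (y, t))" by (simp add: B)
    qed
    ultimately show ?thesis by simp
  qed
  then show ?case
    by (rule Ck_on_SucI[OF open_UNIV]) (rule Suc.IH[OF H'])
qed

text \<open>Apply the fundamental theorem of calculus to \<open>t \<mapsto> f (a + t (y - a))\<close>; \<open>g b y\<close> is the mean of the
  partial derivative in the direction \<open>b\<close> over the segment from \<open>a\<close> to \<open>y\<close>.\<close>

lemma hadamard: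
  fixes f :: "'e::euclidean_space \<Rightarrow> real"
  assumes f: "smooth_on UNIV f"
  obtains g :: "'e \<Rightarrow> 'e \<Rightarrow> real" where "\<And>b. smooth_on UNIV (g b)"
    "\<And>y. f y = f a + (\<Sum>b\<in>Basis. ((y - a) \<bullet> b) * g b y)"
    "\<And>b. g b a = frechet_derivative f (at a) b"
proof
  define c :: "'e \<times> real \<Rightarrow> 'e" where "c z = a + snd z *\<^sub>R (fst z - a)" for z
  have c: "smooth_on UNIV c"
    unfolding c_def
    by (intro smooth_on_add smooth_on_const smooth_on_scaleR smooth_on_diff
        smooth_on_linear[OF _ bounded_linear_snd smooth_on_ident] smooth_on_linear[OF _ bounded_linear_fst smooth_on_ident] open_UNIV)
  define H where "H b z = frechet_derivative f (at (c z)) b" for b z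
  have H: "smooth_on UNIV (H b)" for b
    unfolding H_def
    by (rule smooth_on_compose[OF smooth_on_frechet_derivative[OF f] c]) auto
  define g where "g b y = integral {0..1} (\<lambda>t. H b (y, t))" for b y
  show "smooth_on UNIV (g b)" for b
    unfolding g_def smooth_on_def using Ck_on_param_integral[OF H] by auto
  show "g b a = frechet_derivative f (at a) b" for b
    by (simp add: g_def H_def c_def)
  show "f y = f a + (\<Sum>b\<in>Basis. ((y - a) \<bullet> b) * g b y)" for y
  proof -
    have "((\<lambda>t. f (c (y, t))) has_vector_derivative (\<Sum>b\<in>Basis. ((y - a) \<bullet> b) * H b (y, t))) (at t)" for t
    proof -
      have 1: "((\<lambda>t. c (y, t)) has_vector_derivative (y - a)) (at t)"
        unfolding c_def by (auto intro!: derivative_eq_intros)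
      have 2: "(f has_derivative frechet_derivative f (at (c (y, t)))) (at (c (y, t)))"
        using smooth_on_has_derivative[OF f] by auto
      have lin: "linear (frechet_derivative f (at (c (y, t))))"
        using 2 has_derivative_linear by blast
      have "frechet_derivative f (at (c (y, t))) (y - a) = (\<Sum>b\<in>Basis. ((y - a) \<bullet> b) * H b (y, t))"
        unfolding H_def using linear_Basis_expansion[OF lin, of "y - a"] by simp
      moreover have "((f \<circ> (\<lambda>t. c (y, t))) has_vector_derivative frechet_derivative f (at (c (y, t))) (y - a)) (at t)"
        using vector_derivative_diff_chain_within[OF 1, of f] 2 has_derivative_at_withinI by blast
      ultimately show ?thesis by (simp add: o_def)
    qed
    then have "((\<lambda>t. \<Sum>b\<in>Basis. ((y - a) \<bullet> b) * H b (y, t)) has_integral f (c (y, 1)) - f (c (y, 0))) {0..1}"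
      by (intro fundamental_theorem_of_calculus) (auto intro: has_vector_derivative_at_within)
    then have "f y - f a = integral {0..1} (\<lambda>t. \<Sum>b\<in>Basis. ((y - a) \<bullet> b) * H b (y, t))"
      by (simp add: integral_unique c_def)
    also have "\<dots> = (\<Sum>b\<in>Basis. integral {0..1} (\<lambda>t. ((y - a) \<bullet> b) * H b (y, t)))"
    proof (rule integral_sum)
      show "(\<lambda>t. ((y - a) \<bullet> b) * H b (y, t)) integrable_on {0..1}" for b
        by (intro integrable_continuous_real continuous_intros
            continuous_on_compose2[OF smooth_on_imp_continuous_on[OF H]]) auto
    qed simp
    also have "\<dots> = (\<Sum>b\<in>Basis. ((y - a) \<bullet> b) * g b y)"
      by (simp add: g_def)
    finally show ?thesis by simp
  qed
qed

section \<open>Smooth maps between manifolds\<close>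

text \<open>Smoothness of a map with respect to two atlases refers to all charts of both of them. That there are
  charts around every point is what allows composing smooth maps through an intermediate atlas.\<close>

definition covering_atlas :: "('m::topological_space, 'e::euclidean_space) chart set \<Rightarrow> bool" where
  "covering_atlas \<A> \<longleftrightarrow> (\<forall>c\<in>\<A>. is_chart c) \<and> \<Union> (fst ` \<A>) = UNIV"

lemma covering_atlas_chart: "covering_atlas \<A> \<Longrightarrow> (U, \<phi>) \<in> \<A> \<Longrightarrow> is_chart (U, \<phi>)"
  by (auto simp: covering_atlas_def)

lemma covering_atlas_obtain:
  assumes "covering_atlas \<A>"
  obtains U \<phi> where "(U, \<phi>) \<in> \<A>" "x \<in> U"
proof -
  have "x \<in> \<Union> (fst ` \<A>)" using assms by (simp add: covering_atlas_def)
  then show thesis using that by auto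
qed

lemma smooth_manifold_covering: "smooth_manifold \<A> \<Longrightarrow> covering_atlas \<A>"
  by (simp add: smooth_manifold_def covering_atlas_def)

lemma is_chartD:
  assumes "is_chart (U, \<phi>)"
  shows "open U" "open (\<phi> ` U)" "continuous_on U \<phi>" "continuous_on (\<phi> ` U) (inv_into U \<phi>)"
    "inj_on \<phi> U" "x \<in> U \<Longrightarrow> inv_into U \<phi> (\<phi> x) = x"
  using assms by (auto simp: is_chart_def homeomorphism_def intro: inj_on_inverseI[of _ "inv_into U \<phi>"])

lemma is_chart_open_image:
  assumes "is_chart (U, \<phi>)" "open W"
  shows "open (\<phi> ` (U \<inter> W))"
proof -
  have "homeomorphism U (\<phi> ` U) \<phi> (inv_into U \<phi>)"
    using assms(1) by (simp add: is_chart_def)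
  then have "openin (top_of_set (\<phi> ` U)) (\<phi> ` (U \<inter> W))"
    using assms(2) by (intro homeomorphism_imp_open_map) (auto intro: openin_open_Int)
  then show ?thesis using is_chartD(2)[OF assms(1)] openin_open_trans by blast
qed

lemma covering_euclidean_atlas: "covering_atlas (euclidean_atlas :: ('e::euclidean_space, 'e) chart set)"
proof -
  have "inv_into UNIV (\<lambda>x::'e. x) = (\<lambda>x. x)" using inv_id by (simp add: id_def)
  then show ?thesis
    by (auto simp: covering_atlas_def euclidean_atlas_def is_chart_def homeomorphism_def)
qed

lemma continuous_on_open_vimage_Int:
  "continuous_on U F \<Longrightarrow> open U \<Longrightarrow> open Y \<Longrightarrow> open (U \<inter> F -` Y)"
  using continuous_open_preimage by blast

lemma smooth_map_onI:
  assumes "continuous_on U F"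
    and "\<And>V \<phi> Z \<psi>. (V, \<phi>) \<in> \<A> \<Longrightarrow> (Z, \<psi>) \<in> \<B> \<Longrightarrow>
      smooth_on (\<phi> ` (V \<inter> U \<inter> F -` Z)) (\<psi> \<circ> F \<circ> inv_into V \<phi>)"
  shows "smooth_map_on \<A> \<B> U F"
  using assms by (auto simp: smooth_map_on_def)

lemma smooth_map_onD:
  assumes "smooth_map_on \<A> \<B> U F"
  shows "continuous_on U F"
    and "(V, \<phi>) \<in> \<A> \<Longrightarrow> (Z, \<psi>) \<in> \<B> \<Longrightarrow>
      smooth_on (\<phi> ` (V \<inter> U \<inter> F -` Z)) (\<psi> \<circ> F \<circ> inv_into V \<phi>)"
  using assms by (auto simp: smooth_map_on_def)

lemma smooth_map_on_subset:
  assumes "smooth_map_on \<A> \<B> U F" "W \<subseteq> U"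
  shows "smooth_map_on \<A> \<B> W F"
proof (rule smooth_map_onI)
  show "continuous_on W F" using assms continuous_on_subset smooth_map_onD(1) by blast
  show "smooth_on (\<phi> ` (V \<inter> W \<inter> F -` Z)) (\<psi> \<circ> F \<circ> inv_into V \<phi>)"
    if "(V, \<phi>) \<in> \<A>" "(Z, \<psi>) \<in> \<B>" for V \<phi> Z \<psi>
    by (rule smooth_on_subset[OF smooth_map_onD(2)[OF assms(1) that]]) (use assms(2) in auto)
qed

lemma smooth_map_on_chart_domain_open:
  assumes "is_chart (V, \<phi>)" "is_chart (Z, \<psi>)" "open U" "continuous_on U F"
  shows "open (\<phi> ` (V \<inter> U \<inter> F -` Z))"
  using is_chart_open_image[OF assms(1) continuous_on_open_vimage_Int[OF assms(4,3) is_chartD(1)[OF assms(2)]]]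
  by (simp add: Int_assoc)

lemma smooth_map_on_cong:
  assumes "covering_atlas \<A>" "covering_atlas \<B>" "open U"
    and "smooth_map_on \<A> \<B> U F" "\<And>x. x \<in> U \<Longrightarrow> F x = H x"
  shows "smooth_map_on \<A> \<B> U H"
proof (rule smooth_map_onI)
  have cF: "continuous_on U F" using assms(4) by (rule smooth_map_onD)
  then show "continuous_on U H" using assms(5) by (simp add: continuous_on_cong[of U U F H])
  fix V \<phi> Z \<psi> assume c: "(V, \<phi>) \<in> \<A>" and d: "(Z, \<psi>) \<in> \<B>"
  have ch: "is_chart (V, \<phi>)" "is_chart (Z, \<psi>)" using c d assms covering_atlas_chart by auto
  have eq: "V \<inter> U \<inter> H -` Z = V \<inter> U \<inter> F -` Z" using assms(5) by auto
  show "smooth_on (\<phi> ` (V \<inter> U \<inter> H -` Z)) (\<psi> \<circ> H \<circ> inv_into V \<phi>)"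
    unfolding eq
  proof (rule smooth_on_cong[OF smooth_map_onD(2)[OF assms(4) c d]])
    show "open (\<phi> ` (V \<inter> U \<inter> F -` Z))" by (rule smooth_map_on_chart_domain_open[OF ch assms(3) cF])
  qed (use is_chartD(6)[OF ch(1)] assms(5) in auto)
qed

lemma smooth_map_on_local:
  assumes "covering_atlas \<A>" "covering_atlas \<B>"
    and "\<And>x. x \<in> U \<Longrightarrow> \<exists>N. open N \<and> x \<in> N \<and> smooth_map_on \<A> \<B> N F"
  shows "smooth_map_on \<A> \<B> U F"
proof (rule smooth_map_onI)
  obtain N where N: "\<And>x. x \<in> U \<Longrightarrow> open (N x) \<and> x \<in> N x \<and> smooth_map_on \<A> \<B> (N x) F"
    using assms(3) by metis
  have "continuous_on (\<Union>x\<in>U. N x) F"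
    using N by (intro continuous_on_open_UN) (auto intro: smooth_map_onD(1))
  then show "continuous_on U F" by (rule continuous_on_subset) (use N in auto)
  fix V \<phi> Z \<psi> assume c: "(V, \<phi>) \<in> \<A>" and d: "(Z, \<psi>) \<in> \<B>"
  have ch: "is_chart (V, \<phi>)" "is_chart (Z, \<psi>)" using c d assms covering_atlas_chart by auto
  show "smooth_on (\<phi> ` (V \<inter> U \<inter> F -` Z)) (\<psi> \<circ> F \<circ> inv_into V \<phi>)"
  proof (rule smooth_on_local)
    fix y assume "y \<in> \<phi> ` (V \<inter> U \<inter> F -` Z)"
    then obtain x where x: "x \<in> V" "x \<in> U" "F x \<in> Z" "y = \<phi> x" by auto
    obtain N where N: "open N" "x \<in> N" "smooth_map_on \<A> \<B> N F" using assms(3)[OF x(2)] by auto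
    show "\<exists>T. open T \<and> y \<in> T \<and> smooth_on T (\<psi> \<circ> F \<circ> inv_into V \<phi>)"
      using smooth_map_on_chart_domain_open[OF ch N(1) smooth_map_onD(1)[OF N(3)]]
        smooth_map_onD(2)[OF N(3) c d] x N(2) by blast
  qed
qed

text \<open>Around a point the composition is read through a chart of \<open>\<B>\<close> at its image, on the open set where this
  chart applies; smoothness in the given charts of \<open>\<A>\<close> and \<open>\<C>\<close> then follows since it is local.\<close>

lemma smooth_map_on_compose:
  assumes "covering_atlas \<A>" "covering_atlas \<B>" "covering_atlas \<C>" "open U" "open U'" "F ` U \<subseteq> U'"
    and F: "smooth_map_on \<A> \<B> U F" and H: "smooth_map_on \<B> \<C> U' H"
  shows "smooth_map_on \<A> \<C> U (\<lambda>x. H (F x))"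
proof (rule smooth_map_onI)
  have cF: "continuous_on U F" and cH: "continuous_on U' H" using F H smooth_map_onD(1) by auto
  then show "continuous_on U (\<lambda>x. H (F x))" using assms(6) continuous_on_compose2 by blast
  fix V \<phi> Z \<xi> assume c: "(V, \<phi>) \<in> \<A>" and d: "(Z, \<xi>) \<in> \<C>"
  have ch: "is_chart (V, \<phi>)" "is_chart (Z, \<xi>)" using c d assms covering_atlas_chart by auto
  show "smooth_on (\<phi> ` (V \<inter> U \<inter> (\<lambda>x. H (F x)) -` Z)) (\<xi> \<circ> (\<lambda>x. H (F x)) \<circ> inv_into V \<phi>)"
  proof (rule smooth_on_local)
    fix y assume "y \<in> \<phi> ` (V \<inter> U \<inter> (\<lambda>x. H (F x)) -` Z)"
    then obtain x where x: "x \<in> V" "x \<in> U" "H (F x) \<in> Z" "y = \<phi> x" by auto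
    obtain Y \<psi> where Y: "(Y, \<psi>) \<in> \<B>" "F x \<in> Y" using covering_atlas_obtain[OF assms(2)] .
    have chY: "is_chart (Y, \<psi>)" using Y assms covering_atlas_chart by auto
    define Q where "Q = Y \<inter> (U' \<inter> H -` Z)"
    have oQ: "open Q" unfolding Q_def
      using is_chartD(1)[OF chY] continuous_on_open_vimage_Int[OF cH assms(5) is_chartD(1)[OF ch(2)]] by auto
    define T where "T = \<phi> ` (V \<inter> (U \<inter> F -` Q))"
    have oT: "open T" unfolding T_def
      by (rule is_chart_open_image[OF ch(1) continuous_on_open_vimage_Int[OF cF assms(4) oQ]])
    have yT: "y \<in> T" unfolding T_def Q_def using x Y assms(6) by auto
    have "smooth_on T (\<lambda>y. (\<xi> \<circ> H \<circ> inv_into Y \<psi>) ((\<psi> \<circ> F \<circ> inv_into V \<phi>) y))"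
    proof (rule smooth_on_compose[where g = "\<xi> \<circ> H \<circ> inv_into Y \<psi>" and f = "\<psi> \<circ> F \<circ> inv_into V \<phi>"])
      show "smooth_on (\<psi> ` (Y \<inter> U' \<inter> H -` Z)) (\<xi> \<circ> H \<circ> inv_into Y \<psi>)"
        by (rule smooth_map_onD(2)[OF H Y(1) d])
      show "open (\<psi> ` (Y \<inter> U' \<inter> H -` Z))"
        by (rule smooth_map_on_chart_domain_open[OF chY ch(2) assms(5) cH])
      show "smooth_on T (\<psi> \<circ> F \<circ> inv_into V \<phi>)"
        by (rule smooth_on_subset[OF smooth_map_onD(2)[OF F c Y(1)]]) (auto simp: T_def Q_def)
      show "(\<psi> \<circ> F \<circ> inv_into V \<phi>) ` T \<subseteq> \<psi> ` (Y \<inter> U' \<inter> H -` Z)"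
        using is_chartD(6)[OF ch(1)] by (auto simp: T_def Q_def)
    qed (rule oT)
    then have "smooth_on T (\<xi> \<circ> (\<lambda>x. H (F x)) \<circ> inv_into V \<phi>)"
      by (rule smooth_on_cong[OF _ oT])
         (use is_chartD(6)[OF ch(1)] is_chartD(6)[OF chY] in \<open>auto simp: T_def Q_def\<close>)
    then show "\<exists>T. open T \<and> y \<in> T \<and> smooth_on T (\<xi> \<circ> (\<lambda>x. H (F x)) \<circ> inv_into V \<phi>)"
      using oT yT by blast
  qed
qed

lemma inv_into_map_prod:
  assumes "inj_on \<phi> U" "inj_on \<psi> V" "a \<in> \<phi> ` U" "b \<in> \<psi> ` V"
  shows "inv_into (U \<times> V) (map_prod \<phi> \<psi>) (a, b) = (inv_into U \<phi> a, inv_into V \<psi> b)"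
  using assms by (intro inv_into_f_eq map_prod_inj_on) (auto simp: inv_into_into f_inv_into_f)

lemma is_chart_prod:
  assumes "is_chart (U, \<phi>)" "is_chart (V, \<psi>)"
  shows "is_chart (U \<times> V, map_prod \<phi> \<psi>)"
proof -
  note D = is_chartD[OF assms(1)] is_chartD[OF assms(2)]
  have im: "map_prod \<phi> \<psi> ` (U \<times> V) = \<phi> ` U \<times> \<psi> ` V" by (rule map_prod_surj_on[OF refl refl])
  have inv: "inv_into (U \<times> V) (map_prod \<phi> \<psi>) z = (inv_into U \<phi> (fst z), inv_into V \<psi> (snd z))"
    if "z \<in> \<phi> ` U \<times> \<psi> ` V" for z
    using inv_into_map_prod[OF D(5) D(11), of "fst z" "snd z"] that by auto
  have c1: "continuous_on (U \<times> V) (map_prod \<phi> \<psi>)"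
    unfolding map_prod_def case_prod_beta
    by (intro continuous_on_Pair continuous_on_compose2[OF D(3)] continuous_on_compose2[OF D(9)]
        continuous_on_fst continuous_on_snd continuous_on_id) auto
  have "continuous_on (\<phi> ` U \<times> \<psi> ` V) (\<lambda>z. (inv_into U \<phi> (fst z), inv_into V \<psi> (snd z)))"
    by (intro continuous_on_Pair continuous_on_compose2[OF D(4)] continuous_on_compose2[OF D(10)]
        continuous_on_fst continuous_on_snd continuous_on_id) auto
  then have c2: "continuous_on (\<phi> ` U \<times> \<psi> ` V) (inv_into (U \<times> V) (map_prod \<phi> \<psi>))"
    by (rule continuous_on_eq) (simp add: inv)
  have inj: "inj_on (map_prod \<phi> \<psi>) (U \<times> V)" using D(5,11) by (rule map_prod_inj_on)
  have "homeomorphism (U \<times> V) (map_prod \<phi> \<psi> ` (U \<times> V)) (map_prod \<phi> \<psi>) (inv_into (U \<times> V) (map_prod \<phi> \<psi>))"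
    using c1 c2 inj unfolding im[symmetric]
    by (intro homeomorphismI) (auto simp: inv_into_f_f f_inv_into_f inv_into_into)
  then show ?thesis using D(1,2,7,8) unfolding is_chart_def by (auto simp: im open_Times)
qed

lemma covering_prod_atlas:
  assumes "covering_atlas \<A>" "covering_atlas \<B>"
  shows "covering_atlas (prod_atlas \<A> \<B>)"
proof -
  have "is_chart c" if "c \<in> prod_atlas \<A> \<B>" for c
    using that covering_atlas_chart[OF assms(1)] covering_atlas_chart[OF assms(2)]
    unfolding prod_atlas_def by (auto intro!: is_chart_prod)
  moreover have "z \<in> \<Union> (fst ` prod_atlas \<A> \<B>)" for z
  proof -
    obtain U \<phi> where "(U, \<phi>) \<in> \<A>" "fst z \<in> U" using covering_atlas_obtain[OF assms(1)] .
    moreover obtain V \<psi> where "(V, \<psi>) \<in> \<B>" "snd z \<in> V" using covering_atlas_obtain[OF assms(2)] .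
    ultimately have "(U \<times> V, map_prod \<phi> \<psi>) \<in> prod_atlas \<A> \<B>" "z \<in> U \<times> V"
      by (auto simp: prod_atlas_def mem_Times_iff)
    then show ?thesis by force
  qed
  ultimately show ?thesis by (auto simp: covering_atlas_def)
qed

lemma prod_euclidean_atlas: "prod_atlas euclidean_atlas euclidean_atlas = euclidean_atlas"
proof -
  have "map_prod (\<lambda>x. x) (\<lambda>x. x) = (\<lambda>x. x)" by (auto simp: fun_eq_iff)
  then show ?thesis by (auto simp: prod_atlas_def euclidean_atlas_def)
qed

lemma smooth_map_on_Pair:
  assumes "covering_atlas \<A>" "covering_atlas \<B>" "covering_atlas \<C>" "open U"
    and F: "smooth_map_on \<A> \<B> U F" and H: "smooth_map_on \<A> \<C> U H"
  shows "smooth_map_on \<A> (prod_atlas \<B> \<C>) U (\<lambda>x. (F x, H x))"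
proof (rule smooth_map_onI)
  have cF: "continuous_on U F" and cH: "continuous_on U H" using F H smooth_map_onD(1) by auto
  then show cFH: "continuous_on U (\<lambda>x. (F x, H x))" by (rule continuous_on_Pair)
  fix V \<phi> Z \<xi> assume c: "(V, \<phi>) \<in> \<A>" and d: "(Z, \<xi>) \<in> prod_atlas \<B> \<C>"
  obtain Z1 \<psi>1 Z2 \<psi>2 where Z: "Z = Z1 \<times> Z2" "\<xi> = map_prod \<psi>1 \<psi>2" "(Z1, \<psi>1) \<in> \<B>" "(Z2, \<psi>2) \<in> \<C>"
    using d by (auto simp: prod_atlas_def)
  have ch: "is_chart (V, \<phi>)" "is_chart (Z, \<xi>)"
    using c d assms covering_atlas_chart covering_prod_atlas by blast+
  let ?A = "\<phi> ` (V \<inter> U \<inter> (\<lambda>x. (F x, H x)) -` Z)"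
  have o: "open ?A" by (rule smooth_map_on_chart_domain_open[OF ch assms(4) cFH])
  have "smooth_on ?A (\<lambda>y. ((\<psi>1 \<circ> F \<circ> inv_into V \<phi>) y, (\<psi>2 \<circ> H \<circ> inv_into V \<phi>) y))"
    by (intro smooth_on_Pair[OF o] smooth_on_subset[OF smooth_map_onD(2)[OF F c Z(3)]]
        smooth_on_subset[OF smooth_map_onD(2)[OF H c Z(4)]]) (auto simp: Z(1))
  then show "smooth_on ?A (\<xi> \<circ> (\<lambda>x. (F x, H x)) \<circ> inv_into V \<phi>)"
    by (simp add: Z(2) o_def)
qed

lemma smooth_map_on_const:
  assumes "covering_atlas \<A>" "covering_atlas \<B>" "open U"
  shows "smooth_map_on \<A> \<B> U (\<lambda>x. c)"
proof (rule smooth_map_onI)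
  fix V \<phi> Z \<psi> assume c: "(V, \<phi>) \<in> \<A>" and d: "(Z, \<psi>) \<in> \<B>"
  have ch: "is_chart (V, \<phi>)" "is_chart (Z, \<psi>)" using c d assms covering_atlas_chart by auto
  show "smooth_on (\<phi> ` (V \<inter> U \<inter> (\<lambda>x. c) -` Z)) (\<psi> \<circ> (\<lambda>x. c) \<circ> inv_into V \<phi>)"
    using smooth_on_const[OF smooth_map_on_chart_domain_open[OF ch assms(3), of "\<lambda>x. c"]]
    unfolding o_def by (simp del: vimage_const)
qed simp

lemma smooth_map_on_ident:
  assumes "smooth_manifold \<A>"
  shows "smooth_map_on \<A> \<A> U (\<lambda>x. x)"
proof (rule smooth_map_onI)
  fix V \<phi> Z \<psi> assume c: "(V, \<phi>) \<in> \<A>" and d: "(Z, \<psi>) \<in> \<A>"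
  have "smooth_on (\<phi> ` (V \<inter> Z)) (\<psi> \<circ> inv_into V \<phi>)"
    using assms c d by (auto simp: smooth_manifold_def)
  then have "smooth_on (\<phi> ` (V \<inter> U \<inter> (\<lambda>x. x) -` Z)) (\<psi> \<circ> inv_into V \<phi>)"
    by (rule smooth_on_subset) auto
  then show "smooth_on (\<phi> ` (V \<inter> U \<inter> (\<lambda>x. x) -` Z)) (\<psi> \<circ> (\<lambda>x. x) \<circ> inv_into V \<phi>)"
    by (simp add: o_def)
qed simp

lemma smooth_map_on_euclidean_iff:
  "smooth_map_on euclidean_atlas euclidean_atlas U F \<longleftrightarrow> smooth_on U F"
proof -
  have "inv_into UNIV (\<lambda>x::'a. x) = (\<lambda>x. x)" using inv_id by (simp add: id_def)
  then show ?thesis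
    using smooth_on_imp_continuous_on by (auto simp: smooth_map_on_def euclidean_atlas_def o_def)
qed

lemma smooth_manifold_euclidean_atlas: "smooth_manifold (euclidean_atlas :: ('e::euclidean_space, 'e) chart set)"
proof -
  have "inv_into UNIV (\<lambda>x::'e. x) = (\<lambda>x. x)" using inv_id by (simp add: id_def)
  then have "\<forall>(U, \<phi>)\<in>euclidean_atlas. \<forall>(V, \<psi>)\<in>euclidean_atlas. smooth_on (\<phi> ` (U \<inter> V)) (\<psi> \<circ> inv_into U (\<phi> :: 'e \<Rightarrow> 'e))"
    by (auto simp: euclidean_atlas_def o_def smooth_on_ident)
  then show ?thesis using covering_euclidean_atlas[where 'e = 'e]
    by (simp add: smooth_manifold_def covering_atlas_def)
qed

lemma smooth_map_on_compose_euclidean: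
  assumes "covering_atlas \<A>" "open U" "open S" "smooth_map_on \<A> euclidean_atlas U F" "smooth_on S g" "F ` U \<subseteq> S"
  shows "smooth_map_on \<A> euclidean_atlas U (\<lambda>x. g (F x))"
  using smooth_map_on_compose[OF assms(1) covering_euclidean_atlas covering_euclidean_atlas assms(2,3,6,4)]
    smooth_map_on_euclidean_iff assms(5) by blast

section \<open>Smooth functions\<close>

lemma smooth_fun_on_subset: "smooth_fun_on \<A> U f \<Longrightarrow> W \<subseteq> U \<Longrightarrow> smooth_fun_on \<A> W f"
  unfolding smooth_fun_on_def by (rule smooth_map_on_subset)

lemma smooth_fun_on_cong:
  "covering_atlas \<A> \<Longrightarrow> open U \<Longrightarrow> smooth_fun_on \<A> U f \<Longrightarrow> (\<And>x. x \<in> U \<Longrightarrow> f x = g x) \<Longrightarrow> smooth_fun_on \<A> U g"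
  unfolding smooth_fun_on_def by (rule smooth_map_on_cong[OF _ covering_euclidean_atlas])

lemma smooth_fun_on_local:
  "covering_atlas \<A> \<Longrightarrow> (\<And>x. x \<in> U \<Longrightarrow> \<exists>N. open N \<and> x \<in> N \<and> smooth_fun_on \<A> N f) \<Longrightarrow> smooth_fun_on \<A> U f"
  unfolding smooth_fun_on_def by (rule smooth_map_on_local[OF _ covering_euclidean_atlas])

lemma smooth_fun_on_const: "covering_atlas \<A> \<Longrightarrow> open U \<Longrightarrow> smooth_fun_on \<A> U (\<lambda>x. c)"
  unfolding smooth_fun_on_def by (rule smooth_map_on_const[OF _ covering_euclidean_atlas])

lemma smooth_fun_on_compose2:
  assumes "covering_atlas \<A>" "open U" "open S" "smooth_fun_on \<A> U f" "smooth_fun_on \<A> U g"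
    "smooth_on S (\<lambda>z. op (fst z) (snd z))" "\<And>x. x \<in> U \<Longrightarrow> (f x, g x) \<in> S"
  shows "smooth_fun_on \<A> U (\<lambda>x. op (f x) (g x) :: real)"
proof -
  have "smooth_map_on \<A> euclidean_atlas U (\<lambda>x. (f x, g x))"
    using smooth_map_on_Pair[OF assms(1) covering_euclidean_atlas covering_euclidean_atlas assms(2)] assms(4,5)
    by (simp add: smooth_fun_on_def prod_euclidean_atlas)
  from smooth_map_on_compose_euclidean[OF assms(1,2,3) this assms(6)] assms(7)
  show ?thesis by (auto simp: smooth_fun_on_def)
qed

lemma smooth_on_fst: "open S \<Longrightarrow> smooth_on S fst"
  by (rule smooth_on_linear[OF _ bounded_linear_fst smooth_on_ident])

lemma smooth_on_snd: "open S \<Longrightarrow> smooth_on S snd"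
  by (rule smooth_on_linear[OF _ bounded_linear_snd smooth_on_ident])

lemma smooth_fun_on_add:
  "covering_atlas \<A> \<Longrightarrow> open U \<Longrightarrow> smooth_fun_on \<A> U f \<Longrightarrow> smooth_fun_on \<A> U g \<Longrightarrow> smooth_fun_on \<A> U (\<lambda>x. f x + g x)"
  by (rule smooth_fun_on_compose2[where S = UNIV]) (auto intro!: smooth_on_add smooth_on_fst smooth_on_snd)

lemma smooth_fun_on_diff:
  "covering_atlas \<A> \<Longrightarrow> open U \<Longrightarrow> smooth_fun_on \<A> U f \<Longrightarrow> smooth_fun_on \<A> U g \<Longrightarrow> smooth_fun_on \<A> U (\<lambda>x. f x - g x)"
  by (rule smooth_fun_on_compose2[where S = UNIV]) (auto intro!: smooth_on_diff smooth_on_fst smooth_on_snd)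

lemma smooth_fun_on_mult:
  "covering_atlas \<A> \<Longrightarrow> open U \<Longrightarrow> smooth_fun_on \<A> U f \<Longrightarrow> smooth_fun_on \<A> U g \<Longrightarrow> smooth_fun_on \<A> U (\<lambda>x. f x * g x)"
  by (rule smooth_fun_on_compose2[where S = UNIV]) (auto intro!: smooth_on_mult smooth_on_fst smooth_on_snd)

lemma smooth_fun_on_divide:
  assumes "covering_atlas \<A>" "open U" "smooth_fun_on \<A> U f" "smooth_fun_on \<A> U g" "\<And>x. x \<in> U \<Longrightarrow> g x \<noteq> 0"
  shows "smooth_fun_on \<A> U (\<lambda>x. f x / g x)"
proof (rule smooth_fun_on_compose2[where S = "UNIV \<times> (- {0})", OF assms(1,2) _ assms(3,4)])
  show o: "open (UNIV \<times> (- {0}) :: (real \<times> real) set)" by (intro open_Times) auto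
  show "smooth_on (UNIV \<times> (- {0})) (\<lambda>z. fst z / snd z :: real)"
    by (intro smooth_on_divide smooth_on_fst smooth_on_snd o) auto
qed (use assms(5) in auto)

lemma smooth_fun_on_sum:
  assumes "covering_atlas \<A>" "open U" "finite I" "\<And>i. i \<in> I \<Longrightarrow> smooth_fun_on \<A> U (f i)"
  shows "smooth_fun_on \<A> U (\<lambda>x. \<Sum>i\<in>I. f i x)"
  using assms(3,4)
  by (induction I rule: finite_induct)
     (auto simp: smooth_fun_on_const[OF assms(1,2)] smooth_fun_on_add[OF assms(1,2)])

lemma smooth_fun_on_compose:
  assumes "covering_atlas \<A>" "covering_atlas \<B>" "open U" "open U'" "F ` U \<subseteq> U'"
    "smooth_map_on \<A> \<B> U F" "smooth_fun_on \<B> U' f"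
  shows "smooth_fun_on \<A> U (\<lambda>x. f (F x))"
  using smooth_map_on_compose[OF assms(1,2) covering_euclidean_atlas assms(3,4,5,6)] assms(7)
  by (simp add: smooth_fun_on_def)

lemma smooth_fun_on_continuous: "smooth_fun_on \<A> U f \<Longrightarrow> continuous_on U f"
  unfolding smooth_fun_on_def by (rule smooth_map_onD(1))

section \<open>Coordinates and cut-off functions\<close>

text \<open>Coordinates that are compatible with an atlas without belonging to it, and with values in an arbitrary
  Euclidean space. The coordinates of a bundle that split off the base, for instance, take values in a
  product.\<close>

locale smooth_coordinates =
  fixes \<A> :: "('m::{t2_space,second_countable_topology}, 'e::euclidean_space) chart set"
    and V :: "'m set" and \<Phi> :: "'m \<Rightarrow> 'd::euclidean_space" and \<Psi> :: "'d \<Rightarrow> 'm"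
  assumes manifold: "smooth_manifold \<A>"
    and open_domain: "open V" and open_range: "open (\<Phi> ` V)"
    and smooth_coord: "smooth_map_on \<A> euclidean_atlas V \<Phi>"
    and smooth_param: "smooth_map_on euclidean_atlas \<A> (\<Phi> ` V) \<Psi>"
    and param_coord: "x \<in> V \<Longrightarrow> \<Psi> (\<Phi> x) = x"
begin

lemmas covering = smooth_manifold_covering[OF manifold]

lemma open_coord_image:
  assumes "open U" "U \<subseteq> V"
  shows "open (\<Phi> ` U)"
proof -
  have "\<Phi> ` U = \<Phi> ` V \<inter> \<Psi> -` U" using assms(2) param_coord by force
  then show ?thesis
    using continuous_on_open_vimage_Int[OF smooth_map_onD(1)[OF smooth_param] open_range assms(1)] by simp
qed

lemma smooth_on_param:
  assumes "open U" "U \<subseteq> V" "smooth_fun_on \<A> U f"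
  shows "smooth_on (\<Phi> ` U) (\<lambda>y. f (\<Psi> y))"
proof -
  have "smooth_fun_on euclidean_atlas (\<Phi> ` U) (\<lambda>y. f (\<Psi> y))"
  proof (rule smooth_fun_on_compose[OF covering_euclidean_atlas covering open_coord_image[OF assms(1,2)] assms(1)])
    show "\<Psi> ` \<Phi> ` U \<subseteq> U" using assms(2) param_coord by auto
    show "smooth_map_on euclidean_atlas \<A> (\<Phi> ` U) \<Psi>"
      by (rule smooth_map_on_subset[OF smooth_param]) (use assms(2) in auto)
  qed (rule assms(3))
  then show ?thesis by (simp add: smooth_fun_on_def smooth_map_on_euclidean_iff)
qed

lemma smooth_fun_on_coord:
  assumes "open U" "U \<subseteq> V" "smooth_on (\<Phi> ` U) g"
  shows "smooth_fun_on \<A> U (\<lambda>x. g (\<Phi> x))"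
  unfolding smooth_fun_on_def
  by (rule smooth_map_on_compose_euclidean[OF covering assms(1) open_coord_image[OF assms(1,2)]
        smooth_map_on_subset[OF smooth_coord assms(2)] assms(3)]) auto

definition coord_vec :: "'m \<Rightarrow> 'd \<Rightarrow> 'm tvec" where
  "coord_vec x w = (\<lambda>f. if smooth_fun \<A> f then frechet_derivative (\<lambda>y. f (\<Psi> y)) (at (\<Phi> x)) w else 0)"

end

lemma smooth_coordinates_chart:
  assumes "smooth_manifold \<A>" "(V, \<phi>) \<in> \<A>"
  shows "smooth_coordinates \<A> V \<phi> (inv_into V \<phi>)"
proof
  note ch = covering_atlas_chart[OF smooth_manifold_covering[OF assms(1)]]
  note D = is_chartD[OF ch[OF assms(2)]]
  have trans: "smooth_on (\<phi> ` (U \<inter> V)) (\<psi> \<circ> inv_into U \<phi>)"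
    if "(U, \<phi>) \<in> \<A>" "(V, \<psi>) \<in> \<A>" for U \<phi> V \<psi>
    using assms(1) that by (auto simp: smooth_manifold_def)
  show "smooth_manifold \<A>" by fact
  show "open V" "open (\<phi> ` V)" by (rule D)+
  show "inv_into V \<phi> (\<phi> x) = x" if "x \<in> V" for x using that D(6) by auto
  show "smooth_map_on \<A> euclidean_atlas V \<phi>"
  proof (rule smooth_map_onI[OF D(3)])
    fix U \<psi> and Z :: "'b set" and \<xi> assume "(U, \<psi>) \<in> \<A>" "(Z, \<xi>) \<in> euclidean_atlas"
    then show "smooth_on (\<psi> ` (U \<inter> V \<inter> \<phi> -` Z)) (\<xi> \<circ> \<phi> \<circ> inv_into U \<psi>)"
      using trans[OF _ assms(2)] by (auto simp: euclidean_atlas_def o_def)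
  qed
  show "smooth_map_on euclidean_atlas \<A> (\<phi> ` V) (inv_into V \<phi>)"
  proof (rule smooth_map_onI[OF D(4)])
    fix Z and U :: "'b set" and \<xi> \<psi> assume a: "(U, \<psi>) \<in> euclidean_atlas" "(Z, \<xi>) \<in> \<A>"
    have id: "inv_into UNIV (\<lambda>x::'b. x) = (\<lambda>x. x)" using inv_id by (simp add: id_def)
    have "smooth_on (\<phi> ` V \<inter> inv_into V \<phi> -` Z) (\<xi> \<circ> inv_into V \<phi>)"
      by (rule smooth_on_subset[OF trans[OF assms(2) a(2)]]) (use D(6) in auto)
    then show "smooth_on (\<psi> ` (U \<inter> \<phi> ` V \<inter> inv_into V \<phi> -` Z)) (\<xi> \<circ> inv_into V \<phi> \<circ> inv_into U \<psi>)"
      using a(1) by (simp add: euclidean_atlas_def id o_def)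
  qed
qed

text \<open>Transport a bump from a chart. It extends by \<open>0\<close> because the image of the closed ball under the inverse
  chart is compact and hence closed, the manifold being Hausdorff.\<close>

lemma smooth_bump_exists:
  assumes "smooth_manifold \<A>" "open U" "x \<in> U"
  obtains \<beta> O' K where "smooth_fun \<A> \<beta>" "open O'" "x \<in> O'" "O' \<subseteq> K" "closed K" "K \<subseteq> U"
    "\<And>y. 0 \<le> \<beta> y" "\<And>y. \<beta> y \<le> 1" "\<And>y. y \<in> O' \<Longrightarrow> \<beta> y = 1" "\<And>y. y \<notin> K \<Longrightarrow> \<beta> y = 0"
proof -
  note cov = smooth_manifold_covering[OF assms(1)]
  obtain V \<phi> where V: "(V, \<phi>) \<in> \<A>" "x \<in> V" using covering_atlas_obtain[OF cov] .
  interpret smooth_coordinates \<A> V \<phi> "inv_into V \<phi>"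
    by (rule smooth_coordinates_chart[OF assms(1) V(1)])
  have o: "open (\<phi> ` (V \<inter> U))"
    by (rule open_coord_image) (use open_domain assms in auto)
  obtain R where R: "R > 0" "cball (\<phi> x) R \<subseteq> \<phi> ` (V \<inter> U)"
    using open_contains_cball[THEN iffD1, OF o] V(2) assms(3) by blast
  obtain b :: "_ \<Rightarrow> real" where b: "smooth_on UNIV b" "\<And>y. 0 \<le> b y" "\<And>y. b y \<le> 1"
    "\<And>y. y \<in> cball (\<phi> x) (R / 2) \<Longrightarrow> b y = 1" "\<And>y. y \<notin> ball (\<phi> x) R \<Longrightarrow> b y = 0"
    using euclidean_bump_exists[of "R / 2" R "\<phi> x"] R(1) by auto
  define K where "K = inv_into V \<phi> ` cball (\<phi> x) R"
  have "compact K" unfolding K_def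
    by (rule compact_continuous_image[OF continuous_on_subset[OF smooth_map_onD(1)[OF smooth_param]]]) (use R in auto)
  then have K: "closed K" by (rule compact_imp_closed)
  have KVU: "K \<subseteq> V \<inter> U" unfolding K_def using R(2) param_coord by force
  have Kiff: "y \<in> K \<longleftrightarrow> \<phi> y \<in> cball (\<phi> x) R" if "y \<in> V" for y
    unfolding K_def using R(2) param_coord that by (force intro: image_eqI)
  define O' where "O' = V \<inter> \<phi> -` ball (\<phi> x) (R / 2)"
  define \<beta> where "\<beta> y = (if y \<in> V then b (\<phi> y) else 0)" for y
  have "smooth_fun_on \<A> UNIV \<beta>"
  proof (rule smooth_fun_on_local[OF cov])
    fix y show "\<exists>N. open N \<and> y \<in> N \<and> smooth_fun_on \<A> N \<beta>"
    proof (cases "y \<in> V")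
      case True
      have "smooth_fun_on \<A> V (\<lambda>y. b (\<phi> y))"
        by (rule smooth_fun_on_coord[OF open_domain order_refl smooth_on_subset[OF b(1)]]) simp
      then have "smooth_fun_on \<A> V \<beta>"
        by (rule smooth_fun_on_cong[OF cov open_domain]) (simp add: \<beta>_def)
      then show ?thesis using True open_domain by auto
    next
      case False
      have "\<beta> y = 0" if "y \<notin> K" for y
        using that Kiff[of y] b(5)[of "\<phi> y"] by (auto simp: \<beta>_def)
      then have "smooth_fun_on \<A> (- K) \<beta>"
        by (intro smooth_fun_on_cong[OF cov _ smooth_fun_on_const[OF cov, where c = 0]])
           (use K in \<open>auto simp: open_Compl\<close>)
      then show ?thesis using False K KVU by (intro exI[of _ "- K"]) auto
    qed
  qed
  moreover have "open O'"
    unfolding O'_def by (rule continuous_on_open_vimage_Int[OF smooth_map_onD(1)[OF smooth_coord] open_domain]) auto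
  moreover have "O' \<subseteq> K" using Kiff R(1) by (auto simp: O'_def)
  moreover have "\<beta> y = 1" if "y \<in> O'" for y using that b(4) by (auto simp: O'_def \<beta>_def)
  moreover have "\<beta> y = 0" if "y \<notin> K" for y
    using that Kiff[of y] b(5)[of "\<phi> y"] by (auto simp: \<beta>_def)
  moreover have "x \<in> O'" using V R by (auto simp: O'_def)
  ultimately show thesis
    using b(2,3) K KVU by (intro that[of \<beta> O' K]) (auto simp: \<beta>_def)
qed

lemma smooth_fun_cutoff:
  assumes "covering_atlas \<A>" "open U" "smooth_fun \<A> \<beta>" "closed K" "K \<subseteq> U"
    "\<And>y. y \<notin> K \<Longrightarrow> \<beta> y = 0" "smooth_fun_on \<A> U f"
  shows "smooth_fun \<A> (\<lambda>y. \<beta> y * f y)"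
proof (rule smooth_fun_on_local[OF assms(1)])
  fix y show "\<exists>N. open N \<and> y \<in> N \<and> smooth_fun_on \<A> N (\<lambda>y. \<beta> y * f y)"
  proof (cases "y \<in> U")
    case True
    then show ?thesis
      using smooth_fun_on_mult[OF assms(1,2) smooth_fun_on_subset[OF assms(3)] assms(7)] assms(2) by blast
  next
    case False
    have "smooth_fun_on \<A> (- K) (\<lambda>y. \<beta> y * f y)"
      by (intro smooth_fun_on_cong[OF assms(1) _ smooth_fun_on_const[OF assms(1), where c = 0]])
         (use assms(4,6) in \<open>auto simp: open_Compl\<close>)
    then show ?thesis using False assms(4,5) by (intro exI[of _ "- K"]) auto
  qed
qed

text \<open>Tangent vectors act on functions that are smooth on the whole manifold. Functions that are only defined
  locally, such as coordinates, enter through global ones that agree with them near a point.\<close>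

lemma smooth_fun_extend:
  assumes "smooth_manifold \<A>" "open U" "x \<in> U"
  obtains O' where "open O'" "x \<in> O'" "O' \<subseteq> U"
    "\<forall>f. smooth_fun_on \<A> U f \<longrightarrow> (\<exists>g. smooth_fun \<A> g \<and> (\<forall>y\<in>O'. g y = f y))"
proof -
  obtain \<beta> O' K where b: "smooth_fun \<A> \<beta>" "open O'" "x \<in> O'" "O' \<subseteq> K" "closed K" "K \<subseteq> U"
    "\<And>y. y \<in> O' \<Longrightarrow> \<beta> y = 1" "\<And>y. y \<notin> K \<Longrightarrow> \<beta> y = 0"
    using smooth_bump_exists[OF assms] by metis
  have "\<exists>g. smooth_fun \<A> g \<and> (\<forall>y\<in>O'. g y = f y)" if "smooth_fun_on \<A> U f" for f
    using smooth_fun_cutoff[OF smooth_manifold_covering[OF assms(1)] assms(2) b(1,5,6,8) that] b(7)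
    by (intro exI[of _ "\<lambda>y. \<beta> y * f y"]) auto
  then show thesis using that[of O'] b by auto
qed

section \<open>Tangent vectors\<close>

lemma tangent_space_add: "v \<in> tangent_space \<A> x \<Longrightarrow> smooth_fun \<A> f \<Longrightarrow> smooth_fun \<A> g \<Longrightarrow> v (\<lambda>y. f y + g y) = v f + v g"
  by (simp add: tangent_space_def)

lemma tangent_space_cmult: "v \<in> tangent_space \<A> x \<Longrightarrow> smooth_fun \<A> f \<Longrightarrow> v (\<lambda>y. c * f y) = c * v f"
  by (simp add: tangent_space_def)

lemma tangent_space_mult: "v \<in> tangent_space \<A> x \<Longrightarrow> smooth_fun \<A> f \<Longrightarrow> smooth_fun \<A> g \<Longrightarrow> v (\<lambda>y. f y * g y) = f x * v g + g x * v f"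
  by (simp add: tangent_space_def)

lemma tangent_space_not_smooth: "v \<in> tangent_space \<A> x \<Longrightarrow> \<not> smooth_fun \<A> f \<Longrightarrow> v f = 0"
  by (simp add: tangent_space_def)

lemma tangent_space_const:
  assumes "covering_atlas \<A>" "v \<in> tangent_space \<A> x"
  shows "v (\<lambda>y. c) = 0"
proof -
  have 1: "smooth_fun \<A> (\<lambda>y. 1)" by (rule smooth_fun_on_const[OF assms(1) open_UNIV])
  have "v (\<lambda>y. 1) = 0" using tangent_space_mult[OF assms(2) 1 1] by simp
  then show ?thesis using tangent_space_cmult[OF assms(2) 1, of c] by simp
qed

lemma tangent_space_sum:
  assumes "covering_atlas \<A>" "v \<in> tangent_space \<A> x" "finite I" "\<And>i. i \<in> I \<Longrightarrow> smooth_fun \<A> (f i)"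
  shows "v (\<lambda>y. \<Sum>i\<in>I. f i y) = (\<Sum>i\<in>I. v (f i))"
  using assms(3,4)
proof (induction I rule: finite_induct)
  case empty
  then show ?case using tangent_space_const[OF assms(1,2)] by simp
next
  case (insert i I)
  have "smooth_fun \<A> (\<lambda>y. \<Sum>i\<in>I. f i y)"
    by (rule smooth_fun_on_sum[OF assms(1) open_UNIV insert.hyps(1)]) (use insert.prems in auto)
  then show ?case
    using tangent_space_add[OF assms(2), of "f i" "\<lambda>y. \<Sum>i\<in>I. f i y"] insert by simp
qed

text \<open>Split \<open>h = \<beta> h + (1 - \<beta>) h\<close> with a bump \<beta> at \<open>x\<close> supported in \<open>U\<close>. The first summand is the same for
  \<open>h = f\<close> and \<open>h = g\<close>, and the Leibniz rule for the second one only involves \<open>h x\<close> because \<open>1 - \<beta>\<close>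
  vanishes at \<open>x\<close>.\<close>

lemma tangent_space_local:
  assumes "smooth_manifold \<A>" "v \<in> tangent_space \<A> x" "smooth_fun \<A> f" "smooth_fun \<A> g"
    "open U" "x \<in> U" "\<And>y. y \<in> U \<Longrightarrow> f y = g y"
  shows "v f = v g"
proof -
  note cov = smooth_manifold_covering[OF assms(1)]
  obtain \<beta> O' K where b: "smooth_fun \<A> \<beta>" "x \<in> O'" "K \<subseteq> U"
    "\<And>y. y \<in> O' \<Longrightarrow> \<beta> y = 1" "\<And>y. y \<notin> K \<Longrightarrow> \<beta> y = 0"
    using smooth_bump_exists[OF assms(1,5,6)] by metis
  have *: "v h = v (\<lambda>y. \<beta> y * h y) + h x * v (\<lambda>y. 1 - \<beta> y)" if h: "smooth_fun \<A> h" for h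
  proof -
    have s: "smooth_fun \<A> (\<lambda>y. 1 - \<beta> y)" "smooth_fun \<A> (\<lambda>y. \<beta> y * h y)"
      by (intro smooth_fun_on_diff smooth_fun_on_mult smooth_fun_on_const cov open_UNIV b(1) h)+
    then have s': "smooth_fun \<A> (\<lambda>y. (1 - \<beta> y) * h y)"
      by (intro smooth_fun_on_mult cov open_UNIV h)
    have "v (\<lambda>y. \<beta> y * h y + (1 - \<beta> y) * h y) = v (\<lambda>y. \<beta> y * h y) + v (\<lambda>y. (1 - \<beta> y) * h y)"
      by (rule tangent_space_add[OF assms(2) s(2) s'])
    also have "v (\<lambda>y. (1 - \<beta> y) * h y) = h x * v (\<lambda>y. 1 - \<beta> y)"
      using tangent_space_mult[OF assms(2) s(1) h] b(2,4) by simp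
    finally show ?thesis by (simp add: algebra_simps)
  qed
  have "\<beta> y * f y = \<beta> y * g y" for y
    using b(3) b(5)[of y] assms(7)[of y] by (cases "y \<in> K") auto
  then have "(\<lambda>y. \<beta> y * f y) = (\<lambda>y. \<beta> y * g y)" by (rule ext)
  then show ?thesis using *[OF assms(3)] *[OF assms(4)] assms(6,7) by simp
qed

lemma subspace_tangent_space: "subspace (tangent_space \<A> x)"
  unfolding subspace_def tangent_space_def
  by (auto simp: scaleR_fun_def algebra_simps zero_fun_def plus_fun_def)

context smooth_coordinates
begin

lemma coord_vec_in_tangent_space:
  assumes "x \<in> V"
  shows "coord_vec x w \<in> tangent_space \<A> x"
proof -
  have D: "((\<lambda>y. f (\<Psi> y)) has_derivative frechet_derivative (\<lambda>y. f (\<Psi> y)) (at (\<Phi> x))) (at (\<Phi> x))"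
    if "smooth_fun \<A> f" for f
    using smooth_on_has_derivative[OF smooth_on_param[OF open_domain order_refl smooth_fun_on_subset[OF that]]] assms by auto
  note s = smooth_fun_on_add[OF covering open_UNIV] smooth_fun_on_mult[OF covering open_UNIV]
    smooth_fun_on_const[OF covering open_UNIV]
  show ?thesis
    unfolding tangent_space_def mem_Collect_eq
  proof (intro conjI allI impI)
    fix f g assume f: "smooth_fun \<A> f" and g: "smooth_fun \<A> g"
    show "coord_vec x w (\<lambda>y. f y + g y) = coord_vec x w f + coord_vec x w g"
      using frechet_derivative_at[OF has_derivative_add[OF D[OF f] D[OF g]], symmetric]
      by (simp add: coord_vec_def f g s)
    show "coord_vec x w (\<lambda>y. f y * g y) = f x * coord_vec x w g + g x * coord_vec x w f"
      using frechet_derivative_at[OF has_derivative_mult[OF D[OF f] D[OF g]], symmetric]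
      by (simp add: coord_vec_def f g s param_coord assms)
  next
    fix c f assume f: "smooth_fun \<A> f"
    show "coord_vec x w (\<lambda>y. c * f y) = c * coord_vec x w f"
      using frechet_derivative_at[OF has_derivative_mult_right[OF D[OF f], of c], symmetric]
      by (simp add: coord_vec_def f s)
  qed (simp add: coord_vec_def)
qed

lemma linear_coord_vec:
  assumes "x \<in> V"
  shows "linear (coord_vec x)"
proof -
  have "linear (frechet_derivative (\<lambda>y. f (\<Psi> y)) (at (\<Phi> x)))" if "smooth_fun \<A> f" for f
    using smooth_on_has_derivative[OF smooth_on_param[OF open_domain order_refl smooth_fun_on_subset[OF that]]] assms
      has_derivative_linear by blast
  note lin = linear_add[OF this] linear_scale[OF this]
  show ?thesis
    by (rule linearI) (auto simp: fun_eq_iff coord_vec_def lin scaleR_fun_def plus_fun_def)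
qed

text \<open>The coordinates, made global with a single bump, recover \<open>w\<close> from \<open>coord_vec y w\<close> at all points near
  \<open>x\<close> at once. This makes the components of a smooth vector field smooth functions.\<close>

lemma coordinate_functions:
  assumes "x \<in> V"
  obtains \<kappa> O' where "open O'" "x \<in> O'" "O' \<subseteq> V" "\<forall>b. smooth_fun \<A> (\<kappa> b)"
    "\<forall>b. \<forall>y\<in>O'. \<kappa> b y = \<Phi> y \<bullet> b" "\<forall>y\<in>O'. \<forall>b w. coord_vec y w (\<kappa> b) = w \<bullet> b"
proof -
  obtain O' where O': "open O'" "x \<in> O'" "O' \<subseteq> V"
    "\<forall>f. smooth_fun_on \<A> V f \<longrightarrow> (\<exists>g. smooth_fun \<A> g \<and> (\<forall>y\<in>O'. g y = f y))"
    using smooth_fun_extend[OF manifold open_domain assms] by blast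
  have "smooth_fun_on \<A> V (\<lambda>y. \<Phi> y \<bullet> b)" for b
    by (rule smooth_fun_on_coord[OF open_domain order_refl])
       (intro smooth_on_inner smooth_on_ident smooth_on_const open_range)
  then have "\<forall>b. \<exists>g. smooth_fun \<A> g \<and> (\<forall>y\<in>O'. g y = \<Phi> y \<bullet> b)" using O'(4) by blast
  from choice[OF this] obtain \<kappa> where \<kappa>: "\<And>b. smooth_fun \<A> (\<kappa> b)" "\<And>b y. y \<in> O' \<Longrightarrow> \<kappa> b y = \<Phi> y \<bullet> b"
    by blast
  have cv: "coord_vec y w (\<kappa> b) = w \<bullet> b" if "y \<in> O'" for y w b
  proof -
    have "frechet_derivative (\<lambda>z. \<kappa> b (\<Psi> z)) (at (\<Phi> y)) = frechet_derivative (\<lambda>z. z \<bullet> b) (at (\<Phi> y))"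
      by (rule frechet_derivative_cong_open[OF open_coord_image[OF O'(1,3)]])
         (use that O'(3) param_coord \<kappa>(2) in auto)
    also have "\<dots> = (\<lambda>w. w \<bullet> b)"
      by (rule frechet_derivative_at[symmetric]) (auto intro!: derivative_eq_intros)
    finally show ?thesis by (simp add: coord_vec_def \<kappa>(1))
  qed
  show thesis by (rule that[OF O'(1,2,3)]) (use \<kappa> cv in auto)
qed

lemma coord_vec_inj:
  assumes "x \<in> V"
  shows "inj (coord_vec x)"
proof -
  obtain \<kappa> O' where \<kappa>: "x \<in> O'" "\<forall>y\<in>O'. \<forall>b w. coord_vec y w (\<kappa> b) = w \<bullet> b"
    by (rule coordinate_functions[OF assms])
  show ?thesis
  proof (rule injI)
    fix w w' assume eq: "coord_vec x w = coord_vec x w'"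
    have "w \<bullet> b = coord_vec x w (\<kappa> b)" for b using \<kappa> by simp
    moreover have "w' \<bullet> b = coord_vec x w (\<kappa> b)" for b using \<kappa> unfolding eq by simp
    ultimately have "w \<bullet> b = w' \<bullet> b" for b by simp
    then show "w = w'" using vector_eq_rdot by blast
  qed
qed

text \<open>By the lemma of Hadamard \<open>f\<close> is, near \<open>x\<close>, the constant \<open>f x\<close> plus a sum of products \<open>c b * G b\<close>, where
  \<open>c b\<close> is a coordinate function that vanishes at \<open>x\<close> and \<open>G b x\<close> is a partial derivative of \<open>f\<close>. The
  Leibniz rule then expresses \<open>v f\<close> through the values of \<open>v\<close> on the coordinate functions.\<close>

lemma tangent_space_eq_coord_vec:
  assumes x: "x \<in> V" and v: "v \<in> tangent_space \<A> x"
  shows "\<exists>w. v = coord_vec x w"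
proof -
  obtain \<kappa> O' where \<kappa>: "open O'" "x \<in> O'" "O' \<subseteq> V" and \<kappa>': "\<forall>b. smooth_fun \<A> (\<kappa> b)"
    "\<forall>b. \<forall>y\<in>O'. \<kappa> b y = \<Phi> y \<bullet> b" by (rule coordinate_functions[OF x])
  have \<kappa>_smooth: "smooth_fun \<A> (\<kappa> b)" for b using \<kappa>' by blast
  have \<kappa>_coord: "\<kappa> b y = \<Phi> y \<bullet> b" if "y \<in> O'" for b y using \<kappa>' that by blast
  define w where "w = (\<Sum>b\<in>Basis. v (\<kappa> b) *\<^sub>R b)"
  obtain E where E: "open E" "x \<in> E" "E \<subseteq> V"
    "\<forall>f. smooth_fun_on \<A> V f \<longrightarrow> (\<exists>g. smooth_fun \<A> g \<and> (\<forall>y\<in>E. g y = f y))"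
    using smooth_fun_extend[OF manifold open_domain x] by blast
  have "v f = coord_vec x w f" for f
  proof (cases "smooth_fun \<A> f")
    case f: True
    have fs: "smooth_on (\<Phi> ` V) (\<lambda>y. f (\<Psi> y))"
      by (rule smooth_on_param[OF open_domain order_refl smooth_fun_on_subset[OF f]]) simp
    obtain F T where F: "smooth_on UNIV F" and T: "open T" "\<Phi> x \<in> T" "T \<subseteq> \<Phi> ` V" "\<And>y. y \<in> T \<Longrightarrow> F y = f (\<Psi> y)"
    proof -
      obtain T where T: "open T" "\<Phi> x \<in> T" "T \<subseteq> \<Phi> ` V" "\<forall>f. smooth_fun_on euclidean_atlas (\<Phi> ` V) f \<longrightarrow> (\<exists>g. smooth_fun euclidean_atlas g \<and> (\<forall>y\<in>T. g y = f y))"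
        using smooth_fun_extend[OF smooth_manifold_euclidean_atlas open_range imageI[OF x]] by blast
      moreover have "smooth_fun_on euclidean_atlas (\<Phi> ` V) (\<lambda>y. f (\<Psi> y))"
        using fs by (simp add: smooth_fun_on_def smooth_map_on_euclidean_iff)
      ultimately obtain g where "smooth_fun euclidean_atlas g" "\<forall>y\<in>T. g y = f (\<Psi> y)" by blast
      then show thesis using that[of g T] T(1-3) by (simp add: smooth_fun_on_def smooth_map_on_euclidean_iff)
    qed
    obtain g where g: "\<And>b. smooth_on UNIV (g b)" "\<And>y. F y = F (\<Phi> x) + (\<Sum>b\<in>Basis. ((y - \<Phi> x) \<bullet> b) * g b y)"
      "\<And>b. g b (\<Phi> x) = frechet_derivative F (at (\<Phi> x)) b"
      using hadamard[OF F, of "\<Phi> x"] by blast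
    have "smooth_fun_on \<A> V (\<lambda>y. g b (\<Phi> y))" for b
      by (rule smooth_fun_on_coord[OF open_domain order_refl smooth_on_subset[OF g(1)]]) simp
    then have "\<forall>b. \<exists>G. smooth_fun \<A> G \<and> (\<forall>y\<in>E. G y = g b (\<Phi> y))" using E(4) by blast
    from choice[OF this] obtain G where G: "\<And>b. smooth_fun \<A> (G b)" "\<And>b y. y \<in> E \<Longrightarrow> G b y = g b (\<Phi> y)"
      by blast
    note s = smooth_fun_on_add[OF covering open_UNIV] smooth_fun_on_mult[OF covering open_UNIV]
      smooth_fun_on_const[OF covering open_UNIV] smooth_fun_on_diff[OF covering open_UNIV]
    define c where "c b y = \<kappa> b y - \<kappa> b x" for b y
    have c: "smooth_fun \<A> (c b)" for b unfolding c_def by (intro s \<kappa>_smooth)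
    have vc: "v (c b) = v (\<kappa> b)" for b
    proof -
      have "v (\<lambda>y. \<kappa> b y + (- \<kappa> b x)) = v (\<kappa> b) + v (\<lambda>y. - \<kappa> b x)"
        by (rule tangent_space_add[OF v]) (intro \<kappa>_smooth s)+
      then show ?thesis using tangent_space_const[OF covering v] by (simp add: c_def[abs_def])
    qed
    define N where "N = O' \<inter> E \<inter> (V \<inter> \<Phi> -` T)"
    have N: "open N" "x \<in> N" unfolding N_def
      using \<kappa>(1,2) E(1,2) T(2) x continuous_on_open_vimage_Int[OF smooth_map_onD(1)[OF smooth_coord] open_domain T(1)]
      by (auto intro: open_Int)
    have sumsm: "smooth_fun \<A> (\<lambda>y. \<Sum>b\<in>Basis. c b y * G b y)"
      by (intro smooth_fun_on_sum[OF covering open_UNIV] s c G) auto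
    have "v f = v (\<lambda>y. f x + (\<Sum>b\<in>Basis. c b y * G b y))"
    proof (rule tangent_space_local[OF manifold v f _ N])
      show "smooth_fun \<A> (\<lambda>y. f x + (\<Sum>b\<in>Basis. c b y * G b y))"
        by (intro s sumsm)
      fix y assume y: "y \<in> N"
      have "f y = F (\<Phi> y)" using y T(4)[of "\<Phi> y"] param_coord[of y] by (auto simp: N_def)
      also have "\<dots> = F (\<Phi> x) + (\<Sum>b\<in>Basis. ((\<Phi> y - \<Phi> x) \<bullet> b) * g b (\<Phi> y))" by (rule g(2))
      also have "F (\<Phi> x) = f x" using T(2,4) param_coord[OF x] by auto
      also have "(\<Sum>b\<in>Basis. ((\<Phi> y - \<Phi> x) \<bullet> b) * g b (\<Phi> y)) = (\<Sum>b\<in>Basis. c b y * G b y)"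
        using y \<kappa>(2) by (intro sum.cong) (auto simp: c_def G(2) \<kappa>_coord N_def inner_diff_left)
      finally show "f y = f x + (\<Sum>b\<in>Basis. c b y * G b y)" .
    qed
    also have "\<dots> = v (\<lambda>y. f x) + v (\<lambda>y. \<Sum>b\<in>Basis. c b y * G b y)"
      by (rule tangent_space_add[OF v s(3) sumsm])
    also have "\<dots> = (\<Sum>b\<in>Basis. v (\<lambda>y. c b y * G b y))"
      using tangent_space_const[OF covering v] tangent_space_sum[OF covering v finite_Basis, of "\<lambda>b y. c b y * G b y"] s(2)[OF c G(1)]
      by simp
    also have "\<dots> = (\<Sum>b\<in>Basis. G b x * v (\<kappa> b))"
      using tangent_space_mult[OF v c G(1)] by (simp add: vc) (simp add: c_def)
    also have "\<dots> = (\<Sum>b\<in>Basis. (w \<bullet> b) *\<^sub>R frechet_derivative F (at (\<Phi> x)) b)"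
    proof (rule sum.cong[OF refl])
      fix b :: 'd assume b: "b \<in> Basis"
      have "w \<bullet> b = v (\<kappa> b)" unfolding w_def using b by simp
      then show "G b x * v (\<kappa> b) = (w \<bullet> b) *\<^sub>R frechet_derivative F (at (\<Phi> x)) b"
        using G(2)[OF E(2)] g(3) by simp
    qed
    also have "\<dots> = frechet_derivative F (at (\<Phi> x)) w"
      by (rule linear_Basis_expansion[symmetric, OF has_derivative_linear[OF smooth_on_has_derivative[OF F UNIV_I]]])
    also have "frechet_derivative F (at (\<Phi> x)) = frechet_derivative (\<lambda>y. f (\<Psi> y)) (at (\<Phi> x))"
      by (rule frechet_derivative_cong_open[OF T(1,2,4)])
    also have "\<dots> w = coord_vec x w f" using f by (simp add: coord_vec_def)
    finally show ?thesis .
  next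
    case False
    then show ?thesis using tangent_space_not_smooth[OF v] by (simp add: coord_vec_def)
  qed
  then show ?thesis by auto
qed

lemma tangent_space_range: "x \<in> V \<Longrightarrow> tangent_space \<A> x = range (coord_vec x)"
  by (blast intro: coord_vec_in_tangent_space dest: tangent_space_eq_coord_vec)

lemma smooth_vector_field_coord_vec:
  assumes "open U" "U \<subseteq> V" "\<And>b. b \<in> Basis \<Longrightarrow> smooth_fun_on \<A> U (\<lambda>x. w x \<bullet> b)"
  shows "smooth_vector_field_on \<A> U (\<lambda>x. coord_vec x (w x))"
  unfolding smooth_vector_field_on_def
proof (intro conjI ballI allI impI)
  show "coord_vec x (w x) \<in> tangent_space \<A> x" if "x \<in> U" for x
    using coord_vec_in_tangent_space that assms(2) by auto
  fix f assume f: "smooth_fun \<A> f"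
  have fs: "smooth_on (\<Phi> ` U) (\<lambda>y. f (\<Psi> y))"
    by (rule smooth_on_param[OF assms(1,2) smooth_fun_on_subset[OF f]]) simp
  have "smooth_fun_on \<A> U (\<lambda>x. \<Sum>b\<in>Basis. (w x \<bullet> b) * frechet_derivative (\<lambda>y. f (\<Psi> y)) (at (\<Phi> x)) b)"
    by (intro smooth_fun_on_sum[OF covering assms(1)] smooth_fun_on_mult[OF covering assms(1)] assms(3)
        smooth_fun_on_coord[OF assms(1,2) smooth_on_frechet_derivative[OF fs]]) auto
  then show "smooth_fun_on \<A> U (\<lambda>x. coord_vec x (w x) f)"
  proof (rule smooth_fun_on_cong[OF covering assms(1)])
    fix x assume "x \<in> U"
    then have "linear (frechet_derivative (\<lambda>y. f (\<Psi> y)) (at (\<Phi> x)))"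
      using smooth_on_has_derivative[OF fs] has_derivative_linear by blast
    from linear_Basis_expansion[OF this, of "w x"]
    show "(\<Sum>b\<in>Basis. (w x \<bullet> b) * frechet_derivative (\<lambda>y. f (\<Psi> y)) (at (\<Phi> x)) b) = coord_vec x (w x) f"
      using f by (simp add: coord_vec_def)
  qed
qed

end

section \<open>Dimensions and Gram--Schmidt orthogonalisation\<close>

lemma dim_linear_image_inj:
  fixes f :: "'a::euclidean_space \<Rightarrow> 'b::real_vector"
  assumes "linear f" "inj f"
  shows "dim (f ` A) = dim A"
proof -
  obtain B where B: "B \<subseteq> A" "independent B" "A \<subseteq> span B" "card B = dim A"
    using basis_exists[of A] .
  have "dim (f ` A) = card (f ` B)"
  proof (rule real_vector.dim_unique)
    show "f ` B \<subseteq> f ` A" using B by auto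
    show "f ` A \<subseteq> span (f ` B)"
      using B(3) by (auto simp: linear_span_image[OF assms(1)])
    show "independent (f ` B)"
      by (rule linear_independent_injective_image[OF assms(1) B(2)]) (use assms(2) inj_on_subset in blast)
  qed simp
  also have "card (f ` B) = card B"
    by (rule card_image) (use assms(2) inj_on_subset in blast)
  finally show ?thesis using B(4) by simp
qed

lemma dim_1_span:
  assumes "subspace K" "dim K = 1" "p \<in> K" "p \<noteq> 0"
  shows "K = span {p}"
proof
  show "span {p} \<subseteq> K" using assms by (simp add: span_minimal)
  obtain B where B: "B \<subseteq> K" "independent B" "K \<subseteq> span B" "card B = dim K" by (rule real_vector.basis_exists)
  then obtain b where "B = {b}" using assms(2) by (metis card_1_singletonE)
  then obtain c where c: "p = c *\<^sub>R b" using B(3) assms(3) by (auto simp: span_singleton)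
  then have "c \<noteq> 0" using assms(4) by auto
  then have "b = (1 / c) *\<^sub>R p" using c by simp
  then have "b \<in> span {p}" by (metis span_base span_scale singletonI)
  then show "K \<subseteq> span {p}" using B(3) \<open>B = {b}\<close> span_minimal[of "{b}" "span {p}"] by auto
qed

text \<open>The orthogonalised fields are smooth as long as the previous ones have no zeros. The newest one does
  not vanish at \<open>a\<close>, by independence, and thus not near \<open>a\<close>, by continuity.\<close>

lemma gram_schmidt_smooth:
  fixes v :: "nat \<Rightarrow> 'd::euclidean_space \<Rightarrow> 'd"
  assumes "open T" "a \<in> T" "\<forall>i<m. smooth_on T (v i)" "dim ((\<lambda>i. v i a) ` {..<m}) = m"
  shows "\<exists>T' e. open T' \<and> a \<in> T' \<and> T' \<subseteq> T \<and> (\<forall>i<m. smooth_on T' (e i)) \<and>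
    (\<forall>y\<in>T'. (\<forall>i<m. e i y \<noteq> 0) \<and> (\<forall>i<m. \<forall>j<m. i \<noteq> j \<longrightarrow> e i y \<bullet> e j y = 0) \<and>
       span ((\<lambda>i. e i y) ` {..<m}) = span ((\<lambda>i. v i y) ` {..<m}))"
  using assms(3,4)
proof (induction m)
  case 0
  then show ?case using assms(1,2) by (intro exI[of _ T] exI[of _ v]) auto
next
  case (Suc m)
  let ?S = "\<lambda>y. (\<lambda>i. v i y) ` {..<m}"
  have ins: "(\<lambda>i. v i y) ` {..<Suc m} = insert (v m y) (?S y)" for y
    by (auto simp: lessThan_Suc)
  have le: "dim (?S a) \<le> m" using dim_le_card'[of "?S a"] card_image_le[of "{..<m}" "\<lambda>i. v i a"] by simp
  have d: "dim (?S a) = m" and vm: "v m a \<notin> span (?S a)"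
    using Suc.prems(2) le by (auto simp: ins dim_insert split: if_splits)
  obtain T' e where T': "open T'" "a \<in> T'" "T' \<subseteq> T" and es: "\<forall>i<m. smooth_on T' (e i)"
    and e: "\<forall>y\<in>T'. (\<forall>i<m. e i y \<noteq> 0) \<and> (\<forall>i<m. \<forall>j<m. i \<noteq> j \<longrightarrow> e i y \<bullet> e j y = 0) \<and>
       span ((\<lambda>i. e i y) ` {..<m}) = span (?S y)"
    using Suc.IH Suc.prems(1) d by auto
  define w where "w y = v m y - (\<Sum>i<m. ((v m y \<bullet> e i y) / (e i y \<bullet> e i y)) *\<^sub>R e i y)" for y
  have vms: "smooth_on T' (v m)" using Suc.prems(1) smooth_on_subset T'(3) by blast
  have ws: "smooth_on T' w"
    unfolding w_def
    by (intro smooth_on_diff smooth_on_sum smooth_on_scaleR smooth_on_divide smooth_on_inner T' vms)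
       (use es e in auto)
  define T'' where "T'' = T' \<inter> w -` (- {0})"
  have sumin: "(\<Sum>i<m. ((v m y \<bullet> e i y) / (e i y \<bullet> e i y)) *\<^sub>R e i y) \<in> span ((\<lambda>i. e i y) ` {..<m})" for y
    by (intro span_sum span_scale span_base) auto
  have "open T''" unfolding T''_def
    by (rule continuous_on_open_vimage_Int[OF smooth_on_imp_continuous_on[OF ws] T'(1)]) auto
  moreover have "a \<in> T''"
  proof -
    have "v m a \<in> span (?S a)" if "w a = 0"
      using that sumin[of a] e T'(2) by (simp add: w_def)
    then show ?thesis using vm T'(2) by (auto simp: T''_def)
  qed
  moreover define e' where "e' i = (if i < m then e i else w)" for i
  have "smooth_on T'' (e' i)" if "i < Suc m" for i
    using that es ws smooth_on_subset[of T' _ T''] by (auto simp: e'_def T''_def)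
  moreover have "(\<forall>i<Suc m. e' i y \<noteq> 0) \<and> (\<forall>i<Suc m. \<forall>j<Suc m. i \<noteq> j \<longrightarrow> e' i y \<bullet> e' j y = 0) \<and>
       span ((\<lambda>i. e' i y) ` {..<Suc m}) = span ((\<lambda>i. v i y) ` {..<Suc m})" if y: "y \<in> T''" for y
  proof (intro conjI)
    have yT: "y \<in> T'" using y by (auto simp: T''_def)
    note ey = e[rule_format, OF yT]
    show "\<forall>i<Suc m. e' i y \<noteq> 0" using y ey by (auto simp: e'_def T''_def)
    have orth: "w y \<bullet> e j y = 0" if j: "j < m" for j
    proof -
      have "(\<Sum>i<m. (((v m y \<bullet> e i y) / (e i y \<bullet> e i y)) *\<^sub>R e i y) \<bullet> e j y) = (\<Sum>i<m. if i = j then v m y \<bullet> e j y else 0)"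
        using ey j by (intro sum.cong) auto
      also have "\<dots> = v m y \<bullet> e j y" using j by simp
      finally show ?thesis by (simp add: w_def inner_diff_left inner_sum_left)
    qed
    show "\<forall>i<Suc m. \<forall>j<Suc m. i \<noteq> j \<longrightarrow> e' i y \<bullet> e' j y = 0"
      using ey orth by (auto simp: e'_def less_Suc_eq inner_commute)
    have "span ((\<lambda>i. e' i y) ` {..<Suc m}) = span (insert (w y) ((\<lambda>i. e i y) ` {..<m}))"
      by (rule arg_cong[where f = span]) (auto simp: e'_def lessThan_Suc image_iff)
    also have "\<dots> = span (insert (v m y) ((\<lambda>i. e i y) ` {..<m}))"
      by (rule eq_span_insert_eq) (use sumin[of y] in \<open>simp add: w_def span_neg\<close>)
    also have "\<dots> = span (insert (v m y) (?S y))"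
      using ey by (simp add: span_insert)
    finally show "span ((\<lambda>i. e' i y) ` {..<Suc m}) = span ((\<lambda>i. v i y) ` {..<Suc m})"
      by (simp add: ins)
  qed
  ultimately show ?case
    using T'(3) by (intro exI[of _ T''] exI[of _ e']) (auto simp: T''_def)
qed

lemma orthogonal_family:
  fixes e :: "nat \<Rightarrow> 'd::euclidean_space"
  assumes "\<forall>i<m. e i \<noteq> 0" "\<forall>i<m. \<forall>j<m. i \<noteq> j \<longrightarrow> e i \<bullet> e j = 0"
  shows "dim (e ` {..<m}) = m"
    and "w \<in> span (e ` {..<m}) \<Longrightarrow> w = (\<Sum>i<m. ((w \<bullet> e i) / (e i \<bullet> e i)) *\<^sub>R e i)"
proof -
  have inj: "inj_on e {..<m}"
    by (rule inj_onI) (metis assms inner_eq_zero_iff lessThan_iff)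
  have po: "pairwise orthogonal (e ` {..<m})"
    using assms(2) by (auto simp: pairwise_def orthogonal_def)
  have "independent (e ` {..<m})"
    by (rule pairwise_orthogonal_independent[OF po]) (use assms(1) in auto)
  then show "dim (e ` {..<m}) = m"
    using card_image[OF inj] by (simp add: dim_eq_card_independent)
  assume "w \<in> span (e ` {..<m})"
  moreover have "(\<Sum>b\<in>e ` {..<m}. (b \<bullet> w / (b \<bullet> b)) *\<^sub>R b) \<in> span (e ` {..<m})"
    by (intro span_sum span_scale span_base)
  ultimately have "w - (\<Sum>b\<in>e ` {..<m}. (b \<bullet> w / (b \<bullet> b)) *\<^sub>R b) \<in> span (e ` {..<m})"
    by (rule span_diff)
  from Gram_Schmidt_step[OF po this, of w]
  have "w = (\<Sum>b\<in>e ` {..<m}. (b \<bullet> w / (b \<bullet> b)) *\<^sub>R b)" by (simp add: orthogonal_def)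
  also have "\<dots> = (\<Sum>i<m. ((w \<bullet> e i) / (e i \<bullet> e i)) *\<^sub>R e i)"
    by (simp add: sum.reindex[OF inj] inner_commute)
  finally show "w = \<dots>" .
qed

section \<open>Vector fields and generating families\<close>

lemma smooth_vector_field_onD:
  assumes "smooth_vector_field_on \<A> U X"
  shows "x \<in> U \<Longrightarrow> X x \<in> tangent_space \<A> x" "smooth_fun \<A> f \<Longrightarrow> smooth_fun_on \<A> U (\<lambda>x. X x f)"
  using assms by (auto simp: smooth_vector_field_on_def)

lemma smooth_vector_field_onI:
  assumes "\<And>x. x \<in> U \<Longrightarrow> X x \<in> tangent_space \<A> x" "\<And>f. smooth_fun \<A> f \<Longrightarrow> smooth_fun_on \<A> U (\<lambda>x. X x f)"
  shows "smooth_vector_field_on \<A> U X"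
  using assms by (auto simp: smooth_vector_field_on_def)

lemma smooth_vector_field_on_subset:
  "smooth_vector_field_on \<A> U X \<Longrightarrow> W \<subseteq> U \<Longrightarrow> smooth_vector_field_on \<A> W X"
  using smooth_fun_on_subset unfolding smooth_vector_field_on_def by blast

lemma smooth_vector_field_on_add:
  assumes "covering_atlas \<A>" "open U" "smooth_vector_field_on \<A> U X" "smooth_vector_field_on \<A> U Y"
  shows "smooth_vector_field_on \<A> U (\<lambda>x. X x + Y x)"
proof (rule smooth_vector_field_onI)
  show "X x + Y x \<in> tangent_space \<A> x" if "x \<in> U" for x
    by (rule subspace_add[OF subspace_tangent_space]) (use assms that smooth_vector_field_onD(1) in auto)
  show "smooth_fun_on \<A> U (\<lambda>x. (X x + Y x) f)" if "smooth_fun \<A> f" for f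
    using smooth_fun_on_add[OF assms(1,2)] smooth_vector_field_onD(2)[OF assms(3) that]
      smooth_vector_field_onD(2)[OF assms(4) that] by (simp add: plus_fun_def)
qed

lemma smooth_vector_field_on_scale:
  assumes "covering_atlas \<A>" "open U" "smooth_fun_on \<A> U f" "smooth_vector_field_on \<A> U X"
  shows "smooth_vector_field_on \<A> U (\<lambda>x. f x *\<^sub>R X x)"
proof (rule smooth_vector_field_onI)
  show "f x *\<^sub>R X x \<in> tangent_space \<A> x" if "x \<in> U" for x
    by (rule subspace_scale[OF subspace_tangent_space]) (use assms that smooth_vector_field_onD(1) in auto)
  show "smooth_fun_on \<A> U (\<lambda>x. (f x *\<^sub>R X x) g)" if "smooth_fun \<A> g" for g
    using smooth_fun_on_mult[OF assms(1,2,3)] smooth_vector_field_onD(2)[OF assms(4) that]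
    by (simp add: scaleR_fun_def)
qed

lemma zero_in_tangent_space: "0 \<in> tangent_space \<A> x"
  by (rule subspace_0[OF subspace_tangent_space])

lemma smooth_vector_field_on_zero:
  assumes "covering_atlas \<A>" "open U"
  shows "smooth_vector_field_on \<A> U (\<lambda>x. 0)"
  by (rule smooth_vector_field_onI) (simp_all add: zero_in_tangent_space smooth_fun_on_const[OF assms])

lemma smooth_vector_field_on_sum:
  assumes "covering_atlas \<A>" "open U" "finite I" "\<And>i. i \<in> I \<Longrightarrow> smooth_vector_field_on \<A> U (X i)"
  shows "smooth_vector_field_on \<A> U (\<lambda>x. \<Sum>i\<in>I. X i x)"
  using assms(3,4)
  by (induction I rule: finite_induct)
     (auto intro: smooth_vector_field_on_zero[OF assms(1,2)] smooth_vector_field_on_add[OF assms(1,2)])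

lemma smooth_vector_field_cutoff:
  assumes "covering_atlas \<A>" "open U" "smooth_fun \<A> \<beta>" "closed K" "K \<subseteq> U"
    "\<And>y. y \<notin> K \<Longrightarrow> \<beta> y = 0" "smooth_vector_field_on \<A> U X"
  shows "smooth_vector_field_on \<A> UNIV (\<lambda>x. \<beta> x *\<^sub>R X x)"
proof (rule smooth_vector_field_onI)
  show "\<beta> x *\<^sub>R X x \<in> tangent_space \<A> x" for x
  proof (cases "x \<in> U")
    case True
    then show ?thesis by (rule subspace_scale[OF subspace_tangent_space smooth_vector_field_onD(1)[OF assms(7)]])
  next
    case False
    then have "\<beta> x = 0" using assms(5,6) by auto
    then show ?thesis by (simp add: zero_in_tangent_space)
  qed
  show "smooth_fun_on \<A> UNIV (\<lambda>x. (\<beta> x *\<^sub>R X x) f)" if "smooth_fun \<A> f" for f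
    using smooth_fun_cutoff[OF assms(1-6) smooth_vector_field_onD(2)[OF assms(7) that]] by (simp add: scaleR_fun_def)
qed


text \<open>A substitute for a frame that is visibly smooth without reference to coordinates: the coefficients of
  \<open>d\<close> are the derivatives of fixed functions along \<open>d\<close>. Its sections are the orthogonal projections to
  \<open>D\<close> of the coordinate vector fields, cut off by a bump.\<close>

definition generating_family ::
    "('m::topological_space, 'e::euclidean_space) chart set \<Rightarrow> ('m \<Rightarrow> 'm tvec set) \<Rightarrow> 'm set \<Rightarrow>
     ('e \<Rightarrow> 'm \<Rightarrow> 'm tvec) \<Rightarrow> ('e \<Rightarrow> 'm \<Rightarrow> real) \<Rightarrow> bool" where
  "generating_family \<A> D O' F \<kappa> \<longleftrightarrow>
     (\<forall>b\<in>Basis. F b \<in> vsections \<A> D \<and> smooth_fun \<A> (\<kappa> b)) \<and>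
     (\<forall>x\<in>O'. \<forall>d\<in>D x. d = (\<Sum>b\<in>Basis. d (\<kappa> b) *\<^sub>R F b x))"

context smooth_coordinates
begin

text \<open>Those of the fields that form a basis at \<open>x0\<close> are orthogonalised in coordinates. The result stays
  independent near \<open>x0\<close>, and since the rank of \<open>D\<close> is constant, it spans \<open>D\<close> there.\<close>

lemma orthogonal_frame:
  fixes Y :: "nat \<Rightarrow> 'm \<Rightarrow> 'm tvec"
  assumes D: "\<And>x. x \<in> U \<Longrightarrow> subspace (D x) \<and> D x \<subseteq> tangent_space \<A> x \<and> dim (D x) = m"
    and U: "open U" "x0 \<in> U" "U \<subseteq> V"
    and Y: "\<forall>i<n. smooth_vector_field_on \<A> U (Y i)" "\<forall>x\<in>U. \<forall>i<n. Y i x \<in> D x"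
    and span: "D x0 = span ((\<lambda>i. Y i x0) ` {..<n})"
  obtains O' e \<kappa> where "open O'" "x0 \<in> O'" "O' \<subseteq> U"
    "\<forall>i<m. \<forall>b. smooth_fun_on \<A> O' (\<lambda>x. e i x \<bullet> b)"
    "\<forall>x\<in>O'. (\<forall>i<m. e i x \<noteq> 0) \<and> (\<forall>i<m. \<forall>j<m. i \<noteq> j \<longrightarrow> e i x \<bullet> e j x = 0)"
    "\<forall>x\<in>O'. D x = coord_vec x ` span ((\<lambda>i. e i x) ` {..<m})"
    "\<forall>b. smooth_fun \<A> (\<kappa> b)" "\<forall>x\<in>O'. \<forall>b w. coord_vec x w (\<kappa> b) = w \<bullet> b"
proof -
  have x0V: "x0 \<in> V" using U by auto
  obtain \<kappa> O1 where O1: "open O1" "x0 \<in> O1" "O1 \<subseteq> V" and \<kappa>: "\<forall>b. smooth_fun \<A> (\<kappa> b)"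
      "\<forall>x\<in>O1. \<forall>b w. coord_vec x w (\<kappa> b) = w \<bullet> b"
    by (rule coordinate_functions[OF x0V])
  define P where "P = U \<inter> O1"
  have P: "open P" "x0 \<in> P" "P \<subseteq> V" "P \<subseteq> U" "P \<subseteq> O1" using U O1 by (auto simp: P_def)
  define comp where "comp v = (\<Sum>b\<in>Basis. v (\<kappa> b) *\<^sub>R b)" for v :: "'m tvec"
  have comp_coord_vec: "comp (coord_vec x w) = w" if "x \<in> P" for x w
  proof -
    have "comp (coord_vec x w) = (\<Sum>b\<in>Basis. (w \<bullet> b) *\<^sub>R b)"
      unfolding comp_def using \<kappa>(2) that P(5) by (intro sum.cong) auto
    then show ?thesis by (simp add: euclidean_representation)
  qed
  have coord_vec_comp: "coord_vec x (comp v) = v" if "x \<in> P" "v \<in> tangent_space \<A> x" for x v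
    using tangent_space_eq_coord_vec[OF subsetD[OF P(3) that(1)] that(2)] comp_coord_vec[OF that(1)] by auto
  have injx: "inj (coord_vec x)" and linx: "linear (coord_vec x)" if "x \<in> P" for x
    using coord_vec_inj linear_coord_vec that P(3) by auto
  define y where "y i z = comp (Y i (\<Psi> z))" for i z
  have ys: "smooth_on (\<Phi> ` P) (y i)" if "i < n" for i
  proof -
    have "smooth_on (\<Phi> ` P) (\<lambda>z. Y i (\<Psi> z) (\<kappa> b))" for b
    proof (rule smooth_on_param[OF P(1,3), where f = "\<lambda>x. Y i x (\<kappa> b)"])
      show "smooth_fun_on \<A> P (\<lambda>x. Y i x (\<kappa> b))"
        using smooth_vector_field_onD(2)[OF smooth_vector_field_on_subset[OF Y(1)[rule_format, OF that] P(4)]] \<kappa>(1) by auto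
    qed
    then show ?thesis
      unfolding y_def comp_def
      by (intro smooth_on_sum smooth_on_scaleR smooth_on_const open_coord_image[OF P(1,3)]) auto
  qed
  have y_eq: "y i (\<Phi> x) = comp (Y i x)" if "x \<in> P" for i x
    using param_coord that P(3) by (auto simp: y_def)
  define D' where "D' x = comp ` D x" for x
  have DD': "D x = coord_vec x ` D' x" if "x \<in> P" for x
    unfolding D'_def image_image using coord_vec_comp[OF that] D[of x] that P(4) by (force simp: image_iff)
  have D'_iff: "w \<in> D' x \<longleftrightarrow> coord_vec x w \<in> D x" if "x \<in> P" for x w
    using DD'[OF that] injx[OF that] by (auto simp: inj_image_mem_iff)
  have D'_sub: "subspace (D' x)" if "x \<in> P" for x
  proof -
    have "D' x = coord_vec x -` D x" using D'_iff[OF that] by auto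
    then show ?thesis using linear_subspace_vimage[OF linx[OF that]] D[of x] that P(4) by auto
  qed
  have D'_dim: "dim (D' x) = m" if "x \<in> P" for x
    using dim_linear_image_inj[OF linx[OF that] injx[OF that], of "D' x"] DD'[OF that] D[of x] that P(4) by auto
  have yD': "y i (\<Phi> x) \<in> D' x" if "x \<in> P" "i < n" for x i
    using Y(2) that P(4) by (auto simp: y_eq D'_def)
  have D'_span: "D' x0 \<subseteq> span ((\<lambda>i. y i (\<Phi> x0)) ` {..<n})"
  proof
    fix w assume "w \<in> D' x0"
    then have "coord_vec x0 w \<in> span ((\<lambda>i. Y i x0) ` {..<n})"
      using D'_iff[OF P(2)] span by simp
    also have "(\<lambda>i. Y i x0) ` {..<n} = coord_vec x0 ` ((\<lambda>i. y i (\<Phi> x0)) ` {..<n})"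
      unfolding image_image using coord_vec_comp[OF P(2)] y_eq[OF P(2)] Y(2) D[OF U(2)] U(2)
      by (intro image_cong refl) (metis lessThan_iff subsetD)
    finally show "w \<in> span ((\<lambda>i. y i (\<Phi> x0)) ` {..<n})"
      using injx[OF P(2)] by (auto simp: linear_span_image[OF linx[OF P(2)]] inj_image_mem_iff)
  qed
  obtain B where B: "B \<subseteq> (\<lambda>i. y i (\<Phi> x0)) ` {..<n}" "independent B" "(\<lambda>i. y i (\<Phi> x0)) ` {..<n} \<subseteq> span B"
      "card B = dim ((\<lambda>i. y i (\<Phi> x0)) ` {..<n})"
    using basis_exists .
  have "card B = m"
  proof -
    have "dim ((\<lambda>i. y i (\<Phi> x0)) ` {..<n}) = dim (D' x0)"
      using D'_span yD'[OF P(2)] span_minimal[OF _ D'_sub[OF P(2)]]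
      by (intro span_eq_dim subset_antisym span_mono span_minimal subspace_span) auto
    then show ?thesis using B(4) D'_dim[OF P(2)] by simp
  qed
  moreover have "finite B" using B(1) finite_subset by blast
  ultimately obtain h where h: "bij_betw h {..<m} B"
    using ex_bij_betw_nat_finite[of B] by (auto simp: atLeast0LessThan)
  have "\<forall>j. \<exists>i. j < m \<longrightarrow> i < n \<and> h j = y i (\<Phi> x0)"
    using bij_betwE[OF h] B(1) by fastforce
  from choice[OF this] obtain idx where idx: "\<And>j. j < m \<Longrightarrow> idx j < n \<and> h j = y (idx j) (\<Phi> x0)" by blast
  define v where "v j = y (idx j)" for j
  have "(\<lambda>j. v j (\<Phi> x0)) ` {..<m} = B"
    using bij_betw_imp_surj_on[OF h] idx unfolding v_def by force
  then have dimv: "dim ((\<lambda>j. v j (\<Phi> x0)) ` {..<m}) = m"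
    using B(2) \<open>card B = m\<close> by (simp add: dim_eq_card_independent)
  have vs: "\<forall>j<m. smooth_on (\<Phi> ` P) (v j)" using ys idx by (simp add: v_def)
  obtain T e where T: "open T" "\<Phi> x0 \<in> T" "T \<subseteq> \<Phi> ` P" and es: "\<forall>i<m. smooth_on T (e i)"
    and e: "\<forall>y\<in>T. (\<forall>i<m. e i y \<noteq> 0) \<and> (\<forall>i<m. \<forall>j<m. i \<noteq> j \<longrightarrow> e i y \<bullet> e j y = 0) \<and>
       span ((\<lambda>i. e i y) ` {..<m}) = span ((\<lambda>i. v i y) ` {..<m})"
    using gram_schmidt_smooth[OF open_coord_image[OF P(1,3)] imageI[OF P(2)] vs dimv] by blast
  define O' where "O' = P \<inter> \<Phi> -` T"
  have O': "open O'" "x0 \<in> O'" "O' \<subseteq> P"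
    unfolding O'_def
    using continuous_on_open_vimage_Int[OF continuous_on_subset[OF smooth_map_onD(1)[OF smooth_coord] P(3)] P(1) T(1)] P(2) T(2)
    by auto
  show thesis
  proof (rule that[of O' "\<lambda>i x. e i (\<Phi> x)" \<kappa>])
    show "open O'" "x0 \<in> O'" "O' \<subseteq> U" using O' P(4) by auto
    show "\<forall>i<m. \<forall>b. smooth_fun_on \<A> O' (\<lambda>x. e i (\<Phi> x) \<bullet> b)"
    proof (intro allI impI)
      fix i b assume i: "i < m"
      have o: "open (\<Phi> ` O')" "O' \<subseteq> V" using open_coord_image O' P(3) by blast+
      show "smooth_fun_on \<A> O' (\<lambda>x. e i (\<Phi> x) \<bullet> b)"
        by (rule smooth_fun_on_coord[OF O'(1) o(2), where g = "\<lambda>z. e i z \<bullet> b"])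
           (intro smooth_on_inner smooth_on_const o smooth_on_subset[OF es[rule_format, OF i]], auto simp: O'_def)
    qed
    show "\<forall>x\<in>O'. (\<forall>i<m. e i (\<Phi> x) \<noteq> 0) \<and> (\<forall>i<m. \<forall>j<m. i \<noteq> j \<longrightarrow> e i (\<Phi> x) \<bullet> e j (\<Phi> x) = 0)"
      using e by (auto simp: O'_def)
    show "\<forall>b. smooth_fun \<A> (\<kappa> b)" by fact
    show "\<forall>x\<in>O'. \<forall>b w. coord_vec x w (\<kappa> b) = w \<bullet> b" using \<kappa>(2) O'(3) P(5) by blast
    show "\<forall>x\<in>O'. D x = coord_vec x ` span ((\<lambda>i. e i (\<Phi> x)) ` {..<m})"
    proof
      fix x assume x: "x \<in> O'"
      then have xP: "x \<in> P" and xT: "\<Phi> x \<in> T" by (auto simp: O'_def)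
      note ex = e[rule_format, OF xT]
      have "span ((\<lambda>i. e i (\<Phi> x)) ` {..<m}) = D' x"
      proof (rule subspace_dim_equal)
        show "span ((\<lambda>i. e i (\<Phi> x)) ` {..<m}) \<subseteq> D' x"
          unfolding conjunct2[OF conjunct2[OF ex]]
          by (rule span_minimal) (use yD'[OF xP] idx D'_sub[OF xP] in \<open>auto simp: v_def\<close>)
        show "dim (D' x) \<le> dim (span ((\<lambda>i. e i (\<Phi> x)) ` {..<m}))"
          unfolding dim_span D'_dim[OF xP]
          using orthogonal_family(1)[OF conjunct1[OF ex] conjunct1[OF conjunct2[OF ex]]] by simp
      qed (auto simp: D'_sub[OF xP])
      then show "D x = coord_vec x ` span ((\<lambda>i. e i (\<Phi> x)) ` {..<m})" using DD'[OF xP] by simp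
    qed
  qed
qed

end

text \<open>Both come from an orthogonal frame \<open>e\<close>: the frame itself, and the projections
  \<open>b \<mapsto> (\<Sum>i. (b \<bullet> e i) / (e i \<bullet> e i) * e i)\<close> of the basis vectors \<open>b\<close>. Expanding \<open>w\<close> in the basis and
  projecting gives \<open>w = (\<Sum>b. (w \<bullet> b) * p b)\<close> for \<open>w\<close> in \<open>D\<close>.\<close>

lemma local_frame_and_generating_family:
  fixes \<A> :: "('m::{t2_space,second_countable_topology}, 'e::euclidean_space) chart set"
    and Y :: "nat \<Rightarrow> 'm \<Rightarrow> 'm tvec"
  assumes A: "smooth_manifold \<A>"
    and D: "\<And>x. subspace (D x) \<and> D x \<subseteq> tangent_space \<A> x \<and> dim (D x) = m"
    and U: "open U" "x0 \<in> U"
    and Y: "\<forall>i<n. smooth_vector_field_on \<A> U (Y i)" "\<forall>x\<in>U. \<forall>i<n. Y i x \<in> D x"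
    and span: "D x0 = span ((\<lambda>i. Y i x0) ` {..<n})"
  shows "\<exists>O' X. open O' \<and> x0 \<in> O' \<and> (\<forall>i<m. smooth_vector_field_on \<A> O' (X i)) \<and>
      (\<forall>y\<in>O'. D y = span ((\<lambda>i. X i y) ` {..<m}))"
    and "\<exists>O' F \<kappa>. open O' \<and> x0 \<in> O' \<and> generating_family \<A> D O' F \<kappa>"
proof -
  note cov = smooth_manifold_covering[OF A]
  obtain V \<phi> where V: "(V, \<phi>) \<in> \<A>" "x0 \<in> V" using covering_atlas_obtain[OF cov] .
  interpret smooth_coordinates \<A> V \<phi> "inv_into V \<phi>"
    by (rule smooth_coordinates_chart[OF A V(1)])
  have D': "\<And>x. x \<in> U \<inter> V \<Longrightarrow> subspace (D x) \<and> D x \<subseteq> tangent_space \<A> x \<and> dim (D x) = m" using D by blast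
  have Y': "\<forall>i<n. smooth_vector_field_on \<A> (U \<inter> V) (Y i)" "\<forall>x\<in>U \<inter> V. \<forall>i<n. Y i x \<in> D x"
    using Y smooth_vector_field_on_subset by blast+
  obtain O' e \<kappa> where O': "open O'" "x0 \<in> O'" "O' \<subseteq> U \<inter> V" and
    es: "\<forall>i<m. \<forall>b. smooth_fun_on \<A> O' (\<lambda>x. e i x \<bullet> b)" and
    orth: "\<forall>x\<in>O'. (\<forall>i<m. e i x \<noteq> 0) \<and> (\<forall>i<m. \<forall>j<m. i \<noteq> j \<longrightarrow> e i x \<bullet> e j x = 0)" and
    De: "\<forall>x\<in>O'. D x = coord_vec x ` span ((\<lambda>i. e i x) ` {..<m})" and
    \<kappa>: "\<forall>b. smooth_fun \<A> (\<kappa> b)" "\<forall>x\<in>O'. \<forall>b w. coord_vec x w (\<kappa> b) = w \<bullet> b"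
    by (rule orthogonal_frame[where U = "U \<inter> V" and D = D and m = m and ?x0.0 = x0 and n = n and Y = Y, OF D' _ _ _ Y' span])
       (use U V(2) open_domain in auto)
  have O'V: "O' \<subseteq> V" using O'(3) by auto
  have "smooth_vector_field_on \<A> O' (\<lambda>x. coord_vec x (e i x))" if "i < m" for i
    using smooth_vector_field_coord_vec[OF O'(1) O'V] es that by auto
  moreover have "D y = span ((\<lambda>i. coord_vec y (e i y)) ` {..<m})" if "y \<in> O'" for y
    using De that linear_span_image[OF linear_coord_vec, of y "(\<lambda>i. e i y) ` {..<m}"] O'V
    by (auto simp: image_image)
  ultimately show "\<exists>O' X. open O' \<and> x0 \<in> O' \<and> (\<forall>i<m. smooth_vector_field_on \<A> O' (X i)) \<and>
      (\<forall>y\<in>O'. D y = span ((\<lambda>i. X i y) ` {..<m}))"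
    using O'(1,2) by (intro exI[of _ O'] exI[of _ "\<lambda>i x. coord_vec x (e i x)"]) auto
  define p where "p b x = (\<Sum>i<m. ((b \<bullet> e i x) / (e i x \<bullet> e i x)) *\<^sub>R e i x)" for b x
  have inner_e: "smooth_fun_on \<A> O' (\<lambda>x. e i x \<bullet> e j x)" if "i < m" "j < m" for i j
  proof -
    have "smooth_fun_on \<A> O' (\<lambda>x. \<Sum>b\<in>Basis. (e i x \<bullet> b) * (e j x \<bullet> b))"
      using es that by (intro smooth_fun_on_sum[OF cov O'(1)] smooth_fun_on_mult[OF cov O'(1)]) auto
    then show ?thesis by (simp add: euclidean_inner[of "e i _" "e j _"])
  qed
  have ps: "smooth_fun_on \<A> O' (\<lambda>x. p b x \<bullet> c)" for b c
  proof -
    have "smooth_fun_on \<A> O' (\<lambda>x. b \<bullet> e i x)" if "i < m" for i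
      using es that by (simp add: inner_commute)
    then have "smooth_fun_on \<A> O' (\<lambda>x. \<Sum>i<m. ((b \<bullet> e i x) / (e i x \<bullet> e i x)) * (e i x \<bullet> c))"
      using es orth inner_e
      by (intro smooth_fun_on_sum[OF cov O'(1)] smooth_fun_on_mult[OF cov O'(1)] smooth_fun_on_divide[OF cov O'(1)]) auto
    then show ?thesis by (simp add: p_def inner_sum_left)
  qed
  have pD: "coord_vec x (p b x) \<in> D x" if "x \<in> O'" for b x
  proof -
    have "p b x \<in> span ((\<lambda>i. e i x) ` {..<m})"
      unfolding p_def by (intro span_sum span_scale span_base) auto
    then show ?thesis using De that by auto
  qed
  have p_expand: "w = (\<Sum>b\<in>Basis. (w \<bullet> b) *\<^sub>R p b x)" if x: "x \<in> O'" and w: "w \<in> span ((\<lambda>i. e i x) ` {..<m})" for x w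
  proof -
    have lin: "linear (\<lambda>w. p w x)"
      unfolding p_def by (rule linearI) (simp_all add: inner_add_left add_divide_distrib scaleR_left_distrib sum.distrib scaleR_sum_right)
    have "w = p w x"
      using orthogonal_family(2)[of m "\<lambda>i. e i x" w] orth x w by (simp add: p_def)
    also have "\<dots> = (\<Sum>b\<in>Basis. (w \<bullet> b) *\<^sub>R p b x)" by (rule linear_Basis_expansion[OF lin])
    finally show ?thesis .
  qed
  obtain \<beta> O2 K where b: "smooth_fun \<A> \<beta>" "open O2" "x0 \<in> O2" "O2 \<subseteq> K" "closed K" "K \<subseteq> O'"
    "\<And>y. y \<in> O2 \<Longrightarrow> \<beta> y = 1" "\<And>y. y \<notin> K \<Longrightarrow> \<beta> y = 0"
    using smooth_bump_exists[OF A O'(1,2)] by metis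
  define F where "F b x = \<beta> x *\<^sub>R coord_vec x (p b x)" for b x
  have "F b \<in> vsections \<A> D" for b
    unfolding vsections_def mem_Collect_eq
  proof
    show "smooth_vector_field_on \<A> UNIV (F b)"
      unfolding F_def
      by (rule smooth_vector_field_cutoff[OF cov O'(1) b(1,5,6,8) smooth_vector_field_coord_vec[OF O'(1) O'V ps]])
    show "\<forall>x. F b x \<in> D x"
    proof
      fix x show "F b x \<in> D x"
      proof (cases "x \<in> O'")
        case True
        then show ?thesis unfolding F_def using pD D subspace_scale by blast
      next
        case False
        then have "F b x = 0" using b(6,8) by (auto simp: F_def)
        then show ?thesis using D subspace_0 by metis
      qed
    qed
  qed
  moreover have "d = (\<Sum>b\<in>Basis. d (\<kappa> b) *\<^sub>R F b x)" if x: "x \<in> O2" and d: "d \<in> D x" for x d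
  proof -
    have xO: "x \<in> O'" and xV: "x \<in> V" using x b(4,6) O'V by auto
    obtain w where w: "w \<in> span ((\<lambda>i. e i x) ` {..<m})" "d = coord_vec x w"
      using De xO d by auto
    note lin = linear_coord_vec[OF xV]
    have "d = coord_vec x (\<Sum>b\<in>Basis. (w \<bullet> b) *\<^sub>R p b x)" using p_expand[OF xO w(1)] w(2) by simp
    also have "\<dots> = (\<Sum>b\<in>Basis. coord_vec x ((w \<bullet> b) *\<^sub>R p b x))" by (rule linear_sum[OF lin])
    also have "\<dots> = (\<Sum>b\<in>Basis. d (\<kappa> b) *\<^sub>R F b x)"
      using \<kappa>(2) xO w(2) b(7)[OF x] by (intro sum.cong refl) (simp add: linear_scale[OF lin] F_def)
    finally show ?thesis .
  qed
  ultimately have "generating_family \<A> D O2 F \<kappa>"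
    using \<kappa>(1) by (auto simp: generating_family_def)
  then show "\<exists>O' F \<kappa>. open O' \<and> x0 \<in> O' \<and> generating_family \<A> D O' F \<kappa>" using b(2,3) by blast
qed

section \<open>Products of manifolds\<close>

lemma smooth_manifold_transition:
  assumes "smooth_manifold \<A>" "(U, \<phi>) \<in> \<A>" "(V, \<psi>) \<in> \<A>"
  shows "smooth_on (\<phi> ` (U \<inter> V)) (\<psi> \<circ> inv_into U \<phi>)"
  using assms by (auto simp: smooth_manifold_def)

lemma smooth_manifold_prod:
  assumes "smooth_manifold \<A>" "smooth_manifold \<B>"
  shows "smooth_manifold (prod_atlas \<A> \<B>)"
proof -
  note cov = smooth_manifold_covering[OF assms(1)] smooth_manifold_covering[OF assms(2)]
  have "smooth_on (c ` (A \<inter> B)) (d \<circ> inv_into A c)"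
    if "(A, c) \<in> prod_atlas \<A> \<B>" "(B, d) \<in> prod_atlas \<A> \<B>" for A c B d
  proof -
    obtain U \<phi> V \<psi> where c: "A = U \<times> V" "c = map_prod \<phi> \<psi>" "(U, \<phi>) \<in> \<A>" "(V, \<psi>) \<in> \<B>"
      using \<open>(A, c) \<in> prod_atlas \<A> \<B>\<close> by (auto simp: prod_atlas_def)
    obtain U' \<phi>' V' \<psi>' where d: "B = U' \<times> V'" "d = map_prod \<phi>' \<psi>'" "(U', \<phi>') \<in> \<A>" "(V', \<psi>') \<in> \<B>"
      using \<open>(B, d) \<in> prod_atlas \<A> \<B>\<close> by (auto simp: prod_atlas_def)
    note ch = covering_atlas_chart[OF cov(1) c(3)] covering_atlas_chart[OF cov(2) c(4)]
      covering_atlas_chart[OF cov(1) d(3)] covering_atlas_chart[OF cov(2) d(4)]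
    have im: "c ` (A \<inter> B) = \<phi> ` (U \<inter> U') \<times> \<psi> ` (V \<inter> V')"
      unfolding c(1,2) d(1) Times_Int_Times by (rule map_prod_surj_on[OF refl refl])
    have o: "open (\<phi> ` (U \<inter> U'))" "open (\<psi> ` (V \<inter> V'))"
      using is_chart_open_image[OF ch(1) is_chartD(1)[OF ch(3)]] is_chart_open_image[OF ch(2) is_chartD(1)[OF ch(4)]] by auto
    have "smooth_on (\<phi> ` (U \<inter> U') \<times> \<psi> ` (V \<inter> V')) (\<lambda>z. ((\<phi>' \<circ> inv_into U \<phi>) (fst z), (\<psi>' \<circ> inv_into V \<psi>) (snd z)))"
    proof (rule smooth_on_Pair[OF open_Times[OF o]])
      show "smooth_on (\<phi> ` (U \<inter> U') \<times> \<psi> ` (V \<inter> V')) (\<lambda>z. (\<phi>' \<circ> inv_into U \<phi>) (fst z))"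
        by (rule smooth_on_compose[OF smooth_manifold_transition[OF assms(1) c(3) d(3)] smooth_on_fst[OF open_Times[OF o]]])
           (use o in \<open>auto intro: open_Times\<close>)
      show "smooth_on (\<phi> ` (U \<inter> U') \<times> \<psi> ` (V \<inter> V')) (\<lambda>z. (\<psi>' \<circ> inv_into V \<psi>) (snd z))"
        by (rule smooth_on_compose[OF smooth_manifold_transition[OF assms(2) c(4) d(4)] smooth_on_snd[OF open_Times[OF o]]])
           (use o in \<open>auto intro: open_Times\<close>)
    qed
    then show ?thesis
      unfolding im
    proof (rule smooth_on_cong[OF _ open_Times[OF o]])
      fix z assume "z \<in> \<phi> ` (U \<inter> U') \<times> \<psi> ` (V \<inter> V')"
      then have "inv_into A c (fst z, snd z) = (inv_into U \<phi> (fst z), inv_into V \<psi> (snd z))"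
        unfolding c(1,2) by (intro inv_into_map_prod is_chartD(5)[OF ch(1)] is_chartD(5)[OF ch(2)]) auto
      then show "((\<phi>' \<circ> inv_into U \<phi>) (fst z), (\<psi>' \<circ> inv_into V \<psi>) (snd z)) = (d \<circ> inv_into A c) z"
        by (simp add: d(2))
    qed
  qed
  then show ?thesis
    using covering_prod_atlas[OF cov] by (auto simp: smooth_manifold_def covering_atlas_def)
qed

lemma smooth_map_on_snd:
  assumes "smooth_manifold \<A>" "smooth_manifold \<B>"
  shows "smooth_map_on (prod_atlas \<A> \<B>) \<B> UNIV snd"
proof (rule smooth_map_onI)
  show "continuous_on UNIV snd" by (intro continuous_intros)
  note cov = smooth_manifold_covering[OF assms(1)] smooth_manifold_covering[OF assms(2)]
  fix A c Z \<xi> assume "(A, c) \<in> prod_atlas \<A> \<B>" and Z: "(Z, \<xi>) \<in> \<B>"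
  then obtain U \<phi> V \<psi> where c: "A = U \<times> V" "c = map_prod \<phi> \<psi>" "(U, \<phi>) \<in> \<A>" "(V, \<psi>) \<in> \<B>"
    by (auto simp: prod_atlas_def)
  note ch = covering_atlas_chart[OF cov(1) c(3)] covering_atlas_chart[OF cov(2) c(4)] covering_atlas_chart[OF cov(2) Z]
  have "A \<inter> UNIV \<inter> snd -` Z = U \<times> (V \<inter> Z)" by (auto simp: c(1))
  then have im: "c ` (A \<inter> UNIV \<inter> snd -` Z) = \<phi> ` U \<times> \<psi> ` (V \<inter> Z)"
    unfolding c(2) using map_prod_surj_on[OF refl refl] by metis
  have o1: "open (\<psi> ` (V \<inter> Z))" by (rule is_chart_open_image[OF ch(2) is_chartD(1)[OF ch(3)]])
  note o = o1 open_Times[OF is_chartD(2)[OF ch(1)] o1]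
  have "smooth_on (\<phi> ` U \<times> \<psi> ` (V \<inter> Z)) (\<lambda>z. (\<xi> \<circ> inv_into V \<psi>) (snd z))"
    by (rule smooth_on_compose[OF smooth_manifold_transition[OF assms(2) c(4) Z] smooth_on_snd[OF o(2)] _ o(2,1)]) auto
  then show "smooth_on (c ` (A \<inter> UNIV \<inter> snd -` Z)) (\<xi> \<circ> snd \<circ> inv_into A c)"
    unfolding im
  proof (rule smooth_on_cong[OF _ o(2)])
    fix z assume "z \<in> \<phi> ` U \<times> \<psi> ` (V \<inter> Z)"
    then have "inv_into A c (fst z, snd z) = (inv_into U \<phi> (fst z), inv_into V \<psi> (snd z))"
      unfolding c(1,2) by (intro inv_into_map_prod is_chartD(5)[OF ch(1)] is_chartD(5)[OF ch(2)]) auto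
    then show "(\<xi> \<circ> inv_into V \<psi>) (snd z) = (\<xi> \<circ> snd \<circ> inv_into A c) z" by simp
  qed
qed

section \<open>Differentials\<close>

lemma smooth_fun_compose:
  assumes "covering_atlas \<A>" "covering_atlas \<B>" "smooth_map_on \<A> \<B> UNIV F" "smooth_fun \<B> f"
  shows "smooth_fun \<A> (f \<circ> F)"
  using smooth_fun_on_compose[OF assms(1,2) open_UNIV open_UNIV _ assms(3,4)] by (simp add: o_def)

lemma push_in_tangent_space:
  assumes "covering_atlas \<A>" "covering_atlas \<B>" "smooth_map_on \<A> \<B> UNIV F" "v \<in> tangent_space \<A> x"
  shows "push \<B> F v \<in> tangent_space \<B> (F x)"
proof -
  note c = smooth_fun_compose[OF assms(1-3), unfolded o_def]
  note s = smooth_fun_on_add[OF assms(2) open_UNIV] smooth_fun_on_mult[OF assms(2) open_UNIV]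
    smooth_fun_on_const[OF assms(2) open_UNIV]
  show ?thesis
    unfolding tangent_space_def mem_Collect_eq
    by (simp add: push_def o_def s c tangent_space_add[OF assms(4)] tangent_space_cmult[OF assms(4)]
        tangent_space_mult[OF assms(4)])
qed

lemma linear_push: "linear (push \<B> F)"
  by (rule linearI) (auto simp: push_def fun_eq_iff scaleR_fun_def plus_fun_def)

lemma push_push:
  assumes "covering_atlas \<B>" "covering_atlas \<C>" "smooth_map_on \<B> \<C> UNIV H"
  shows "push \<C> H (push \<B> F v) = push \<C> (H \<circ> F) v"
  using smooth_fun_compose[OF assms] by (auto simp: push_def fun_eq_iff o_def)

lemma push_ident:
  assumes "v \<in> tangent_space \<A> x"
  shows "push \<A> (\<lambda>x. x) v = v"
  using tangent_space_not_smooth[OF assms] by (auto simp: push_def fun_eq_iff o_def)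

section \<open>Adapted coordinates\<close>

lemma (in smooth_coordinates) restrict:
  assumes "open U"
  shows "smooth_coordinates \<A> (V \<inter> U) \<Phi> \<Psi>"
proof
  show "open (\<Phi> ` (V \<inter> U))" by (rule open_coord_image) (use assms open_domain in auto)
qed (use assms manifold open_domain param_coord smooth_map_on_subset[OF smooth_coord] smooth_map_on_subset[OF smooth_param] in \<open>auto simp: image_mono\<close>)

lemma smooth_coordinates_pullback:
  assumes "smooth_manifold \<A>" "diffeomorphism_on \<A> \<B> U U' F" "open U" "open U'"
    and "smooth_coordinates \<B> W \<phi> \<psi>" "W \<subseteq> U'"
  shows "smooth_coordinates \<A> (U \<inter> F -` W) (\<lambda>x. \<phi> (F x)) (\<lambda>z. inv_into U F (\<psi> z))"
proof -
  interpret W: smooth_coordinates \<B> W \<phi> \<psi> by fact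
  note cov = smooth_manifold_covering[OF assms(1)]
  have F: "bij_betw F U U'" "smooth_map_on \<A> \<B> U F" "smooth_map_on \<B> \<A> U' (inv_into U F)"
    using assms(2) by (auto simp: diffeomorphism_on_def)
  have FW: "F ` (U \<inter> F -` W) = W" using F(1) assms(6) by (force simp: bij_betw_def)
  then have im: "(\<lambda>x. \<phi> (F x)) ` (U \<inter> F -` W) = \<phi> ` W" by (metis image_image)
  have o: "open (U \<inter> F -` W)"
    by (rule continuous_on_open_vimage_Int[OF smooth_map_onD(1)[OF F(2)] assms(3) W.open_domain])
  show ?thesis
  proof
    show "smooth_map_on \<A> euclidean_atlas (U \<inter> F -` W) (\<lambda>x. \<phi> (F x))"
      by (rule smooth_map_on_compose[OF cov W.covering covering_euclidean_atlas o W.open_domain _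
            smooth_map_on_subset[OF F(2)] W.smooth_coord]) auto
    show "smooth_map_on euclidean_atlas \<A> ((\<lambda>x. \<phi> (F x)) ` (U \<inter> F -` W)) (\<lambda>z. inv_into U F (\<psi> z))"
      unfolding im
      by (rule smooth_map_on_compose[OF covering_euclidean_atlas W.covering cov W.open_range assms(4) _ W.smooth_param F(3)])
         (use W.param_coord assms(6) in auto)
    show "inv_into U F (\<psi> (\<phi> (F x))) = x" if "x \<in> U \<inter> F -` W" for x
      using that W.param_coord F(1) by (auto simp: bij_betw_def)
    show "open ((\<lambda>x. \<phi> (F x)) ` (U \<inter> F -` W))" unfolding im by (rule W.open_range)
  qed (use assms(1) o in auto)
qed

locale adapted_coordinates =
  total: smooth_coordinates \<A> V \<Phi> \<Psi> + base: smooth_coordinates \<S> U \<psi> \<psi>i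
  for \<A> :: "('m::{t2_space,second_countable_topology}, 'e::euclidean_space) chart set"
    and \<S> :: "('s::{t2_space,second_countable_topology}, 'f::euclidean_space) chart set"
    and V :: "'m set" and \<Phi> :: "'m \<Rightarrow> 'f \<times> real" and \<Psi> and U and \<psi> :: "'s \<Rightarrow> 'f" and \<psi>i +
  fixes \<pi> :: "'m \<Rightarrow> 's"
  assumes smooth_proj: "smooth_map_on \<A> \<S> UNIV \<pi>"
    and fst_coord: "x \<in> V \<Longrightarrow> \<pi> x \<in> U \<and> fst (\<Phi> x) = \<psi> (\<pi> x)"
begin

lemma proj_param: "z \<in> \<Phi> ` V \<Longrightarrow> \<pi> (\<Psi> z) = \<psi>i (fst z)"
  using fst_coord total.param_coord base.param_coord by auto

text \<open>In adapted coordinates \<pi> is the first projection.\<close>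

lemma push_coord_vec:
  assumes x: "x \<in> V"
  shows "push \<S> \<pi> (total.coord_vec x w) = base.coord_vec (\<pi> x) (fst w)"
proof (rule ext)
  fix f show "push \<S> \<pi> (total.coord_vec x w) f = base.coord_vec (\<pi> x) (fst w) f"
  proof (cases "smooth_fun \<S> f")
    case f: True
    have s: "smooth_fun \<A> (f \<circ> \<pi>)" by (rule smooth_fun_compose[OF total.covering base.covering smooth_proj f])
    have "smooth_on (\<psi> ` U) (\<lambda>y. f (\<psi>i y))"
      by (rule base.smooth_on_param[OF base.open_domain order_refl smooth_fun_on_subset[OF f]]) simp
    then have D: "((\<lambda>y. f (\<psi>i y)) has_derivative frechet_derivative (\<lambda>y. f (\<psi>i y)) (at (fst (\<Phi> x)))) (at (fst (\<Phi> x)))"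
      using fst_coord[OF x] smooth_on_has_derivative by auto
    have D2: "((\<lambda>z. f (\<psi>i (fst z))) has_derivative (\<lambda>w. frechet_derivative (\<lambda>y. f (\<psi>i y)) (at (fst (\<Phi> x))) (fst w))) (at (\<Phi> x))"
      using has_derivative_compose[OF bounded_linear_imp_has_derivative[OF bounded_linear_fst] D] .
    have "frechet_derivative (\<lambda>z. (f \<circ> \<pi>) (\<Psi> z)) (at (\<Phi> x)) = frechet_derivative (\<lambda>z. f (\<psi>i (fst z))) (at (\<Phi> x))"
      by (rule frechet_derivative_cong_open[OF total.open_range imageI[OF x]]) (simp add: proj_param)
    also have "\<dots> = (\<lambda>w. frechet_derivative (\<lambda>y. f (\<psi>i y)) (at (fst (\<Phi> x))) (fst w))"
      using frechet_derivative_at[OF D2] by simp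
    finally show ?thesis using f s fst_coord[OF x]
      by (simp add: push_def total.coord_vec_def base.coord_vec_def)
  qed (simp add: push_def base.coord_vec_def)
qed

lemma push_surj:
  assumes x: "x \<in> V" and d: "d \<in> tangent_space \<S> (\<pi> x)"
  shows "\<exists>v\<in>tangent_space \<A> x. push \<S> \<pi> v = d"
proof -
  obtain w where "d = base.coord_vec (\<pi> x) w"
    using base.tangent_space_eq_coord_vec[OF _ d] fst_coord[OF x] by auto
  then show ?thesis
    using push_coord_vec[OF x, of "(w, 0)"] total.coord_vec_in_tangent_space[OF x] by auto
qed

text \<open>In adapted coordinates the preimage of \<open>B\<close> is the product of \<open>B\<close> with the line of the fibre.\<close>

lemma dim_push_preimage:
  assumes x: "x \<in> V" and B: "subspace B" "B \<subseteq> tangent_space \<S> (\<pi> x)"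
  shows "dim {v \<in> tangent_space \<A> x. push \<S> \<pi> v \<in> B} = dim B + 1"
proof -
  have xU: "\<pi> x \<in> U" using fst_coord[OF x] by auto
  define B' where "B' = base.coord_vec (\<pi> x) -` B"
  have B': "subspace B'" unfolding B'_def by (rule linear_subspace_vimage[OF base.linear_coord_vec[OF xU] B(1)])
  have "B = base.coord_vec (\<pi> x) ` B'"
    using B(2) base.tangent_space_range[OF xU] unfolding B'_def by (simp add: image_vimage_eq Int_absorb2)
  then have dB: "dim B = dim B'"
    using dim_linear_image_inj[OF base.linear_coord_vec[OF xU] base.coord_vec_inj[OF xU]] by simp
  have "{v \<in> tangent_space \<A> x. push \<S> \<pi> v \<in> B} = total.coord_vec x ` (B' \<times> UNIV)"
    unfolding total.tangent_space_range[OF x] B'_def using push_coord_vec[OF x] by (auto simp: image_iff) 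
  then have "dim {v \<in> tangent_space \<A> x. push \<S> \<pi> v \<in> B} = dim (B' \<times> (UNIV :: real set))"
    using dim_linear_image_inj[OF total.linear_coord_vec[OF x] total.coord_vec_inj[OF x]] by simp
  also have "\<dots> = dim B' + 1" using dim_Times[OF B' subspace_UNIV, where ?'b = real] by simp
  finally show ?thesis using dB by simp
qed

text \<open>The horizontal lift with respect to adapted coordinates. It is defined near \<open>x0\<close> only and is made
  global by a bump, which is the factor \<open>c\<close>.\<close>

lemma lift_vector_field:
  assumes Y: "smooth_vector_field_on \<S> UNIV Y" and x0: "x0 \<in> V"
  shows "\<exists>X c O'. smooth_vector_field_on \<A> UNIV X \<and> open O' \<and> x0 \<in> O' \<and>
    (\<forall>x\<in>O'. c x = (1::real)) \<and> (\<forall>x. push \<S> \<pi> (X x) = c x *\<^sub>R Y (\<pi> x))"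
proof -
  have U0: "\<pi> x0 \<in> U" using fst_coord[OF x0] by auto
  obtain \<kappa> O1 where O1: "open O1" "\<pi> x0 \<in> O1" "O1 \<subseteq> U" and \<kappa>: "\<forall>b. smooth_fun \<S> (\<kappa> b)"
      "\<forall>x\<in>O1. \<forall>b w. base.coord_vec x w (\<kappa> b) = w \<bullet> b"
    by (rule base.coordinate_functions[OF U0])
  define w where "w s = (\<Sum>b\<in>Basis. Y s (\<kappa> b) *\<^sub>R b)" for s
  have Yw: "Y s = base.coord_vec s (w s)" if s: "s \<in> O1" for s
  proof -
    obtain u where u: "Y s = base.coord_vec s u"
      using base.tangent_space_eq_coord_vec[OF subsetD[OF O1(3) s]] smooth_vector_field_onD(1)[OF Y] by auto
    have "w s = (\<Sum>b\<in>Basis. (u \<bullet> b) *\<^sub>R b)" unfolding w_def using u \<kappa>(2) s by simp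
    then show ?thesis using u by (simp add: euclidean_representation)
  qed
  define P where "P = V \<inter> \<pi> -` O1"
  have P: "open P" "x0 \<in> P" "P \<subseteq> V"
    using total.open_domain open_vimage[OF O1(1) smooth_map_onD(1)[OF smooth_proj]] x0 O1(2) by (auto simp: P_def)
  obtain \<beta> O2 K where b: "smooth_fun \<A> \<beta>" "open O2" "x0 \<in> O2" "closed K" "K \<subseteq> P"
    "\<And>y. y \<in> O2 \<Longrightarrow> \<beta> y = 1" "\<And>y. y \<notin> K \<Longrightarrow> \<beta> y = 0"
    using smooth_bump_exists[OF total.manifold P(1,2)] by metis
  define X where "X x = \<beta> x *\<^sub>R total.coord_vec x (w (\<pi> x), 0)" for x
  have "smooth_vector_field_on \<A> UNIV X"
    unfolding X_def
  proof (rule smooth_vector_field_cutoff[OF total.covering P(1) b(1,4,5,7)])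
    show "smooth_vector_field_on \<A> P (\<lambda>x. total.coord_vec x (w (\<pi> x), 0))"
    proof (rule total.smooth_vector_field_coord_vec[OF P(1,3)])
      fix b :: "'f \<times> real"
      have "smooth_fun_on \<A> P (\<lambda>x. Y (\<pi> x) (\<kappa> c))" for c
        by (rule smooth_fun_on_compose[OF total.covering base.covering P(1) open_UNIV _
              smooth_map_on_subset[OF smooth_proj] smooth_vector_field_onD(2)[OF Y]]) (use \<kappa>(1) in auto)
      then have "smooth_fun_on \<A> P (\<lambda>x. \<Sum>c\<in>Basis. Y (\<pi> x) (\<kappa> c) * (c \<bullet> fst b))"
        by (intro smooth_fun_on_sum[OF total.covering P(1)] smooth_fun_on_mult[OF total.covering P(1)]
            smooth_fun_on_const[OF total.covering P(1)]) auto
      then show "smooth_fun_on \<A> P (\<lambda>x. (w (\<pi> x), 0) \<bullet> b)"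
        by (simp add: w_def inner_prod_def inner_sum_left)
    qed
  qed
  moreover have "push \<S> \<pi> (X x) = \<beta> x *\<^sub>R Y (\<pi> x)" for x
  proof (cases "x \<in> P")
    case True
    then show ?thesis
      unfolding X_def linear_scale[OF linear_push] using push_coord_vec[of x] Yw[of "\<pi> x"] by (auto simp: P_def)
  next
    case False
    then have "\<beta> x = 0" using b(5,7) by auto
    then show ?thesis by (simp add: X_def linear_0[OF linear_push])
  qed
  ultimately show ?thesis using b(2,3,6) by blast
qed

text \<open>Keep the fibre coordinate at its value at \<open>x0\<close>.\<close>

lemma local_section:
  assumes x0: "x0 \<in> V"
  shows "\<exists>\<sigma> O'. open O' \<and> \<pi> x0 \<in> O' \<and> smooth_map_on \<S> \<A> O' \<sigma> \<and> (\<forall>s\<in>O'. \<pi> (\<sigma> s) = s) \<and> \<sigma> (\<pi> x0) = x0"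
proof -
  define j where "j s = (\<psi> s, snd (\<Phi> x0))" for s
  have j: "smooth_map_on \<S> euclidean_atlas U j"
    unfolding j_def prod_euclidean_atlas[symmetric]
    by (rule smooth_map_on_Pair[OF base.covering covering_euclidean_atlas covering_euclidean_atlas base.open_domain
          base.smooth_coord smooth_map_on_const[OF base.covering covering_euclidean_atlas base.open_domain]])
  define O' where "O' = U \<inter> j -` (\<Phi> ` V)"
  have O': "open O'" unfolding O'_def
    by (rule continuous_on_open_vimage_Int[OF smooth_map_onD(1)[OF j] base.open_domain total.open_range])
  have j0: "j (\<pi> x0) = \<Phi> x0" using fst_coord[OF x0] by (simp add: j_def prod_eq_iff)
  have "smooth_map_on \<S> \<A> O' (\<lambda>s. \<Psi> (j s))"
    by (rule smooth_map_on_compose[OF base.covering covering_euclidean_atlas total.covering O' total.open_range _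
          smooth_map_on_subset[OF j] total.smooth_param]) (auto simp: O'_def)
  moreover have "\<pi> (\<Psi> (j s)) = s" if "s \<in> O'" for s
    using that proj_param[of "j s"] base.param_coord by (auto simp: O'_def j_def)
  ultimately show ?thesis
    using O' j0 x0 fst_coord[OF x0] total.param_coord[OF x0]
    by (intro exI[of _ "\<lambda>s. \<Psi> (j s)"] exI[of _ O']) (auto simp: O'_def)
qed

end

section \<open>Principal bundles with one-dimensional fibres\<close>

locale principal_line_bundle =
  fixes \<A> :: "('m::{t2_space,second_countable_topology}, 'e::euclidean_space) chart set"
    and \<S> :: "('s::{t2_space,second_countable_topology}, 'f::euclidean_space) chart set"
    and G :: "'g::{t2_space,second_countable_topology} monoid"
    and \<G> :: "('g, real) chart set"
    and \<pi> :: "'m \<Rightarrow> 's"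
    and act :: "'m \<Rightarrow> 'g \<Rightarrow> 'm"
  assumes principal: "principal_bundle \<A> \<S> G \<G> \<pi> act"
begin

lemma manifolds: "smooth_manifold \<A>" "smooth_manifold \<S>" "smooth_manifold \<G>"
  and smooth_proj: "smooth_map_on \<A> \<S> UNIV \<pi>"
  and smooth_act: "smooth_map_on (prod_atlas \<A> \<G>) \<A> UNIV (\<lambda>(x, a). act x a)"
  and act_one: "act x \<one>\<^bsub>G\<^esub> = x" and act_mult: "act (act x a) b = act x (a \<otimes>\<^bsub>G\<^esub> b)"
  and proj_act: "\<pi> (act x a) = \<pi> x"
  and group: "group G" "carrier G = UNIV"
  and smooth_mult: "smooth_map_on (prod_atlas \<G> \<G>) \<G> UNIV (\<lambda>(a, b). a \<otimes>\<^bsub>G\<^esub> b)"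
  using principal by (auto simp: principal_bundle_def lie_group_def)

lemmas cov = smooth_manifold_covering[OF manifolds(1)] smooth_manifold_covering[OF manifolds(2)]
  smooth_manifold_covering[OF manifolds(3)]

lemma mult_inv_cancel: "a \<otimes>\<^bsub>G\<^esub> (inv\<^bsub>G\<^esub> a \<otimes>\<^bsub>G\<^esub> b) = b" "inv\<^bsub>G\<^esub> a \<otimes>\<^bsub>G\<^esub> (a \<otimes>\<^bsub>G\<^esub> b) = b"
proof -
  interpret group G by (rule group(1))
  show "a \<otimes>\<^bsub>G\<^esub> (inv\<^bsub>G\<^esub> a \<otimes>\<^bsub>G\<^esub> b) = b" "inv\<^bsub>G\<^esub> a \<otimes>\<^bsub>G\<^esub> (a \<otimes>\<^bsub>G\<^esub> b) = b"
    using m_assoc[of a "inv\<^bsub>G\<^esub> a" b] m_assoc[of "inv\<^bsub>G\<^esub> a" a b] group(2) by auto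
qed

lemma trivialization:
  obtains U \<tau> where "open U" "s \<in> U"
    "diffeomorphism_on \<A> (prod_atlas \<S> \<G>) (\<pi> -` U) (U \<times> UNIV) (\<lambda>x. (\<pi> x, \<tau> x))"
    "\<forall>x\<in>\<pi> -` U. \<forall>a. \<tau> (act x a) = \<tau> x \<otimes>\<^bsub>G\<^esub> a"
  using principal unfolding principal_bundle_def by blast

lemma open_proj_vimage: "open U \<Longrightarrow> open (\<pi> -` U)"
  using open_vimage smooth_map_onD(1)[OF smooth_proj] by blast

text \<open>A local trivialization followed by a product chart.\<close>

lemma adapted_coordinates_exist:
  "\<exists>V \<Phi> \<Psi> U \<psi> \<psi>i. adapted_coordinates \<A> \<S> V \<Phi> \<Psi> U \<psi> \<psi>i \<pi> \<and> x0 \<in> V"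
proof -
  obtain U0 \<tau> where U0: "open U0" "\<pi> x0 \<in> U0"
    and T: "diffeomorphism_on \<A> (prod_atlas \<S> \<G>) (\<pi> -` U0) (U0 \<times> UNIV) (\<lambda>x. (\<pi> x, \<tau> x))"
    by (rule trivialization[of "\<pi> x0"])
  obtain Y \<psi> where Y: "(Y, \<psi>) \<in> \<S>" "\<pi> x0 \<in> Y" using covering_atlas_obtain[OF cov(2)] .
  obtain Z \<theta> where Z: "(Z, \<theta>) \<in> \<G>" "\<tau> x0 \<in> Z" using covering_atlas_obtain[OF cov(3)] .
  have c: "(Y \<times> Z, map_prod \<psi> \<theta>) \<in> prod_atlas \<S> \<G>" using Y Z by (auto simp: prod_atlas_def)
  have oU: "open (U0 \<times> (UNIV :: 'g set))" using U0 by (intro open_Times) auto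
  interpret W: smooth_coordinates "prod_atlas \<S> \<G>" "Y \<times> Z" "map_prod \<psi> \<theta>" "inv_into (Y \<times> Z) (map_prod \<psi> \<theta>)"
    by (rule smooth_coordinates_chart[OF smooth_manifold_prod[OF manifolds(2,3)] c])
  define V where "V = \<pi> -` U0 \<inter> (\<lambda>x. (\<pi> x, \<tau> x)) -` ((Y \<times> Z) \<inter> (U0 \<times> UNIV))"
  have 1: "smooth_coordinates \<A> V (\<lambda>x. map_prod \<psi> \<theta> (\<pi> x, \<tau> x))
     (\<lambda>z. inv_into (\<pi> -` U0) (\<lambda>x. (\<pi> x, \<tau> x)) (inv_into (Y \<times> Z) (map_prod \<psi> \<theta>) z))"
    unfolding V_def
    by (rule smooth_coordinates_pullback[OF manifolds(1) T open_proj_vimage[OF U0(1)] oU W.restrict[OF oU]]) auto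
  have "adapted_coordinates \<A> \<S> V (\<lambda>x. map_prod \<psi> \<theta> (\<pi> x, \<tau> x))
     (\<lambda>z. inv_into (\<pi> -` U0) (\<lambda>x. (\<pi> x, \<tau> x)) (inv_into (Y \<times> Z) (map_prod \<psi> \<theta>) z)) Y \<psi> (inv_into Y \<psi>) \<pi>"
    by (intro adapted_coordinates.intro[OF 1 smooth_coordinates_chart[OF manifolds(2) Y(1)]] adapted_coordinates_axioms.intro smooth_proj)
       (auto simp: V_def)
  moreover have "x0 \<in> V" using U0 Y Z by (auto simp: V_def)
  ultimately show ?thesis by blast
qed

lemma push_proj_in_tangent_space: "v \<in> tangent_space \<A> x \<Longrightarrow> push \<S> \<pi> v \<in> tangent_space \<S> (\<pi> x)"
  by (rule push_in_tangent_space[OF cov(1,2) smooth_proj])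

lemma push_proj_surj:
  assumes "d \<in> tangent_space \<S> (\<pi> x)"
  shows "\<exists>v\<in>tangent_space \<A> x. push \<S> \<pi> v = d"
proof -
  obtain V \<Phi> \<Psi> U \<psi> \<psi>i where ad: "adapted_coordinates \<A> \<S> V \<Phi> \<Psi> U \<psi> \<psi>i \<pi>" "x \<in> V"
    using adapted_coordinates_exist[of x] by (elim exE conjE)
  show ?thesis by (rule adapted_coordinates.push_surj[OF ad(1) ad(2) assms])
qed

lemma dim_push_preimage:
  assumes "subspace B" "B \<subseteq> tangent_space \<S> (\<pi> x)"
  shows "dim {v \<in> tangent_space \<A> x. push \<S> \<pi> v \<in> B} = dim B + 1"
proof -
  obtain V \<Phi> \<Psi> U \<psi> \<psi>i where ad: "adapted_coordinates \<A> \<S> V \<Phi> \<Psi> U \<psi> \<psi>i \<pi>" "x \<in> V"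
    using adapted_coordinates_exist[of x] by (elim exE conjE)
  show ?thesis by (rule adapted_coordinates.dim_push_preimage[OF ad(1) ad(2) assms])
qed

lemma lift_vector_field:
  assumes "smooth_vector_field_on \<S> UNIV Y"
  shows "\<exists>X c O'. smooth_vector_field_on \<A> UNIV X \<and> open O' \<and> x0 \<in> O' \<and>
    (\<forall>x\<in>O'. c x = (1::real)) \<and> (\<forall>x. push \<S> \<pi> (X x) = c x *\<^sub>R Y (\<pi> x))"
proof -
  obtain V \<Phi> \<Psi> U \<psi> \<psi>i where ad: "adapted_coordinates \<A> \<S> V \<Phi> \<Psi> U \<psi> \<psi>i \<pi>" "x0 \<in> V"
    using adapted_coordinates_exist[of x0] by (elim exE conjE)
  show ?thesis by (rule adapted_coordinates.lift_vector_field[OF ad(1) assms ad(2)])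
qed

lemma local_section:
  "\<exists>\<sigma> O'. open O' \<and> \<pi> x0 \<in> O' \<and> smooth_map_on \<S> \<A> O' \<sigma> \<and> (\<forall>s\<in>O'. \<pi> (\<sigma> s) = s) \<and> \<sigma> (\<pi> x0) = x0"
proof -
  obtain V \<Phi> \<Psi> U \<psi> \<psi>i where ad: "adapted_coordinates \<A> \<S> V \<Phi> \<Psi> U \<psi> \<psi>i \<pi>" "x0 \<in> V"
    using adapted_coordinates_exist[of x0] by (elim exE conjE)
  show ?thesis by (rule adapted_coordinates.local_section[OF ad])
qed

lemma proj_surj: "\<exists>x. \<pi> x = s"
proof -
  obtain U \<tau> where "s \<in> U" "diffeomorphism_on \<A> (prod_atlas \<S> \<G>) (\<pi> -` U) (U \<times> UNIV) (\<lambda>x. (\<pi> x, \<tau> x))"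
    by (rule trivialization[of s])
  then have "(\<lambda>x. (\<pi> x, \<tau> x)) ` (\<pi> -` U) = U \<times> UNIV" by (auto simp: diffeomorphism_on_def bij_betw_def)
  then have "(s, undefined) \<in> (\<lambda>x. (\<pi> x, \<tau> x)) ` (\<pi> -` U)" using \<open>s \<in> U\<close> by auto
  then show ?thesis by auto
qed

text \<open>The group element is \<open>(\<tau> x)\<^sup>-\<^sup>1 * \<tau> y\<close> for the fibre component \<tau> of a trivialization.\<close>

lemma act_transitive:
  assumes "\<pi> x = \<pi> y"
  shows "\<exists>a. y = act x a"
proof -
  obtain U \<tau> where U: "\<pi> x \<in> U" "diffeomorphism_on \<A> (prod_atlas \<S> \<G>) (\<pi> -` U) (U \<times> UNIV) (\<lambda>x. (\<pi> x, \<tau> x))"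
    and \<tau>: "\<forall>x\<in>\<pi> -` U. \<forall>a. \<tau> (act x a) = \<tau> x \<otimes>\<^bsub>G\<^esub> a"
    by (rule trivialization[of "\<pi> x"])
  have inj: "inj_on (\<lambda>x. (\<pi> x, \<tau> x)) (\<pi> -` U)" using U by (auto simp: diffeomorphism_on_def bij_betw_def)
  define a where "a = inv\<^bsub>G\<^esub> (\<tau> x) \<otimes>\<^bsub>G\<^esub> \<tau> y"
  have "\<tau> x \<otimes>\<^bsub>G\<^esub> a = \<tau> y"
    unfolding a_def by (rule mult_inv_cancel)
  then have "\<tau> (act x a) = \<tau> y" using \<tau> U(1) by auto
  then have "act x a = y"
    using inj_onD[OF inj, of "act x a" y] proj_act[of x a] assms U(1) by auto
  then show ?thesis by auto
qed

lemma smooth_right_translation: "smooth_map_on \<A> \<A> UNIV (\<lambda>y. act y a)"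
  using smooth_map_on_compose[OF cov(1) covering_prod_atlas[OF cov(1,3)] cov(1) open_UNIV open_UNIV _
      smooth_map_on_Pair[OF cov(1,1,3) open_UNIV smooth_map_on_ident[OF manifolds(1)] smooth_map_on_const[OF cov(1,3) open_UNIV]] smooth_act]
  by simp

lemma smooth_orbit_map: "smooth_map_on \<G> \<A> UNIV (act x)"
  using smooth_map_on_compose[OF cov(3) covering_prod_atlas[OF cov(1,3)] cov(1) open_UNIV open_UNIV _
      smooth_map_on_Pair[OF cov(3,1,3) open_UNIV smooth_map_on_const[OF cov(3,1) open_UNIV] smooth_map_on_ident[OF manifolds(3)]] smooth_act]
  by simp

lemma smooth_left_mult: "smooth_map_on \<G> \<G> UNIV (\<lambda>b. a \<otimes>\<^bsub>G\<^esub> b)"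
  using smooth_map_on_compose[OF cov(3) covering_prod_atlas[OF cov(3,3)] cov(3) open_UNIV open_UNIV _
      smooth_map_on_Pair[OF cov(3,3,3) open_UNIV smooth_map_on_const[OF cov(3,3) open_UNIV] smooth_map_on_ident[OF manifolds(3)]] smooth_mult]
  by simp

lemma push_right_translation:
  assumes "v \<in> tangent_space \<A> x"
  shows "push \<A> (\<lambda>y. act y a) v \<in> tangent_space \<A> (act x a)"
    and "push \<S> \<pi> (push \<A> (\<lambda>y. act y a) v) = push \<S> \<pi> v"
proof -
  show "push \<A> (\<lambda>y. act y a) v \<in> tangent_space \<A> (act x a)"
    by (rule push_in_tangent_space[OF cov(1,1) smooth_right_translation assms])
  have "push \<S> \<pi> (push \<A> (\<lambda>y. act y a) v) = push \<S> (\<pi> \<circ> (\<lambda>y. act y a)) v"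
    by (rule push_push[OF cov(1,2) smooth_proj])
  then show "push \<S> \<pi> (push \<A> (\<lambda>y. act y a) v) = push \<S> \<pi> v" by (simp add: o_def proj_act)
qed

lemma push_right_translation_inverse:
  assumes "v \<in> tangent_space \<A> (act x a)"
  shows "push \<A> (\<lambda>y. act y a) (push \<A> (\<lambda>y. act y (inv\<^bsub>G\<^esub> a)) v) = v"
    and "push \<A> (\<lambda>y. act y (inv\<^bsub>G\<^esub> a)) v \<in> tangent_space \<A> x"
proof -
  have "push \<A> (\<lambda>y. act y a) (push \<A> (\<lambda>y. act y (inv\<^bsub>G\<^esub> a)) v) = push \<A> ((\<lambda>y. act y a) \<circ> (\<lambda>y. act y (inv\<^bsub>G\<^esub> a))) v"
    by (rule push_push[OF cov(1,1) smooth_right_translation])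
  also have "(\<lambda>y. act y a) \<circ> (\<lambda>y. act y (inv\<^bsub>G\<^esub> a)) = (\<lambda>y. y)"
    using group group.l_inv[of G a] by (auto simp: act_mult act_one fun_eq_iff)
  also have "push \<A> (\<lambda>y. y) v = v" by (rule push_ident[OF assms])
  finally show "push \<A> (\<lambda>y. act y a) (push \<A> (\<lambda>y. act y (inv\<^bsub>G\<^esub> a)) v) = v" .
  have "act (act x a) (inv\<^bsub>G\<^esub> a) = x" using group group.r_inv[of G a] by (simp add: act_mult act_one)
  then show "push \<A> (\<lambda>y. act y (inv\<^bsub>G\<^esub> a)) v \<in> tangent_space \<A> x"
    using push_in_tangent_space[OF cov(1,1) smooth_right_translation assms, of "inv\<^bsub>G\<^esub> a"] by simp
qed

text \<open>The field is the image of a fixed tangent vector \<open>v1\<close> of the group at the identity under the orbit maps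
  \<open>a \<mapsto> act x a\<close>. It has no zeros because the orbit map has a smooth local left inverse
  \<open>y \<mapsto> (\<tau> x)\<^sup>-\<^sup>1 * \<tau> y\<close>, where \<tau> is the fibre component of a trivialization, and it is smooth because
  \<open>act\<close> is smooth in both arguments.\<close>

lemma vertical_vector_field:
  obtains p where "smooth_vector_field_on \<A> UNIV p" "\<forall>x. p x \<in> vertical_space \<A> \<S> \<pi> x" "\<forall>x. p x \<noteq> 0"
proof -
  obtain Z \<theta> where Z: "(Z, \<theta>) \<in> \<G>" "\<one>\<^bsub>G\<^esub> \<in> Z" using covering_atlas_obtain[OF cov(3)] .
  interpret Z: smooth_coordinates \<G> Z \<theta> "inv_into Z \<theta>"
    by (rule smooth_coordinates_chart[OF manifolds(3) Z(1)])
  define \<gamma> where "\<gamma> = inv_into Z \<theta>"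
  define v1 where "v1 = Z.coord_vec \<one>\<^bsub>G\<^esub> 1"
  have v1: "v1 \<in> tangent_space \<G> \<one>\<^bsub>G\<^esub>" unfolding v1_def by (rule Z.coord_vec_in_tangent_space[OF Z(2)])
  define p where "p x = push \<A> (act x) v1" for x
  have pT: "p x \<in> tangent_space \<A> x" for x
    unfolding p_def using push_in_tangent_space[OF cov(3,1) smooth_orbit_map v1, of x] by (simp add: act_one)
  have "p x \<in> vertical_space \<A> \<S> \<pi> x" for x
  proof -
    have "push \<S> \<pi> (p x) = push \<S> (\<pi> \<circ> act x) v1"
      unfolding p_def by (rule push_push[OF cov(1,2) smooth_proj])
    also have "\<dots> = 0"
      using tangent_space_const[OF cov(3) v1] by (auto simp: push_def o_def proj_act fun_eq_iff)
    finally show ?thesis using pT by (simp add: vertical_space_def)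
  qed
  moreover have "p x \<noteq> 0" for x
  proof
    assume p0: "p x = 0"
    obtain U \<tau> where U: "open U" "\<pi> x \<in> U" and T: "diffeomorphism_on \<A> (prod_atlas \<S> \<G>) (\<pi> -` U) (U \<times> UNIV) (\<lambda>x. (\<pi> x, \<tau> x))"
      and \<tau>: "\<forall>x\<in>\<pi> -` U. \<forall>a. \<tau> (act x a) = \<tau> x \<otimes>\<^bsub>G\<^esub> a"
      by (rule trivialization[of "\<pi> x"])
    note oU = open_proj_vimage[OF U(1)]
    have "smooth_map_on \<A> (prod_atlas \<S> \<G>) (\<pi> -` U) (\<lambda>x. (\<pi> x, \<tau> x))" using T by (simp add: diffeomorphism_on_def)
    from smooth_map_on_compose[OF cov(1) covering_prod_atlas[OF cov(2,3)] cov(3) oU open_UNIV _ this smooth_map_on_snd[OF manifolds(2,3)]]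
    have s\<tau>: "smooth_map_on \<A> \<G> (\<pi> -` U) \<tau>" by simp
    define H where "H y = inv\<^bsub>G\<^esub> (\<tau> x) \<otimes>\<^bsub>G\<^esub> \<tau> y" for y
    have sH: "smooth_map_on \<A> \<G> (\<pi> -` U) H"
      unfolding H_def by (rule smooth_map_on_compose[OF cov(1,3,3) oU open_UNIV _ s\<tau> smooth_left_mult]) simp
    have H: "H (act x a) = a" for a
      unfolding H_def using \<tau> U(2) by (simp add: mult_inv_cancel)
    define P where "P = \<pi> -` U \<inter> H -` Z"
    have P: "open P" "x \<in> P"
      unfolding P_def
      using continuous_on_open_vimage_Int[OF smooth_map_onD(1)[OF sH] oU Z.open_domain] U(2) H[of "\<one>\<^bsub>G\<^esub>"] Z(2)
      by (auto simp: act_one)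
    have "smooth_fun_on \<A> P (\<lambda>y. \<theta> (H y))"
      unfolding smooth_fun_on_def
      by (rule smooth_map_on_compose[OF cov(1,3) covering_euclidean_atlas P(1) Z.open_domain _ smooth_map_on_subset[OF sH] Z.smooth_coord])
         (auto simp: P_def)
    then obtain f Q where f: "smooth_fun \<A> f" "open Q" "x \<in> Q" "Q \<subseteq> P" "\<forall>y\<in>Q. f y = \<theta> (H y)"
      using smooth_fun_extend[OF manifolds(1) P] by metis
    obtain \<kappa> O' where \<kappa>: "open O'" "\<one>\<^bsub>G\<^esub> \<in> O'" "O' \<subseteq> Z" "\<forall>b. smooth_fun \<G> (\<kappa> b)"
        "\<forall>b. \<forall>y\<in>O'. \<kappa> b y = \<theta> y \<bullet> b" "\<forall>y\<in>O'. \<forall>b w. Z.coord_vec y w (\<kappa> b) = w \<bullet> b"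
      by (rule Z.coordinate_functions[OF Z(2)])
    \<comment> \<open>\<open>H\<close> is a left inverse of \<open>act x\<close>, so \<open>f\<close> composed with \<open>act x\<close> is the coordinate \<theta> near the identity.\<close>
    have "v1 (f \<circ> act x) = v1 (\<kappa> 1)"
    proof (rule tangent_space_local[OF manifolds(3) v1])
      show "smooth_fun \<G> (f \<circ> act x)" by (rule smooth_fun_compose[OF cov(3,1) smooth_orbit_map f(1)])
      show "smooth_fun \<G> (\<kappa> 1)" using \<kappa>(4) by blast
      show "open (O' \<inter> act x -` Q)"
        using \<kappa>(1) open_vimage[OF f(2) smooth_map_onD(1)[OF smooth_orbit_map]] by auto
      show "\<one>\<^bsub>G\<^esub> \<in> O' \<inter> act x -` Q" using \<kappa>(2) f(3) by (simp add: act_one)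
      show "(f \<circ> act x) a = \<kappa> 1 a" if "a \<in> O' \<inter> act x -` Q" for a
        using that f(5) \<kappa>(5) by (simp add: H)
    qed
    also have "\<dots> = 1" using \<kappa>(2,6) by (simp add: v1_def)
    finally have "p x f = 1" using f(1) by (simp add: p_def push_def)
    then show False using p0 by simp
  qed
  moreover have "smooth_vector_field_on \<A> UNIV p"
  proof (rule smooth_vector_field_onI[OF pT])
    fix f assume f: "smooth_fun \<A> f"
    show "smooth_fun \<A> (\<lambda>x. p x f)"
    proof (rule smooth_fun_on_local[OF cov(1)])
      fix x0
      obtain V \<phi> where V: "(V, \<phi>) \<in> \<A>" "x0 \<in> V" using covering_atlas_obtain[OF cov(1)] .
      interpret V: smooth_coordinates \<A> V \<phi> "inv_into V \<phi>"
        by (rule smooth_coordinates_chart[OF manifolds(1) V(1)])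
      define B where "B = \<phi> ` V \<times> \<theta> ` Z"
      have oB: "open B" unfolding B_def by (rule open_Times[OF V.open_range Z.open_range])
      note E = covering_euclidean_atlas
      have fst': "smooth_map_on euclidean_atlas euclidean_atlas B fst" and snd': "smooth_map_on euclidean_atlas euclidean_atlas B snd"
        using smooth_on_fst[OF oB] smooth_on_snd[OF oB] by (simp_all add: smooth_map_on_euclidean_iff)
      have 1: "smooth_map_on euclidean_atlas \<A> B (\<lambda>z. inv_into V \<phi> (fst z))"
        by (rule smooth_map_on_compose[OF E E cov(1) oB V.open_range _ fst' V.smooth_param]) (auto simp: B_def)
      have 2: "smooth_map_on euclidean_atlas \<G> B (\<lambda>z. \<gamma> (snd z))"
        unfolding \<gamma>_def
        by (rule smooth_map_on_compose[OF E E cov(3) oB Z.open_range _ snd' Z.smooth_param]) (auto simp: B_def)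
      have 3: "smooth_map_on euclidean_atlas \<A> B (\<lambda>z. act (inv_into V \<phi> (fst z)) (\<gamma> (snd z)))"
        using smooth_map_on_compose[OF E covering_prod_atlas[OF cov(1,3)] cov(1) oB open_UNIV _
            smooth_map_on_Pair[OF E cov(1,3) oB 1 2] smooth_act] by simp
      \<comment> \<open>In coordinates, \<open>p x f\<close> is the derivative of \<open>t \<mapsto> K (\<phi> x, t)\<close> at \<open>t0\<close>.\<close>
      define K where "K z = f (act (inv_into V \<phi> (fst z)) (\<gamma> (snd z)))" for z
      have K: "smooth_on B K"
        using smooth_fun_on_compose[OF E cov(1) oB open_UNIV _ 3 f]
        by (simp add: K_def[abs_def] smooth_fun_on_def smooth_map_on_euclidean_iff)
      define t0 where "t0 = \<theta> \<one>\<^bsub>G\<^esub>"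
      have dK: "smooth_on B (\<lambda>z. frechet_derivative K (at z) (0, 1))" by (rule smooth_on_frechet_derivative[OF K])
      have "smooth_on (\<phi> ` V) (\<lambda>y. frechet_derivative K (at (y, t0)) (0, 1))"
        by (rule smooth_on_compose[OF dK smooth_on_Pair[OF V.open_range smooth_on_ident[OF V.open_range] smooth_on_const[OF V.open_range]] _ V.open_range oB])
           (use Z(2) in \<open>auto simp: B_def t0_def\<close>)
      then have "smooth_fun_on \<A> V (\<lambda>x. frechet_derivative K (at (\<phi> x, t0)) (0, 1))"
        by (rule V.smooth_fun_on_coord[OF V.open_domain order_refl])
      then have "smooth_fun_on \<A> V (\<lambda>x. p x f)"
      proof (rule smooth_fun_on_cong[OF cov(1) V.open_domain])
        fix x assume x: "x \<in> V"
        have z: "(\<phi> x, t0) \<in> B" using x Z(2) by (auto simp: B_def t0_def)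
        have "((\<lambda>t. (\<phi> x, t)) has_derivative (\<lambda>t. (0, t))) (at t0)" by (auto intro!: derivative_eq_intros)
        from has_derivative_compose[OF this smooth_on_has_derivative[OF K z]]
        have "((\<lambda>t. K (\<phi> x, t)) has_derivative (\<lambda>t. frechet_derivative K (at (\<phi> x, t0)) (0, t))) (at t0)" .
        from frechet_derivative_at[OF this]
        have "frechet_derivative (\<lambda>t. K (\<phi> x, t)) (at t0) = (\<lambda>t. frechet_derivative K (at (\<phi> x, t0)) (0, t))" by simp
        moreover have "(\<lambda>t. K (\<phi> x, t)) = (\<lambda>t. (f \<circ> act x) (\<gamma> t))"
          using V.param_coord[OF x] by (simp add: K_def fun_eq_iff)
        ultimately have "frechet_derivative (\<lambda>t. (f \<circ> act x) (\<gamma> t)) (at t0) 1 = frechet_derivative K (at (\<phi> x, t0)) (0, 1)"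
          by simp
        moreover have "p x f = frechet_derivative (\<lambda>t. (f \<circ> act x) (\<gamma> t)) (at t0) 1"
          using f smooth_fun_compose[OF cov(3,1) smooth_orbit_map f, of x]
          by (simp add: p_def push_def v1_def Z.coord_vec_def \<gamma>_def t0_def)
        ultimately show "frechet_derivative K (at (\<phi> x, t0)) (0, 1) = p x f" by simp
      qed
      then show "\<exists>N. open N \<and> x0 \<in> N \<and> smooth_fun_on \<A> N (\<lambda>x. p x f)" using V.open_domain V(2) by blast
    qed
  qed
  ultimately show thesis using that by blast
qed

end

section \<open>Codimension one distributions\<close>

lemma dim_tangent_space:
  fixes \<A> :: "('m::{t2_space,second_countable_topology}, 'e::euclidean_space) chart set"
  assumes "smooth_manifold \<A>"
  shows "dim (tangent_space \<A> x) = DIM('e)"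
proof -
  obtain V \<phi> where V: "(V, \<phi>) \<in> \<A>" "x \<in> V"
    using covering_atlas_obtain[OF smooth_manifold_covering[OF assms]] .
  interpret smooth_coordinates \<A> V \<phi> "inv_into V \<phi>"
    by (rule smooth_coordinates_chart[OF assms V(1)])
  show ?thesis
    using dim_linear_image_inj[OF linear_coord_vec[OF V(2)] coord_vec_inj[OF V(2)], of UNIV]
    by (simp add: tangent_space_range[OF V(2)])
qed

lemma codim1_distribution_dim:
  fixes \<A> :: "('m::{t2_space,second_countable_topology}, 'e::euclidean_space) chart set"
  assumes "smooth_manifold \<A>" "codim1_distribution \<A> W"
  shows "subspace (W x) \<and> W x \<subseteq> tangent_space \<A> x \<and> dim (W x) = DIM('e) - 1"
proof -
  have "subspace (W x) \<and> W x \<subseteq> tangent_space \<A> x \<and> dim (W x) + 1 = dim (tangent_space \<A> x)"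
    using assms(2) by (simp add: codim1_distribution_def)
  then show ?thesis using dim_tangent_space[OF assms(1), of x] by linarith
qed

text \<open>It suffices to have finitely many smooth fields near each point that span the distribution at that
  point; a frame is obtained from them because the rank is constant.\<close>

lemma codim1_distributionI:
  fixes \<A> :: "('m::{t2_space,second_countable_topology}, 'e::euclidean_space) chart set"
  assumes A: "smooth_manifold \<A>"
    and W: "\<And>x. subspace (W x)" "\<And>x. W x \<subseteq> tangent_space \<A> x" "\<And>x. dim (W x) + 1 = dim (tangent_space \<A> x)"
    and Y: "\<And>x. \<exists>U \<Y>. open U \<and> x \<in> U \<and> finite \<Y> \<and> (\<forall>Y\<in>\<Y>. smooth_vector_field_on \<A> U Y) \<and>
      (\<forall>y\<in>U. \<forall>Y\<in>\<Y>. Y y \<in> W y) \<and> W x = span ((\<lambda>Y. Y x) ` \<Y>)"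
  shows "codim1_distribution \<A> W"
proof -
  have D: "subspace (W x) \<and> W x \<subseteq> tangent_space \<A> x \<and> dim (W x) = DIM('e) - 1" for x
    using W[of x] dim_tangent_space[OF A, of x] by simp
  have "\<exists>U X. open U \<and> x \<in> U \<and> (\<forall>i<dim (W x). smooth_vector_field_on \<A> U (X i)) \<and>
        (\<forall>y\<in>U. W y = span ((\<lambda>i. X i y) ` {..<dim (W x)}))" for x
  proof -
    obtain U \<Y> where U: "open U" "x \<in> U" and \<Y>: "finite \<Y>" "\<forall>Y\<in>\<Y>. smooth_vector_field_on \<A> U Y"
      "\<forall>y\<in>U. \<forall>Y\<in>\<Y>. Y y \<in> W y" "W x = span ((\<lambda>Y. Y x) ` \<Y>)"
      using Y[of x] by (elim exE conjE)
    obtain n :: nat and Z where "\<Y> = Z ` {i. i < n}"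
      using \<Y>(1) finite_imp_nat_seg_image_inj_on by metis
    then have Y: "open U" "x \<in> U" "\<forall>i<n. smooth_vector_field_on \<A> U (Z i)"
      "\<forall>y\<in>U. \<forall>i<n. Z i y \<in> W y" "W x = span ((\<lambda>i. Z i x) ` {..<n})"
      using U \<Y> by (auto simp: image_image lessThan_def)
    from local_frame_and_generating_family(1)[OF A D Y] show ?thesis using D[of x] by simp
  qed
  then show ?thesis using W by (simp add: codim1_distribution_def)
qed

lemma codim1_generating_family:
  assumes "smooth_manifold \<A>" "codim1_distribution \<A> W"
  shows "\<exists>O' F \<kappa>. open O' \<and> x0 \<in> O' \<and> generating_family \<A> W O' F \<kappa>"
proof -
  obtain U X where X: "open U" "x0 \<in> U" "\<forall>i<dim (W x0). smooth_vector_field_on \<A> U (X i)"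
    "\<forall>y\<in>U. W y = span ((\<lambda>i. X i y) ` {..<dim (W x0)})"
    using assms(2) unfolding codim1_distribution_def by blast
  have XW: "\<forall>y\<in>U. \<forall>i<dim (W x0). X i y \<in> W y"
    using X(4) by (auto intro: span_base)
  have W0: "W x0 = span ((\<lambda>i. X i x0) ` {..<dim (W x0)})" using X(2,4) by blast
  show ?thesis
    by (rule local_frame_and_generating_family(2)[OF assms(1) codim1_distribution_dim[OF assms] X(1-3) XW W0])
qed

lemma generating_familyD:
  assumes "generating_family \<A> D O' F \<kappa>"
  shows "b \<in> Basis \<Longrightarrow> F b \<in> vsections \<A> D" "b \<in> Basis \<Longrightarrow> smooth_fun \<A> (\<kappa> b)"
    "x \<in> O' \<Longrightarrow> d \<in> D x \<Longrightarrow> d = (\<Sum>b\<in>Basis. d (\<kappa> b) *\<^sub>R F b x)"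
proof -
  show "b \<in> Basis \<Longrightarrow> F b \<in> vsections \<A> D" "b \<in> Basis \<Longrightarrow> smooth_fun \<A> (\<kappa> b)"
    using assms unfolding generating_family_def by blast+
  have gen: "\<forall>x\<in>O'. \<forall>d\<in>D x. d = (\<Sum>b\<in>Basis. d (\<kappa> b) *\<^sub>R F b x)"
    using assms unfolding generating_family_def by (rule conjunct2)
  show "d = (\<Sum>b\<in>Basis. d (\<kappa> b) *\<^sub>R F b x)" if "x \<in> O'" "d \<in> D x"
    by (rule gen[rule_format, OF that])
qed

lemma vsectionsD: "X \<in> vsections \<A> W \<Longrightarrow> smooth_vector_field_on \<A> UNIV X" "X \<in> vsections \<A> W \<Longrightarrow> X x \<in> W x"
  by (auto simp: vsections_def)

text \<open>Evaluate the coefficients of a generating family on \<open>u\<close> and keep them constant.\<close>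

lemma section_through:
  assumes A: "smooth_manifold \<A>" and W: "codim1_distribution \<A> W" and u: "u \<in> W x0"
  shows "\<exists>X\<in>vsections \<A> W. X x0 = u"
proof -
  note cov = smooth_manifold_covering[OF A]
  obtain O' F \<kappa> where O': "x0 \<in> O'" "generating_family \<A> W O' F \<kappa>"
    using codim1_generating_family[OF A W, of x0] by (elim exE conjE)
  note F = generating_familyD(1)[OF O'(2)]
  let ?X = "\<lambda>x. \<Sum>b\<in>Basis. u (\<kappa> b) *\<^sub>R F b x"
  have X0: "?X x0 = u" by (rule generating_familyD(3)[OF O'(2,1) u, symmetric])
  have "?X \<in> vsections \<A> W"
    unfolding vsections_def mem_Collect_eq
  proof
    show "smooth_vector_field_on \<A> UNIV ?X"
      by (rule smooth_vector_field_on_sum[OF cov open_UNIV finite_Basis],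
          rule smooth_vector_field_on_scale[OF cov open_UNIV smooth_fun_on_const[OF cov open_UNIV]],
          rule vsectionsD(1)[OF F])
    have sub: "subspace (W x)" for x using codim1_distribution_dim[OF A W] by blast
    show "\<forall>x. ?X x \<in> W x"
      by (intro allI subspace_sum[OF sub] subspace_scale[OF sub] vsectionsD(2)[OF F])
  qed
  with X0 show ?thesis by (rule bexI)
qed

section \<open>Forms and conformal classes\<close>

lemma symmetric_formD:
  assumes "symmetric_form \<A> W h"
  shows "u \<in> W x \<Longrightarrow> v \<in> W x \<Longrightarrow> h x u v = h x v u"
    "u \<in> W x \<Longrightarrow> v \<in> W x \<Longrightarrow> w \<in> W x \<Longrightarrow> h x (u + v) w = h x u w + h x v w"
    "u \<in> W x \<Longrightarrow> v \<in> W x \<Longrightarrow> h x (c *\<^sub>R u) v = c * h x u v"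
    "u \<notin> W x \<or> v \<notin> W x \<Longrightarrow> h x u v = 0"
    "X \<in> vsections \<A> W \<Longrightarrow> Y \<in> vsections \<A> W \<Longrightarrow> smooth_fun \<A> (\<lambda>x. h x (X x) (Y x))"
  using assms unfolding symmetric_form_def by blast+

lemma symmetric_form_right:
  assumes "symmetric_form \<A> W h" "subspace (W x)"
  shows "u \<in> W x \<Longrightarrow> v \<in> W x \<Longrightarrow> w \<in> W x \<Longrightarrow> h x w (u + v) = h x w u + h x w v"
    "u \<in> W x \<Longrightarrow> v \<in> W x \<Longrightarrow> h x v (c *\<^sub>R u) = c * h x v u"
proof -
  note sym = symmetric_formD(1)[OF assms(1)]
  show "h x w (u + v) = h x w u + h x w v" if "u \<in> W x" "v \<in> W x" "w \<in> W x"
    using sym[OF subspace_add[OF assms(2) that(1,2)] that(3)] sym[OF that(1,3)] sym[OF that(2,3)]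
      symmetric_formD(2)[OF assms(1) that] by simp
  show "h x v (c *\<^sub>R u) = c * h x v u" if "u \<in> W x" "v \<in> W x"
    using sym[OF subspace_scale[OF assms(2) that(1)] that(2)] sym[OF that]
      symmetric_formD(3)[OF assms(1) that] by simp
qed

lemma symmetric_form_sum:
  assumes h: "symmetric_form \<A> W h" and W: "subspace (W x)" and I: "finite I"
    "\<And>i. i \<in> I \<Longrightarrow> u i \<in> W x" and v: "v \<in> W x"
  shows "h x (\<Sum>i\<in>I. c i *\<^sub>R u i) v = (\<Sum>i\<in>I. c i * h x (u i) v)"
  using I
proof (induction I rule: finite_induct)
  case empty
  then show ?case using symmetric_formD(3)[OF h v v, of 0] by (simp add: zero_fun_def)
next
  case (insert i I)
  have "(\<Sum>i\<in>I. c i *\<^sub>R u i) \<in> W x" by (intro subspace_sum[OF W] subspace_scale[OF W]) (use insert in auto)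
  then have "h x (c i *\<^sub>R u i + (\<Sum>i\<in>I. c i *\<^sub>R u i)) v = c i * h x (u i) v + (\<Sum>i\<in>I. c i * h x (u i) v)"
    using insert symmetric_formD(2)[OF h _ _ v, of "c i *\<^sub>R u i"] symmetric_formD(3)[OF h _ v] subspace_scale[OF W] by simp
  then show ?case by (simp only: sum.insert[OF insert.hyps])
qed

lemma symmetric_form_sum2:
  assumes h: "symmetric_form \<A> W h" and W: "subspace (W x)" and I: "finite I"
    "\<And>i. i \<in> I \<Longrightarrow> u i \<in> W x"
  shows "h x (\<Sum>i\<in>I. c i *\<^sub>R u i) (\<Sum>j\<in>I. d j *\<^sub>R u j) = (\<Sum>i\<in>I. \<Sum>j\<in>I. c i * d j * h x (u i) (u j))"
proof -
  have s: "(\<Sum>j\<in>I. e j *\<^sub>R u j) \<in> W x" for e by (intro subspace_sum[OF W] subspace_scale[OF W] I)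
  have "h x (\<Sum>i\<in>I. c i *\<^sub>R u i) (\<Sum>j\<in>I. d j *\<^sub>R u j) = (\<Sum>i\<in>I. c i * h x (u i) (\<Sum>j\<in>I. d j *\<^sub>R u j))"
    by (rule symmetric_form_sum[OF h W I s])
  also have "\<dots> = (\<Sum>i\<in>I. c i * (\<Sum>j\<in>I. d j * h x (u i) (u j)))"
  proof (intro sum.cong refl)
    fix i assume i: "i \<in> I"
    have "h x (u i) (\<Sum>j\<in>I. d j *\<^sub>R u j) = h x (\<Sum>j\<in>I. d j *\<^sub>R u j) (u i)"
      by (rule symmetric_formD(1)[OF h I(2)[OF i] s])
    also have "\<dots> = (\<Sum>j\<in>I. d j * h x (u j) (u i))" by (rule symmetric_form_sum[OF h W I I(2)[OF i]])
    also have "\<dots> = (\<Sum>j\<in>I. d j * h x (u i) (u j))"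
      by (intro sum.cong refl arg_cong2[where f = "(*)"] symmetric_formD(1)[OF h] I(2) i)
    finally show "c i * h x (u i) (\<Sum>j\<in>I. d j *\<^sub>R u j) = c i * (\<Sum>j\<in>I. d j * h x (u i) (u j))" by simp
  qed
  finally show ?thesis by (simp add: sum_distrib_left mult.assoc)
qed

lemma symmetric_form_scale:
  assumes "covering_atlas \<A>" "symmetric_form \<A> W h" "smooth_fun \<A> \<phi>"
  shows "symmetric_form \<A> W (\<lambda>x u v. \<phi> x * h x u v)"
proof -
  note D = symmetric_formD[OF assms(2)]
  show ?thesis
    unfolding symmetric_form_def
  proof (intro conjI allI ballI impI)
    show "smooth_fun \<A> (\<lambda>x. \<phi> x * h x (X x) (Y x))" if "X \<in> vsections \<A> W" "Y \<in> vsections \<A> W" for X Y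
      by (rule smooth_fun_on_mult[OF assms(1) open_UNIV assms(3) D(5)[OF that]])
  qed (use D in \<open>auto simp: algebra_simps\<close>)
qed

lemma conformal_class_refl:
  assumes "covering_atlas \<A>"
  shows "h \<in> conformal_class \<A> h"
  unfolding conformal_class_def using smooth_fun_on_const[OF assms open_UNIV, of 1]
  by (auto intro!: exI[of _ "\<lambda>x. 1"])

lemma conformal_classE:
  assumes "h' \<in> conformal_class \<A> h"
  obtains \<phi> where "smooth_fun \<A> \<phi>" "\<forall>x. \<phi> x > 0" "h' = (\<lambda>x u v. \<phi> x * h x u v)"
  using assms by (auto simp: conformal_class_def)

lemma conformal_classI:
  "smooth_fun \<A> \<phi> \<Longrightarrow> \<forall>x. \<phi> x > 0 \<Longrightarrow> h' = (\<lambda>x u v. \<phi> x * h x u v) \<Longrightarrow> h' \<in> conformal_class \<A> h"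
  by (auto simp: conformal_class_def)

lemma conformal_class_sym:
  assumes "covering_atlas \<A>" "h' \<in> conformal_class \<A> h"
  shows "h \<in> conformal_class \<A> h'"
proof -
  obtain \<phi> where \<phi>: "smooth_fun \<A> \<phi>" "\<forall>x. \<phi> x > 0" "h' = (\<lambda>x u v. \<phi> x * h x u v)"
    using assms(2) by (rule conformal_classE)
  have nz: "\<phi> x \<noteq> 0" for x using \<phi>(2) by (metis less_irrefl)
  have "smooth_fun \<A> (\<lambda>x. 1 / \<phi> x)"
    by (rule smooth_fun_on_divide[OF assms(1) open_UNIV smooth_fun_on_const[OF assms(1) open_UNIV] \<phi>(1) nz])
  then show ?thesis
    by (rule conformal_classI) (use \<phi>(2,3) nz in \<open>auto simp: fun_eq_iff\<close>)
qed

lemma conformal_class_trans: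
  assumes "covering_atlas \<A>" "h' \<in> conformal_class \<A> h" "h'' \<in> conformal_class \<A> h'"
  shows "h'' \<in> conformal_class \<A> h"
proof -
  obtain \<phi> where \<phi>: "smooth_fun \<A> \<phi>" "\<forall>x. \<phi> x > 0" "h' = (\<lambda>x u v. \<phi> x * h x u v)"
    using assms(2) by (rule conformal_classE)
  obtain \<psi> where \<psi>: "smooth_fun \<A> \<psi>" "\<forall>x. \<psi> x > 0" "h'' = (\<lambda>x u v. \<psi> x * h' x u v)"
    using assms(3) by (rule conformal_classE)
  show ?thesis
    by (rule conformal_classI[OF smooth_fun_on_mult[OF assms(1) open_UNIV \<psi>(1) \<phi>(1)]])
       (use \<phi> \<psi> in \<open>auto simp: fun_eq_iff mult.assoc\<close>)
qed

lemma conformal_class_eq: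
  assumes "covering_atlas \<A>" "h' \<in> conformal_class \<A> h"
  shows "conformal_class \<A> h' = conformal_class \<A> h"
  using conformal_class_trans[OF assms(1)] conformal_class_sym[OF assms] assms(2) by blast

lemma positive_definite_conformal:
  assumes "covering_atlas \<A>" "positive_definite_metric \<A> W g" "g' \<in> conformal_class \<A> g"
  shows "positive_definite_metric \<A> W g'"
proof -
  obtain \<phi> where \<phi>: "smooth_fun \<A> \<phi>" "\<forall>x. \<phi> x > 0" "g' = (\<lambda>x u v. \<phi> x * g x u v)"
    using assms(3) by (rule conformal_classE)
  show ?thesis
    using assms(2) \<phi>(2) symmetric_form_scale[OF assms(1) _ \<phi>(1)]
    by (auto simp: positive_definite_metric_def \<phi>(3))
qed

text \<open>The factor at \<open>x\<close> is \<open>h' x (X x) (X x) / h x (X x) (X x)\<close> for every section \<open>X\<close> with nonzero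
  denominator, which makes it smooth. If \<open>h\<close> vanishes identically, the factor \<open>1\<close> will do.\<close>

lemma pointwise_proportional_conformal:
  assumes A: "smooth_manifold \<A>" and W: "codim1_distribution \<A> W"
    and h: "symmetric_form \<A> W h" and h': "symmetric_form \<A> W h'"
    and proportional: "\<And>x. \<exists>c>0. \<forall>u v. h' x u v = c * h x u v"
    and nz: "(\<forall>x. \<exists>u\<in>W x. h x u u \<noteq> 0) \<or> (\<forall>x u v. h x u v = 0)"
  shows "h' \<in> conformal_class \<A> h"
proof -
  note cov = smooth_manifold_covering[OF A]
  have "\<forall>x. \<exists>c. c > 0 \<and> (\<forall>u v. h' x u v = c * h x u v)" using proportional by blast
  from choice[OF this] obtain c where c: "\<And>x. c x > 0" "\<And>x u v. h' x u v = c x * h x u v" by blast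
  from nz show ?thesis
  proof
    assume nz: "\<forall>x. \<exists>u\<in>W x. h x u u \<noteq> 0"
    have "smooth_fun \<A> c"
    proof (rule smooth_fun_on_local[OF cov])
      fix x
      obtain u where u: "u \<in> W x" "h x u u \<noteq> 0" using nz by blast
      obtain X where X: "X \<in> vsections \<A> W" "X x = u" using section_through[OF A W u(1)] by blast
      let ?q = "\<lambda>x. h x (X x) (X x)" and ?q' = "\<lambda>x. h' x (X x) (X x)"
      have q: "smooth_fun \<A> ?q" "smooth_fun \<A> ?q'" using symmetric_formD(5)[OF h X(1) X(1)] symmetric_formD(5)[OF h' X(1) X(1)] by auto
      define N where "N = ?q -` (- {0})"
      have N: "open N" unfolding N_def using open_vimage[OF _ smooth_fun_on_continuous[OF q(1)], of "- {0}"] by auto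
      have "smooth_fun_on \<A> N (\<lambda>x. ?q' x / ?q x)"
        by (rule smooth_fun_on_divide[OF cov N smooth_fun_on_subset[OF q(2)] smooth_fun_on_subset[OF q(1)]]) (auto simp: N_def)
      then have "smooth_fun_on \<A> N c"
        by (rule smooth_fun_on_cong[OF cov N]) (auto simp: N_def c(2))
      then show "\<exists>N. open N \<and> x \<in> N \<and> smooth_fun_on \<A> N c" using N X(2) u(2) by (intro exI[of _ N]) (auto simp: N_def)
    qed
    then show ?thesis by (rule conformal_classI) (auto intro!: ext simp: c)
  next
    assume "\<forall>x u v. h x u v = 0"
    then have "h' = h" using c(2) by (simp add: fun_eq_iff)
    then show ?thesis using conformal_class_refl[OF cov] by simp
  qed
qed

text \<open>The second case occurs on one-dimensional manifolds, where a distribution of codimension one is zero.\<close>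

lemma positive_definite_nondegenerate:
  fixes \<A> :: "('m::{t2_space,second_countable_topology}, 'e::euclidean_space) chart set"
  assumes A: "smooth_manifold \<A>" and W: "codim1_distribution \<A> W" and g: "positive_definite_metric \<A> W g"
  shows "(\<forall>x. \<exists>u\<in>W x. g x u u \<noteq> 0) \<or> (\<forall>x u v. g x u v = 0)"
proof (cases "DIM('e) = 1")
  case True
  have "W x \<subseteq> {0}" for x
  proof -
    obtain U X where "x \<in> U" "\<forall>y\<in>U. W y = span ((\<lambda>i. (X :: nat \<Rightarrow> _) i y) ` {..<dim (W x)})"
      using W unfolding codim1_distribution_def by blast
    then show ?thesis using codim1_distribution_dim[OF A W, of x] True by auto
  qed
  moreover have sf: "symmetric_form \<A> W g" using g by (simp add: positive_definite_metric_def)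
  ultimately have "g x u v = 0" for x u v
    using symmetric_formD(3,4)[OF sf, of u x v] symmetric_formD(3)[OF sf, of u x v 0] by (cases "u \<in> W x \<and> v \<in> W x") auto
  then show ?thesis by simp
next
  case False
  have "\<exists>u\<in>W x. g x u u \<noteq> 0" for x
  proof -
    have "dim (W x) \<noteq> 0" using codim1_distribution_dim[OF A W, of x] False DIM_positive[where 'a = 'e] by linarith
    moreover have "dim (W x) = 0" if "W x \<subseteq> {0}"
      using real_vector.dim_le_card[of "W x" "{}"] that by simp
    ultimately have "\<not> W x \<subseteq> {0}" by linarith
    then obtain u where "u \<in> W x" "u \<noteq> 0" by (metis singletonI subsetI)
    then show ?thesis using g unfolding positive_definite_metric_def by (metis less_irrefl)
  qed
  then show ?thesis by blast
qed

section \<open>Brackets of vector fields\<close>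

text \<open>In \<open>X (Y (f g)) - Y (X (f g))\<close> the mixed terms \<open>X f * Y g\<close> and \<open>X g * Y f\<close> cancel.\<close>

lemma smooth_vector_field_bracket:
  assumes c: "covering_atlas \<A>" and X: "smooth_vector_field_on \<A> UNIV X" and Y: "smooth_vector_field_on \<A> UNIV Y"
  shows "smooth_vector_field_on \<A> UNIV (bracket X Y)"
proof (rule smooth_vector_field_onI)
  note XT = smooth_vector_field_onD(1)[OF X UNIV_I] and YT = smooth_vector_field_onD(1)[OF Y UNIV_I]
  note Xs = smooth_vector_field_onD(2)[OF X] and Ys = smooth_vector_field_onD(2)[OF Y]
  note m = smooth_fun_on_mult[OF c open_UNIV] and a = smooth_fun_on_add[OF c open_UNIV]
  have snd_order_add: "Z x (\<lambda>y. Z' y (\<lambda>z. f z + g z)) = Z x (\<lambda>y. Z' y f) + Z x (\<lambda>y. Z' y g)"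
    and snd_order_cmult: "Z x (\<lambda>y. Z' y (\<lambda>z. k * f z)) = k * Z x (\<lambda>y. Z' y f)"
    and snd_order_mult: "Z x (\<lambda>y. Z' y (\<lambda>z. f z * g z)) =
      f x * Z x (\<lambda>y. Z' y g) + Z' x g * Z x f + (g x * Z x (\<lambda>y. Z' y f) + Z' x f * Z x g)"
    if Z: "smooth_vector_field_on \<A> UNIV Z" "smooth_vector_field_on \<A> UNIV Z'"
      and f: "smooth_fun \<A> f" and g: "smooth_fun \<A> g" for Z Z' f g x k
  proof -
    note ZT = smooth_vector_field_onD(1)[OF Z(1) UNIV_I] and Z'T = smooth_vector_field_onD(1)[OF Z(2) UNIV_I]
    note Z's = smooth_vector_field_onD(2)[OF Z(2)]
    show "Z x (\<lambda>y. Z' y (\<lambda>z. f z + g z)) = Z x (\<lambda>y. Z' y f) + Z x (\<lambda>y. Z' y g)"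
      using tangent_space_add[OF Z'T f g] tangent_space_add[OF ZT Z's[OF f] Z's[OF g]] by simp
    show "Z x (\<lambda>y. Z' y (\<lambda>z. k * f z)) = k * Z x (\<lambda>y. Z' y f)"
      using tangent_space_cmult[OF Z'T f] tangent_space_cmult[OF ZT Z's[OF f]] by simp
    show "Z x (\<lambda>y. Z' y (\<lambda>z. f z * g z)) =
      f x * Z x (\<lambda>y. Z' y g) + Z' x g * Z x f + (g x * Z x (\<lambda>y. Z' y f) + Z' x f * Z x g)"
      using tangent_space_mult[OF Z'T f g] tangent_space_add[OF ZT m[OF f Z's[OF g]] m[OF g Z's[OF f]]]
        tangent_space_mult[OF ZT f Z's[OF g]] tangent_space_mult[OF ZT g Z's[OF f]] by simp
  qed
  show "bracket X Y x \<in> tangent_space \<A> x" for x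
    unfolding tangent_space_def mem_Collect_eq
  proof (intro conjI allI impI)
    fix f g assume f: "smooth_fun \<A> f" and g: "smooth_fun \<A> g"
    show "bracket X Y x (\<lambda>y. f y + g y) = bracket X Y x f + bracket X Y x g"
      by (simp add: bracket_def snd_order_add[OF X Y f g] snd_order_add[OF Y X f g])
    show "bracket X Y x (\<lambda>y. f y * g y) = f x * bracket X Y x g + g x * bracket X Y x f"
      by (simp add: bracket_def snd_order_mult[OF X Y f g] snd_order_mult[OF Y X f g] algebra_simps)
  next
    fix k f assume f: "smooth_fun \<A> f"
    show "bracket X Y x (\<lambda>y. k * f y) = k * bracket X Y x f"
      by (simp add: bracket_def snd_order_cmult[OF X Y f f] snd_order_cmult[OF Y X f f] algebra_simps)
  next
    fix f assume f: "\<not> smooth_fun \<A> f"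
    then show "bracket X Y x f = 0"
      using tangent_space_not_smooth[OF XT f] tangent_space_not_smooth[OF YT f]
        tangent_space_const[OF c XT] tangent_space_const[OF c YT] by (simp add: bracket_def)
  qed
  show "smooth_fun \<A> (\<lambda>x. bracket X Y x f)" if f: "smooth_fun \<A> f" for f
    unfolding bracket_def by (intro smooth_fun_on_diff[OF c open_UNIV] Xs Ys f)
qed

section \<open>From the base to the total space\<close>

context principal_line_bundle
begin

abbreviation pull :: "('s \<Rightarrow> 's tvec set) \<Rightarrow> 'm \<Rightarrow> 'm tvec set" where
  "pull D \<equiv> pull_distribution \<A> \<S> \<pi> D"

abbreviation pull_form :: "('s \<Rightarrow> 's tvec set) \<Rightarrow> 's form \<Rightarrow> 'm form" where
  "pull_form D g \<equiv> pullback_form \<S> \<pi> (pull D) g"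

lemma in_pull_iff: "v \<in> pull D x \<longleftrightarrow> v \<in> tangent_space \<A> x \<and> push \<S> \<pi> v \<in> D (\<pi> x)"
  by (simp add: pull_distribution_def)

lemma in_vertical_iff: "v \<in> vertical_space \<A> \<S> \<pi> x \<longleftrightarrow> v \<in> tangent_space \<A> x \<and> push \<S> \<pi> v = 0"
  by (simp add: vertical_space_def)

lemma subspace_push_preimage: "subspace B \<Longrightarrow> subspace {v \<in> tangent_space \<A> x. push \<S> \<pi> v \<in> B}"
  using subspace_inter[OF subspace_tangent_space linear_subspace_vimage[OF linear_push], of B \<A> x \<S> \<pi>]
  by (simp add: vimage_def Int_def)

lemma subspace_vertical: "subspace (vertical_space \<A> \<S> \<pi> x)"
  using subspace_push_preimage[of "{0}" x] by (simp add: vertical_space_def subspace_single_0)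

lemma dim_vertical: "dim (vertical_space \<A> \<S> \<pi> x) = 1"
proof -
  have "dim {0 :: 's tvec} = 0" using real_vector.dim_le_card[of "{0 :: 's tvec}" "{}"] by simp
  then show ?thesis
    using dim_push_preimage[of "{0}" x] zero_in_tangent_space[of \<S> "\<pi> x"]
    by (simp add: vertical_space_def subspace_single_0)
qed

lemma dim_tangent_total: "dim (tangent_space \<A> x) = dim (tangent_space \<S> (\<pi> x)) + 1"
proof -
  have "{v \<in> tangent_space \<A> x. push \<S> \<pi> v \<in> tangent_space \<S> (\<pi> x)} = tangent_space \<A> x"
    using push_proj_in_tangent_space by auto
  then show ?thesis using dim_push_preimage[OF subspace_tangent_space order_refl, of x] by simp
qed

text \<open>Lifts of sections of \<open>D\<close> belong to the preimage of \<open>D\<close> also where the cut-off factor is not \<open>1\<close>.\<close>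

lemma pull_lift:
  assumes sub: "\<And>s. subspace (D s)" and E: "E \<in> vsections \<S> D"
  shows "\<exists>X\<in>vsections \<A> (pull D). \<exists>O'. open O' \<and> x0 \<in> O' \<and> (\<forall>x\<in>O'. push \<S> \<pi> (X x) = E (\<pi> x))"
proof -
  obtain X c O' where X: "smooth_vector_field_on \<A> UNIV X" "open O'" "x0 \<in> O'" "\<forall>x\<in>O'. c x = (1::real)"
      "\<forall>x. push \<S> \<pi> (X x) = c x *\<^sub>R E (\<pi> x)"
    using lift_vector_field[OF vsectionsD(1)[OF E], of x0] by (elim exE conjE)
  have "X x \<in> pull D x" for x
    using smooth_vector_field_onD(1)[OF X(1)] subspace_scale[OF sub vsectionsD(2)[OF E]] X(5)
    by (simp add: in_pull_iff)
  then have "X \<in> vsections \<A> (pull D)" using X(1) by (simp add: vsections_def)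
  moreover have "\<forall>x\<in>O'. push \<S> \<pi> (X x) = E (\<pi> x)" using X(4,5) by simp
  ultimately show ?thesis using X(2,3) by blast
qed

text \<open>The preimage of \<open>D\<close> is spanned at \<open>x\<close> by lifts of a generating family of \<open>D\<close> and by a vertical field.\<close>

lemma pull_codim1:
  assumes D: "codim1_distribution \<S> D"
  shows "codim1_distribution \<A> (pull D)"
proof (rule codim1_distributionI[OF manifolds(1)])
  have D': "subspace (D s)" "D s \<subseteq> tangent_space \<S> s" "dim (D s) + 1 = dim (tangent_space \<S> s)" for s
    using D by (simp_all add: codim1_distribution_def)
  have pull_eq: "pull D x = {v \<in> tangent_space \<A> x. push \<S> \<pi> v \<in> D (\<pi> x)}" for x
    by (simp add: pull_distribution_def)
  show sub: "subspace (pull D x)" for x unfolding pull_eq by (rule subspace_push_preimage[OF D'(1)])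
  show "pull D x \<subseteq> tangent_space \<A> x" for x by (auto simp: in_pull_iff)
  show "dim (pull D x) + 1 = dim (tangent_space \<A> x)" for x
    unfolding pull_eq dim_push_preimage[OF D'(1,2)] dim_tangent_total D'(3) by simp
  fix x
  obtain p where p: "smooth_vector_field_on \<A> UNIV p" "\<forall>x. p x \<in> vertical_space \<A> \<S> \<pi> x" "\<forall>x. p x \<noteq> 0"
    by (rule vertical_vector_field)
  obtain O' F \<kappa> where O': "\<pi> x \<in> O'" "generating_family \<S> D O' F \<kappa>"
    using codim1_generating_family[OF manifolds(2) D, of "\<pi> x"] by (elim exE conjE)
  have "\<forall>b\<in>Basis. \<exists>X. X \<in> vsections \<A> (pull D) \<and> push \<S> \<pi> (X x) = F b (\<pi> x)"
    using pull_lift[OF D'(1) generating_familyD(1)[OF O'(2)], of _ x] by blast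
  from bchoice[OF this] obtain X where X: "\<forall>b\<in>Basis. X b \<in> vsections \<A> (pull D) \<and> push \<S> \<pi> (X b x) = F b (\<pi> x)" ..
  define \<Y> where "\<Y> = insert p (X ` Basis)"
  have YW: "\<forall>y\<in>UNIV. \<forall>Y\<in>\<Y>. Y y \<in> pull D y"
  proof (intro ballI)
    fix y Y assume "Y \<in> \<Y>"
    then consider "Y = p" | b where "b \<in> Basis" "Y = X b" by (auto simp: \<Y>_def)
    then show "Y y \<in> pull D y"
    proof cases
      case 1
      then show ?thesis using p(2) subspace_0[OF D'(1)] by (auto simp: in_vertical_iff in_pull_iff)
    next
      case 2
      show ?thesis unfolding 2(2) by (rule vsectionsD(2)) (use X 2(1) in blast)
    qed
  qed
  have "pull D x \<subseteq> span ((\<lambda>Y. Y x) ` \<Y>)"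
  proof
    fix v assume v: "v \<in> pull D x"
    define d where "d = push \<S> \<pi> v"
    define u where "u = (\<Sum>b\<in>Basis. d (\<kappa> b) *\<^sub>R X b x)"
    have "d \<in> D (\<pi> x)" using v by (simp add: d_def in_pull_iff)
    then have "d = (\<Sum>b\<in>Basis. d (\<kappa> b) *\<^sub>R F b (\<pi> x))" by (rule generating_familyD(3)[OF O'(2,1)])
    also have "\<dots> = (\<Sum>b\<in>Basis. d (\<kappa> b) *\<^sub>R push \<S> \<pi> (X b x))" using X by (intro sum.cong) auto
    also have "\<dots> = push \<S> \<pi> u"
      unfolding u_def by (simp only: linear_sum[OF linear_push] linear_scale[OF linear_push])
    finally have pu: "push \<S> \<pi> v = push \<S> \<pi> u" by (simp only: d_def)
    have uW: "u \<in> pull D x" unfolding u_def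
      by (intro subspace_sum[OF sub] subspace_scale[OF sub]) (use YW in \<open>auto simp: \<Y>_def\<close>)
    have "v - u \<in> vertical_space \<A> \<S> \<pi> x"
      using pu subspace_diff[OF sub v uW] by (simp add: in_vertical_iff in_pull_iff linear_diff[OF linear_push])
    then have "v - u \<in> span {p x}"
      using dim_1_span[OF subspace_vertical dim_vertical] p(2,3) by blast
    then have "v - u \<in> span ((\<lambda>Y. Y x) ` \<Y>)"
      using span_mono[of "{p x}" "(\<lambda>Y. Y x) ` \<Y>"] by (auto simp: \<Y>_def)
    moreover have "u \<in> span ((\<lambda>Y. Y x) ` \<Y>)"
      unfolding u_def by (intro span_sum span_scale span_base) (auto simp: \<Y>_def)
    ultimately have "(v - u) + u \<in> span ((\<lambda>Y. Y x) ` \<Y>)" by (rule span_add)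
    then show "v \<in> span ((\<lambda>Y. Y x) ` \<Y>)" by (simp only: diff_add_cancel)
  qed
  moreover have "span ((\<lambda>Y. Y x) ` \<Y>) \<subseteq> pull D x"
    by (rule span_minimal[OF _ sub]) (use YW in blast)
  ultimately have sp: "pull D x = span ((\<lambda>Y. Y x) ` \<Y>)" by (rule subset_antisym)
  have "\<forall>Y\<in>\<Y>. smooth_vector_field_on \<A> UNIV Y"
    using p(1) X by (auto simp: \<Y>_def intro: vsectionsD(1))
  then show "\<exists>U \<Y>. open U \<and> x \<in> U \<and> finite \<Y> \<and> (\<forall>Y\<in>\<Y>. smooth_vector_field_on \<A> U Y) \<and>
      (\<forall>y\<in>U. \<forall>Y\<in>\<Y>. Y y \<in> pull D y) \<and> pull D x = span ((\<lambda>Y. Y x) ` \<Y>)"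
    using YW sp by (intro exI[of _ UNIV] exI[of _ \<Y>] conjI) (auto simp: \<Y>_def)
qed

lemma push_pull_section:
  assumes F: "generating_family \<S> D O' F \<kappa>" and x: "\<pi> x \<in> O'" and v: "v \<in> pull D x"
  shows "push \<S> \<pi> v = (\<Sum>b\<in>Basis. v (\<kappa> b \<circ> \<pi>) *\<^sub>R F b (\<pi> x))"
proof -
  have "push \<S> \<pi> v \<in> D (\<pi> x)" using v by (simp add: in_pull_iff)
  then have "push \<S> \<pi> v = (\<Sum>b\<in>Basis. push \<S> \<pi> v (\<kappa> b) *\<^sub>R F b (\<pi> x))"
    by (rule generating_familyD(3)[OF F x])
  also have "\<dots> = (\<Sum>b\<in>Basis. v (\<kappa> b \<circ> \<pi>) *\<^sub>R F b (\<pi> x))"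
    using generating_familyD(2)[OF F] by (intro sum.cong refl) (simp add: push_def)
  finally show ?thesis .
qed

lemma pull_form_apply: "u \<in> pull D x \<Longrightarrow> v \<in> pull D x \<Longrightarrow> pull_form D g x u v = g (\<pi> x) (push \<S> \<pi> u) (push \<S> \<pi> v)"
  by (simp add: pullback_form_def)

lemma smooth_fun_proj: "smooth_fun \<S> f \<Longrightarrow> smooth_fun \<A> (f \<circ> \<pi>)"
  by (rule smooth_fun_compose[OF cov(1,2) smooth_proj])

lemma pull_form_local:
  assumes D: "codim1_distribution \<S> D" and g: "symmetric_form \<S> D g"
    and F: "generating_family \<S> D O' F \<kappa>" and x: "\<pi> x \<in> O'" and uv: "u \<in> pull D x" "v \<in> pull D x"
  shows "pull_form D g x u v = (\<Sum>b\<in>Basis. \<Sum>c\<in>Basis. u (\<kappa> b \<circ> \<pi>) * v (\<kappa> c \<circ> \<pi>) * g (\<pi> x) (F b (\<pi> x)) (F c (\<pi> x)))"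
  unfolding pull_form_apply[OF uv] push_pull_section[OF F x uv(1)] push_pull_section[OF F x uv(2)]
proof (rule symmetric_form_sum2[OF g _ finite_Basis])
  show "subspace (D (\<pi> x))" using codim1_distribution_dim[OF manifolds(2) D] by blast
  show "F b (\<pi> x) \<in> D (\<pi> x)" if "b \<in> Basis" for b using generating_familyD(1)[OF F that] by (rule vsectionsD(2))
qed

text \<open>The pulled back form is smooth by \<open>pull_form_local\<close>: the coefficients of a section of the preimage of
  \<open>D\<close> are smooth on \<open>M\<close>, and the values of \<open>g\<close> on the generating family are smooth on \<open>S\<close>.\<close>

lemma pull_form_symmetric:
  assumes D: "codim1_distribution \<S> D" and g: "symmetric_form \<S> D g"
  shows "symmetric_form \<A> (pull D) (pull_form D g)"
  unfolding symmetric_form_def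
proof (intro conjI allI ballI impI)
  have sub: "subspace (pull D x)" for x
    using codim1_distribution_dim[OF manifolds(1) pull_codim1[OF D]] by blast
  note g' = symmetric_formD[OF g]
  fix x u v
  show "pull_form D g x u v = 0" if "u \<notin> pull D x \<or> v \<notin> pull D x" using that by (auto simp: pullback_form_def)
  assume u: "u \<in> pull D x" and v: "v \<in> pull D x"
  then have uv: "push \<S> \<pi> u \<in> D (\<pi> x)" "push \<S> \<pi> v \<in> D (\<pi> x)" by (simp_all add: in_pull_iff)
  show "pull_form D g x u v = pull_form D g x v u"
    using g'(1)[OF uv] by (simp add: pull_form_apply u v)
  show "pull_form D g x (u + v) w = pull_form D g x u w + pull_form D g x v w" if w: "w \<in> pull D x" for w
  proof -
    have "push \<S> \<pi> w \<in> D (\<pi> x)" using w by (simp add: in_pull_iff)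
    from g'(2)[OF uv this] show ?thesis
      unfolding pull_form_apply[OF u w] pull_form_apply[OF v w] pull_form_apply[OF subspace_add[OF sub u v] w]
        linear_add[OF linear_push] .
  qed
  show "pull_form D g x (c *\<^sub>R u) v = c * pull_form D g x u v" for c
    using g'(3)[OF uv] unfolding pull_form_apply[OF u v] pull_form_apply[OF subspace_scale[OF sub u] v]
      linear_scale[OF linear_push] .
next
  fix X Y assume X: "X \<in> vsections \<A> (pull D)" and Y: "Y \<in> vsections \<A> (pull D)"
  show "smooth_fun \<A> (\<lambda>x. pull_form D g x (X x) (Y x))"
  proof (rule smooth_fun_on_local[OF cov(1)])
    fix x0
    obtain O' F \<kappa> where O': "open O'" "\<pi> x0 \<in> O'" and F: "generating_family \<S> D O' F \<kappa>"
      using codim1_generating_family[OF manifolds(2) D, of "\<pi> x0"] by (elim exE conjE)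
    note N = open_proj_vimage[OF O'(1)]
    have a: "smooth_fun \<A> (\<lambda>x. Z x (\<kappa> b \<circ> \<pi>))" if "Z \<in> vsections \<A> (pull D)" "b \<in> Basis" for Z b
      by (rule smooth_vector_field_onD(2)[OF vsectionsD(1)[OF that(1)] smooth_fun_proj[OF generating_familyD(2)[OF F that(2)]]])
    have gs: "smooth_fun \<A> (\<lambda>x. g (\<pi> x) (F b (\<pi> x)) (F c (\<pi> x)))" if "b \<in> Basis" "c \<in> Basis" for b c
      using smooth_fun_proj[OF symmetric_formD(5)[OF g generating_familyD(1)[OF F that(1)] generating_familyD(1)[OF F that(2)]]]
      by (simp add: o_def)
    have "smooth_fun \<A> (\<lambda>x. \<Sum>b\<in>Basis. \<Sum>c\<in>Basis. X x (\<kappa> b \<circ> \<pi>) * Y x (\<kappa> c \<circ> \<pi>) * g (\<pi> x) (F b (\<pi> x)) (F c (\<pi> x)))"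
      by (intro smooth_fun_on_sum[OF cov(1) open_UNIV] finite_Basis smooth_fun_on_mult[OF cov(1) open_UNIV] a[OF X] a[OF Y] gs)
    then have "smooth_fun_on \<A> (\<pi> -` O') (\<lambda>x. pull_form D g x (X x) (Y x))"
      by (intro smooth_fun_on_cong[OF cov(1) N smooth_fun_on_subset])
         (auto simp: pull_form_local[OF D g F _ vsectionsD(2)[OF X] vsectionsD(2)[OF Y]])
    then show "\<exists>N. open N \<and> x0 \<in> N \<and> smooth_fun_on \<A> N (\<lambda>x. pull_form D g x (X x) (Y x))"
      using N O'(2) by blast
  qed
qed

lemma conformal_pull_form:
  assumes "h \<in> conformal_class \<A> (pull_form D g)"
  obtains \<phi> where "smooth_fun \<A> \<phi>" "\<forall>x. \<phi> x > 0"
    "\<forall>x u v. h x u v = (if u \<in> pull D x \<and> v \<in> pull D x then \<phi> x * g (\<pi> x) (push \<S> \<pi> u) (push \<S> \<pi> v) else 0)"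
proof -
  obtain \<phi> where \<phi>: "smooth_fun \<A> \<phi>" "\<forall>x. \<phi> x > 0" "h = (\<lambda>x u v. \<phi> x * pull_form D g x u v)"
    using assms by (rule conformal_classE)
  show thesis by (rule that[OF \<phi>(1,2)]) (simp add: \<phi>(3) pullback_form_def)
qed

text \<open>Positive definiteness of \<open>g\<close> turns \<open>h u u = 0\<close> into \<open>\<pi>\<^sub>* u = 0\<close>.\<close>

lemma pull_form_kernel:
  assumes D: "codim1_distribution \<S> D" and g: "positive_definite_metric \<S> D g"
    and h: "h \<in> conformal_class \<A> (pull_form D g)"
  shows "form_kernel (pull D) h x = vertical_space \<A> \<S> \<pi> x"
proof -
  obtain \<phi> where \<phi>: "\<forall>x. \<phi> x > 0"
    "\<forall>x u v. h x u v = (if u \<in> pull D x \<and> v \<in> pull D x then \<phi> x * g (\<pi> x) (push \<S> \<pi> u) (push \<S> \<pi> v) else 0)"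
    using h by (rule conformal_pull_form)
  have sf: "symmetric_form \<S> D g" and pos: "\<And>s u. u \<in> D s \<Longrightarrow> u \<noteq> 0 \<Longrightarrow> g s u u > 0"
    using g by (auto simp: positive_definite_metric_def)
  have D0: "0 \<in> D s" for s using codim1_distribution_dim[OF manifolds(2) D] subspace_0 by blast
  have \<phi>nz: "\<phi> x \<noteq> 0" for x using \<phi>(1) by (metis less_irrefl)
  have g0: "g s 0 v = 0" if "v \<in> D s" for s v using symmetric_formD(3)[OF sf D0 that, of 0] by simp
  show ?thesis
  proof (rule subset_antisym; rule subsetI)
    fix u assume "u \<in> form_kernel (pull D) h x"
    then have u: "u \<in> pull D x" "h x u u = 0" by (auto simp: form_kernel_def)
    then have "g (\<pi> x) (push \<S> \<pi> u) (push \<S> \<pi> u) = 0" using \<phi>(2) \<phi>nz by simp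
    then have "push \<S> \<pi> u = 0" using pos[of "push \<S> \<pi> u" "\<pi> x"] u(1) by (auto simp: in_pull_iff)
    then show "u \<in> vertical_space \<A> \<S> \<pi> x" using u(1) by (simp add: in_vertical_iff in_pull_iff)
  next
    fix u assume "u \<in> vertical_space \<A> \<S> \<pi> x"
    then have u: "u \<in> tangent_space \<A> x" "push \<S> \<pi> u = 0" by (simp_all add: in_vertical_iff)
    then have "u \<in> pull D x" using D0 by (simp add: in_pull_iff)
    then show "u \<in> form_kernel (pull D) h x"
      using \<phi>(2) u(2) g0 by (auto simp: form_kernel_def in_pull_iff)
  qed
qed

lemma pull_form_semipositive:
  assumes D: "codim1_distribution \<S> D" and g: "positive_definite_metric \<S> D g"
  shows "semipositive_metric \<A> (pull D) (pull_form D g)"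
  unfolding semipositive_metric_def
proof (intro conjI allI ballI)
  have sf: "symmetric_form \<S> D g" and pos: "\<And>s u. u \<in> D s \<Longrightarrow> u \<noteq> 0 \<Longrightarrow> g s u u > 0"
    using g by (auto simp: positive_definite_metric_def)
  show "symmetric_form \<A> (pull D) (pull_form D g)" by (rule pull_form_symmetric[OF D sf])
  show "dim (form_kernel (pull D) (pull_form D g) x) = 1" for x
    unfolding pull_form_kernel[OF D g conformal_class_refl[OF cov(1)]] by (rule dim_vertical)
  show "0 \<le> pull_form D g x u u" if u: "u \<in> pull D x" for x u
  proof (cases "push \<S> \<pi> u = 0")
    case True
    then have "0 \<in> D (\<pi> x)" using u by (simp add: in_pull_iff)
    then show ?thesis using True symmetric_formD(3)[OF sf, of 0 "\<pi> x" 0 0] by (simp add: pull_form_apply u)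
  next
    case False
    then show ?thesis using pos[of "push \<S> \<pi> u" "\<pi> x"] u by (simp add: pull_form_apply in_pull_iff)
  qed
qed

lemma push_pull_distribution:
  assumes "\<And>s. D s \<subseteq> tangent_space \<S> s"
  shows "push_distribution \<S> \<pi> (pull D) = D"
proof (rule ext, rule subset_antisym; rule subsetI)
  fix s d assume "d \<in> D s"
  obtain x where x: "\<pi> x = s" using proj_surj by blast
  obtain v where "v \<in> tangent_space \<A> x" "push \<S> \<pi> v = d"
    using push_proj_surj[of d x] assms \<open>d \<in> D s\<close> x by blast
  then show "d \<in> push_distribution \<S> \<pi> (pull D) s"
    using x \<open>d \<in> D s\<close> unfolding push_distribution_def by (auto simp: in_pull_iff)
qed (auto simp: push_distribution_def in_pull_iff)

text \<open>As \<pi> is onto on points and on tangent vectors, proportionality of the pullbacks at any point of a fibre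
  gives proportionality of the metrics at its image. The factor on \<open>S\<close> is smooth by
  \<open>pointwise_proportional_conformal\<close>.\<close>

lemma pull_form_conformal_iff:
  assumes D: "codim1_distribution \<S> D" and g: "positive_definite_metric \<S> D g"
  shows "positive_definite_metric \<S> D g' \<and> pull_form D g' \<in> conformal_class \<A> (pull_form D g) \<longleftrightarrow>
    g' \<in> conformal_class \<S> g"
proof
  assume "g' \<in> conformal_class \<S> g"
  moreover from this obtain \<phi> where \<phi>: "smooth_fun \<S> \<phi>" "\<forall>x. \<phi> x > 0" "g' = (\<lambda>x u v. \<phi> x * g x u v)"
    by (rule conformal_classE)
  have "pull_form D g' \<in> conformal_class \<A> (pull_form D g)"
    by (rule conformal_classI[OF smooth_fun_proj[OF \<phi>(1)]]) (use \<phi>(2,3) in \<open>auto simp: pullback_form_def fun_eq_iff\<close>)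
  ultimately show "positive_definite_metric \<S> D g' \<and> pull_form D g' \<in> conformal_class \<A> (pull_form D g)"
    using positive_definite_conformal[OF cov(2) g] by blast
next
  assume a: "positive_definite_metric \<S> D g' \<and> pull_form D g' \<in> conformal_class \<A> (pull_form D g)"
  then have g': "positive_definite_metric \<S> D g'" by blast
  from a have "pull_form D g' \<in> conformal_class \<A> (pull_form D g)" by blast
  then obtain \<phi> where \<phi>: "\<forall>x. \<phi> x > 0"
    "\<forall>x u v. pull_form D g' x u v = (if u \<in> pull D x \<and> v \<in> pull D x then \<phi> x * g (\<pi> x) (push \<S> \<pi> u) (push \<S> \<pi> v) else 0)"
    by (rule conformal_pull_form)
  have sf: "symmetric_form \<S> D g" "symmetric_form \<S> D g'"
    using g g' by (auto simp: positive_definite_metric_def)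
  have DT: "D s \<subseteq> tangent_space \<S> s" for s using codim1_distribution_dim[OF manifolds(2) D] by blast
  show "g' \<in> conformal_class \<S> g"
  proof (rule pointwise_proportional_conformal[OF manifolds(2) D sf])
    fix s
    obtain x where x: "\<pi> x = s" using proj_surj by blast
    have "g' s u v = \<phi> x * g s u v" for u v
    proof (cases "u \<in> D s \<and> v \<in> D s")
      case True
      obtain u' v' where "u' \<in> tangent_space \<A> x" "push \<S> \<pi> u' = u" "v' \<in> tangent_space \<A> x" "push \<S> \<pi> v' = v"
        using push_proj_surj[of u x] push_proj_surj[of v x] True DT x by blast
      moreover from this have "u' \<in> pull D x" "v' \<in> pull D x" using True x by (auto simp: in_pull_iff)
      ultimately show ?thesis using \<phi>(2)[rule_format, of x u' v'] pull_form_apply[of u' D x v' g'] x by simp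
    next
      case False
      then show ?thesis using symmetric_formD(4)[OF sf(1), of u s v] symmetric_formD(4)[OF sf(2), of u s v] by auto
    qed
    then show "\<exists>c>0. \<forall>u v. g' s u v = c * g s u v" using \<phi>(1) by blast
  qed (rule positive_definite_nondegenerate[OF manifolds(2) D g])
qed

text \<open>Members of \<open>[g]\<close> have conformal pullbacks, so the union that defines the pullback of \<open>[g]\<close> consists of a
  single class.\<close>

lemma rt_pullback_conformal:
  "rt_pullback \<A> \<S> \<pi> (D, conformal_class \<S> g) = (pull D, conformal_class \<A> (pull_form D g))"
proof -
  have "conformal_class \<A> (pull_form D g') = conformal_class \<A> (pull_form D g)" if g': "g' \<in> conformal_class \<S> g" for g'
  proof (rule conformal_class_eq[OF cov(1)])
    obtain \<phi> where \<phi>: "smooth_fun \<S> \<phi>" "\<forall>x. \<phi> x > 0" "g' = (\<lambda>x u v. \<phi> x * g x u v)"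
      using g' by (rule conformal_classE)
    show "pull_form D g' \<in> conformal_class \<A> (pull_form D g)"
      by (rule conformal_classI[OF smooth_fun_proj[OF \<phi>(1)]]) (use \<phi>(2,3) in \<open>auto simp: pullback_form_def fun_eq_iff\<close>)
  qed
  then have "(\<Union>g'\<in>conformal_class \<S> g. conformal_class \<A> (pull_form D g')) = conformal_class \<A> (pull_form D g)"
    using conformal_class_refl[OF cov(2)] by blast
  then show ?thesis by (simp add: rt_pullback_def)
qed

lemma rt_projection_pullback:
  assumes D: "codim1_distribution \<S> D" and g: "positive_definite_metric \<S> D g"
  shows "rt_projection \<S> \<pi> (rt_pullback \<A> \<S> \<pi> (D, conformal_class \<S> g)) = (D, conformal_class \<S> g)"
proof -
  have "push_distribution \<S> \<pi> (pull D) = D"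
    by (rule push_pull_distribution) (use codim1_distribution_dim[OF manifolds(2) D] in blast)
  then show ?thesis
    using pull_form_conformal_iff[OF D g] by (simp add: rt_pullback_conformal rt_projection_def)
qed

section \<open>Lie derivatives along the fibres\<close>

text \<open>Apply the bracket to \<open>f \<circ> \<pi>\<close>. The term \<open>X (p (f \<circ> \<pi>))\<close> is zero, and in \<open>p (X (f \<circ> \<pi>))\<close>, after expanding
  \<open>X (f \<circ> \<pi>)\<close> in the generating family, \<open>p\<close> only differentiates the coefficients of \<open>X\<close>, since the
  functions \<open>(F b f) \<circ> \<pi>\<close> are constant along the fibres.\<close>

lemma push_bracket_vertical:
  assumes D: "codim1_distribution \<S> D" and X: "X \<in> vsections \<A> (pull D)"
    and p: "smooth_vector_field_on \<A> UNIV p" "\<forall>x. p x \<in> vertical_space \<A> \<S> \<pi> x"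
    and F: "generating_family \<S> D O' F \<kappa>" "open O'" "\<pi> x \<in> O'"
  shows "push \<S> \<pi> (bracket p X x) = (\<Sum>b\<in>Basis. p x (\<lambda>y. X y (\<kappa> b \<circ> \<pi>)) *\<^sub>R F b (\<pi> x))"
proof (rule ext)
  fix f
  note Xv = vsectionsD(1)[OF X]
  note XT = smooth_vector_field_onD(1)[OF Xv UNIV_I] and pT = smooth_vector_field_onD(1)[OF p(1) UNIV_I]
  have FT: "F b s \<in> tangent_space \<S> s" if "b \<in> Basis" for b s
    using smooth_vector_field_onD(1)[OF vsectionsD(1)[OF generating_familyD(1)[OF F(1) that]]] by simp
  have sum_apply: "(\<Sum>b\<in>Basis. c b *\<^sub>R F b s) f = (\<Sum>b\<in>Basis. c b * F b s f)" for c s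
  proof -
    have "finite (B :: 'f set) \<Longrightarrow> (\<Sum>b\<in>B. c b *\<^sub>R F b s) f = (\<Sum>b\<in>B. c b * F b s f)" for B
      by (induction B rule: finite_induct) (auto simp: zero_fun_def plus_fun_def scaleR_fun_def)
    then show ?thesis by simp
  qed
  show "push \<S> \<pi> (bracket p X x) f = (\<Sum>b\<in>Basis. p x (\<lambda>y. X y (\<kappa> b \<circ> \<pi>)) *\<^sub>R F b (\<pi> x)) f"
  proof (cases "smooth_fun \<S> f")
    case f: True
    have p0: "p y (f \<circ> \<pi>) = 0" for y
    proof -
      have "push \<S> \<pi> (p y) f = 0" using p(2) by (simp add: in_vertical_iff)
      then show ?thesis using f by (simp add: push_def)
    qed
    have as: "smooth_fun \<A> (\<lambda>y. X y (\<kappa> b \<circ> \<pi>))" if "b \<in> Basis" for b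
      by (rule smooth_vector_field_onD(2)[OF Xv smooth_fun_proj[OF generating_familyD(2)[OF F(1) that]]])
    have Fs: "smooth_fun \<S> (\<lambda>s. F b s f)" if "b \<in> Basis" for b
      by (rule smooth_vector_field_onD(2)[OF vsectionsD(1)[OF generating_familyD(1)[OF F(1) that]] f])
    then have Fs': "smooth_fun \<A> (\<lambda>y. F b (\<pi> y) f)" if "b \<in> Basis" for b
      using smooth_fun_proj[OF Fs[OF that]] that by (simp add: o_def)
    have pF: "p x (\<lambda>y. F b (\<pi> y) f) = 0" if "b \<in> Basis" for b
    proof -
      have "push \<S> \<pi> (p x) (\<lambda>s. F b s f) = 0" using p(2) by (simp add: in_vertical_iff)
      then show ?thesis using Fs[OF that] by (simp add: push_def o_def)
    qed
    note m = smooth_fun_on_mult[OF cov(1) open_UNIV]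
    have "push \<S> \<pi> (bracket p X x) f = p x (\<lambda>y. X y (f \<circ> \<pi>))"
      using f tangent_space_const[OF cov(1) XT] by (simp add: push_def bracket_def p0)
    also have "\<dots> = p x (\<lambda>y. \<Sum>b\<in>Basis. X y (\<kappa> b \<circ> \<pi>) * F b (\<pi> y) f)"
    proof (rule tangent_space_local[OF manifolds(1) pT])
      show "smooth_fun \<A> (\<lambda>y. X y (f \<circ> \<pi>))" by (rule smooth_vector_field_onD(2)[OF Xv smooth_fun_proj[OF f]])
      show "smooth_fun \<A> (\<lambda>y. \<Sum>b\<in>Basis. X y (\<kappa> b \<circ> \<pi>) * F b (\<pi> y) f)"
        by (intro smooth_fun_on_sum[OF cov(1) open_UNIV] finite_Basis m as Fs')
      show "open (\<pi> -` O')" "x \<in> \<pi> -` O'" using open_proj_vimage F(2,3) by auto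
      fix y assume "y \<in> \<pi> -` O'"
      then have "push \<S> \<pi> (X y) f = (\<Sum>b\<in>Basis. X y (\<kappa> b \<circ> \<pi>) * F b (\<pi> y) f)"
        using push_pull_section[OF F(1) _ vsectionsD(2)[OF X], of y] sum_apply by simp
      then show "X y (f \<circ> \<pi>) = (\<Sum>b\<in>Basis. X y (\<kappa> b \<circ> \<pi>) * F b (\<pi> y) f)" using f by (simp add: push_def)
    qed
    also have "\<dots> = (\<Sum>b\<in>Basis. p x (\<lambda>y. X y (\<kappa> b \<circ> \<pi>) * F b (\<pi> y) f))"
      by (rule tangent_space_sum[OF cov(1) pT finite_Basis]) (intro m as Fs')
    also have "\<dots> = (\<Sum>b\<in>Basis. p x (\<lambda>y. X y (\<kappa> b \<circ> \<pi>)) * F b (\<pi> x) f)"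
      using tangent_space_mult[OF pT as Fs'] pF by (intro sum.cong refl) simp
    finally show ?thesis by (simp add: sum_apply)
  next
    case False
    then show ?thesis using tangent_space_not_smooth[OF FT False] by (simp add: push_def sum_apply)
  qed
qed

lemma bracket_vertical_section:
  assumes D: "codim1_distribution \<S> D" and X: "X \<in> vsections \<A> (pull D)"
    and p: "smooth_vector_field_on \<A> UNIV p" "\<forall>x. p x \<in> vertical_space \<A> \<S> \<pi> x"
  shows "bracket p X \<in> vsections \<A> (pull D)"
  unfolding vsections_def mem_Collect_eq
proof
  show b: "smooth_vector_field_on \<A> UNIV (bracket p X)"
    by (rule smooth_vector_field_bracket[OF cov(1) p(1) vsectionsD(1)[OF X]])
  show "\<forall>x. bracket p X x \<in> pull D x"
  proof
    fix x
    obtain O' F \<kappa> where O': "open O'" "\<pi> x \<in> O'" and F: "generating_family \<S> D O' F \<kappa>"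
      using codim1_generating_family[OF manifolds(2) D, of "\<pi> x"] by (elim exE conjE)
    have sub: "subspace (D (\<pi> x))" using codim1_distribution_dim[OF manifolds(2) D] by blast
    have "push \<S> \<pi> (bracket p X x) \<in> D (\<pi> x)"
      unfolding push_bracket_vertical[OF D X p F O']
      by (intro subspace_sum[OF sub] subspace_scale[OF sub] vsectionsD(2)[OF generating_familyD(1)[OF F]])
    then show "bracket p X x \<in> pull D x" using smooth_vector_field_onD(1)[OF b] by (simp add: in_pull_iff)
  qed
qed

text \<open>In the expansion of \<open>\<pi>\<^sup>* g (X, Y)\<close> with coefficients \<alpha> of \<open>X\<close> and \<beta> of \<open>Y\<close>, \<open>p\<close> annihilates the values
  of \<open>g\<close> on the generating family. By \<open>push_bracket_vertical\<close> the brackets \<open>[p, X]\<close> and \<open>[p, Y]\<close> have the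
  coefficients \<open>p \<alpha>\<close> and \<open>p \<beta>\<close>, so they account for exactly the two terms of the Leibniz rule.\<close>

lemma lie_derivative_pull_form:
  assumes D: "codim1_distribution \<S> D" and g: "symmetric_form \<S> D g"
    and X: "X \<in> vsections \<A> (pull D)" and Y: "Y \<in> vsections \<A> (pull D)"
    and p: "smooth_vector_field_on \<A> UNIV p" "\<forall>x. p x \<in> vertical_space \<A> \<S> \<pi> x"
  shows "lie_derivative_form p (pull_form D g) X Y x = 0"
proof -
  obtain O' F \<kappa> where O': "open O'" "\<pi> x \<in> O'" and F: "generating_family \<S> D O' F \<kappa>"
    using codim1_generating_family[OF manifolds(2) D, of "\<pi> x"] by (elim exE conjE)
  note pT = smooth_vector_field_onD(1)[OF p(1) UNIV_I]
  note m = smooth_fun_on_mult[OF cov(1) open_UNIV]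
  define G where "G b c y = g (\<pi> y) (F b (\<pi> y)) (F c (\<pi> y))" for b c y
  define \<alpha> where "\<alpha> b y = X y (\<kappa> b \<circ> \<pi>)" for b y
  define \<beta> where "\<beta> b y = Y y (\<kappa> b \<circ> \<pi>)" for b y
  have s: "smooth_fun \<A> (\<alpha> b)" "smooth_fun \<A> (\<beta> b)" if "b \<in> Basis" for b
    unfolding \<alpha>_def \<beta>_def
    using smooth_vector_field_onD(2)[OF vsectionsD(1)[OF X] smooth_fun_proj[OF generating_familyD(2)[OF F that]]]
      smooth_vector_field_onD(2)[OF vsectionsD(1)[OF Y] smooth_fun_proj[OF generating_familyD(2)[OF F that]]] by auto
  have gs: "smooth_fun \<S> (\<lambda>s. g s (F b s) (F c s))" if "b \<in> Basis" "c \<in> Basis" for b c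
    by (rule symmetric_formD(5)[OF g generating_familyD(1)[OF F that(1)] generating_familyD(1)[OF F that(2)]])
  have Gs: "smooth_fun \<A> (G b c)" if "b \<in> Basis" "c \<in> Basis" for b c
    using smooth_fun_proj[OF gs[OF that]] by (simp add: G_def[abs_def] o_def)
  have pG: "p x (G b c) = 0" if "b \<in> Basis" "c \<in> Basis" for b c
  proof -
    have "push \<S> \<pi> (p x) (\<lambda>s. g s (F b s) (F c s)) = 0" using p(2) by (simp add: in_vertical_iff)
    then show ?thesis using gs[OF that] by (simp add: push_def o_def G_def[abs_def])
  qed
  have sub: "subspace (D (\<pi> x))" using codim1_distribution_dim[OF manifolds(2) D] by blast
  note FD = vsectionsD(2)[OF generating_familyD(1)[OF F]]
  note bX = bracket_vertical_section[OF D X p] and bY = bracket_vertical_section[OF D Y p]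
  have XY: "pull_form D g y (X y) (Y y) = (\<Sum>b\<in>Basis. \<Sum>c\<in>Basis. \<alpha> b y * \<beta> c y * G b c y)" if "\<pi> y \<in> O'" for y
    unfolding \<alpha>_def \<beta>_def G_def by (rule pull_form_local[OF D g F that vsectionsD(2)[OF X] vsectionsD(2)[OF Y]])
  have "p x (\<lambda>y. pull_form D g y (X y) (Y y)) = p x (\<lambda>y. \<Sum>b\<in>Basis. \<Sum>c\<in>Basis. \<alpha> b y * \<beta> c y * G b c y)"
  proof (rule tangent_space_local[OF manifolds(1) pT])
    show "smooth_fun \<A> (\<lambda>y. pull_form D g y (X y) (Y y))" by (rule symmetric_formD(5)[OF pull_form_symmetric[OF D g] X Y])
    show "smooth_fun \<A> (\<lambda>y. \<Sum>b\<in>Basis. \<Sum>c\<in>Basis. \<alpha> b y * \<beta> c y * G b c y)"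
      by (intro smooth_fun_on_sum[OF cov(1) open_UNIV] finite_Basis m s Gs)
    show "open (\<pi> -` O')" "x \<in> \<pi> -` O'" using open_proj_vimage O' by auto
  qed (use XY in auto)
  also have "\<dots> = (\<Sum>b\<in>Basis. p x (\<lambda>y. \<Sum>c\<in>Basis. \<alpha> b y * \<beta> c y * G b c y))"
    by (rule tangent_space_sum[OF cov(1) pT finite_Basis])
       (intro smooth_fun_on_sum[OF cov(1) open_UNIV] finite_Basis m s Gs)
  also have "\<dots> = (\<Sum>b\<in>Basis. \<Sum>c\<in>Basis. p x (\<lambda>y. \<alpha> b y * \<beta> c y * G b c y))"
    by (intro sum.cong refl tangent_space_sum[OF cov(1) pT finite_Basis] m s Gs)
  also have "\<dots> = (\<Sum>b\<in>Basis. \<Sum>c\<in>Basis. p x (\<alpha> b) * \<beta> c x * G b c x + \<alpha> b x * p x (\<beta> c) * G b c x)"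
  proof (intro sum.cong refl)
    fix b c :: 'f assume bc: "b \<in> Basis" "c \<in> Basis"
    show "p x (\<lambda>y. \<alpha> b y * \<beta> c y * G b c y) = p x (\<alpha> b) * \<beta> c x * G b c x + \<alpha> b x * p x (\<beta> c) * G b c x"
      using tangent_space_mult[OF pT m[OF s(1)[OF bc(1)] s(2)[OF bc(2)]] Gs[OF bc]]
        tangent_space_mult[OF pT s(1)[OF bc(1)] s(2)[OF bc(2)]] pG[OF bc] by (simp add: algebra_simps)
  qed
  also have "\<dots> = (\<Sum>b\<in>Basis. \<Sum>c\<in>Basis. p x (\<alpha> b) * \<beta> c x * G b c x) + (\<Sum>b\<in>Basis. \<Sum>c\<in>Basis. \<alpha> b x * p x (\<beta> c) * G b c x)"
    by (simp add: sum.distrib)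
  also have "(\<Sum>b\<in>Basis. \<Sum>c\<in>Basis. p x (\<alpha> b) * \<beta> c x * G b c x) = pull_form D g x (bracket p X x) (Y x)"
    unfolding pull_form_apply[OF vsectionsD(2)[OF bX] vsectionsD(2)[OF Y]] push_bracket_vertical[OF D X p F O']
      push_pull_section[OF F O'(2) vsectionsD(2)[OF Y]] \<alpha>_def \<beta>_def G_def
    by (rule symmetric_form_sum2[OF g sub finite_Basis FD, symmetric])
  also have "(\<Sum>b\<in>Basis. \<Sum>c\<in>Basis. \<alpha> b x * p x (\<beta> c) * G b c x) = pull_form D g x (X x) (bracket p Y x)"
    unfolding pull_form_apply[OF vsectionsD(2)[OF X] vsectionsD(2)[OF bY]] push_bracket_vertical[OF D Y p F O']
      push_pull_section[OF F O'(2) vsectionsD(2)[OF X]] \<alpha>_def \<beta>_def G_def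
    by (rule symmetric_form_sum2[OF g sub finite_Basis FD, symmetric])
  finally show ?thesis by (simp add: lie_derivative_form_def)
qed

text \<open>By \<open>lie_derivative_pull_form\<close>, \<open>L\<^sub>p h = (p \<phi> / \<phi>) h\<close> for \<open>h = \<phi> \<pi>\<^sup>* g\<close>.\<close>

lemma shearfree_pullback:
  assumes D: "codim1_distribution \<S> D" and g: "positive_definite_metric \<S> D g"
  shows "shearfree_structure \<A> (pull D, conformal_class \<A> (pull_form D g))"
proof -
  obtain p where p: "smooth_vector_field_on \<A> UNIV p" "\<forall>x. p x \<in> vertical_space \<A> \<S> \<pi> x" "\<forall>x. p x \<noteq> 0"
    by (rule vertical_vector_field)
  have sf: "symmetric_form \<S> D g" using g by (simp add: positive_definite_metric_def)
  note pT = smooth_vector_field_onD(1)[OF p(1) UNIV_I]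
  have "\<exists>f. smooth_fun \<A> f \<and> (\<forall>X\<in>vsections \<A> (pull D). \<forall>Y\<in>vsections \<A> (pull D). \<forall>x.
              lie_derivative_form p h X Y x = f x * h x (X x) (Y x))"
    if h: "h \<in> conformal_class \<A> (pull_form D g)" for h
  proof -
    obtain \<phi> where \<phi>: "smooth_fun \<A> \<phi>" "\<forall>x. \<phi> x > 0" "h = (\<lambda>x u v. \<phi> x * pull_form D g x u v)"
      using h by (rule conformal_classE)
    have nz: "\<phi> x \<noteq> 0" for x using \<phi>(2) by (metis less_irrefl)
    have "lie_derivative_form p h X Y x = (p x \<phi> / \<phi> x) * h x (X x) (Y x)"
      if X: "X \<in> vsections \<A> (pull D)" and Y: "Y \<in> vsections \<A> (pull D)" for X Y x
    proof -
      let ?q = "\<lambda>y. pull_form D g y (X y) (Y y)"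
      have q: "smooth_fun \<A> ?q" by (rule symmetric_formD(5)[OF pull_form_symmetric[OF D sf] X Y])
      have "p x (\<lambda>y. \<phi> y * ?q y) = \<phi> x * p x ?q + ?q x * p x \<phi>" by (rule tangent_space_mult[OF pT \<phi>(1) q])
      moreover have "p x ?q = pull_form D g x (bracket p X x) (Y x) + pull_form D g x (X x) (bracket p Y x)"
        using lie_derivative_pull_form[OF D sf X Y p(1,2), of x] by (simp add: lie_derivative_form_def)
      ultimately have "lie_derivative_form p h X Y x = ?q x * p x \<phi>"
        by (simp add: lie_derivative_form_def \<phi>(3) algebra_simps)
      then show ?thesis using nz[of x] by (simp add: \<phi>(3))
    qed
    moreover have "smooth_fun \<A> (\<lambda>x. p x \<phi> / \<phi> x)"
      by (rule smooth_fun_on_divide[OF cov(1) open_UNIV smooth_vector_field_onD(2)[OF p(1) \<phi>(1)] \<phi>(1) nz])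
    ultimately show ?thesis by (intro exI[of _ "\<lambda>x. p x \<phi> / \<phi> x"]) simp
  qed
  moreover have "\<forall>h\<in>conformal_class \<A> (pull_form D g). \<forall>x. p x \<in> form_kernel (pull D) h x"
    using p(2) pull_form_kernel[OF D g] by simp
  moreover have "\<forall>X\<in>vsections \<A> (pull D). bracket p X \<in> vsections \<A> (pull D)"
    using bracket_vertical_section[OF D _ p(1,2)] by blast
  ultimately show ?thesis
    unfolding shearfree_structure_def prod.case
    by (intro conjI exI[of _ "pull_form D g"] exI[of _ p] pull_codim1[OF D] pull_form_semipositive[OF D g] p(1,3) refl)
       auto
qed

lemma push_right_translation_pull:
  "push \<A> (\<lambda>y. act y a) ` pull D x = pull D (act x a)"
proof (rule subset_antisym; rule subsetI)
  fix v assume "v \<in> push \<A> (\<lambda>y. act y a) ` pull D x"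
  then show "v \<in> pull D (act x a)"
    using push_right_translation by (auto simp: in_pull_iff proj_act)
next
  fix v assume v: "v \<in> pull D (act x a)"
  then have vT: "v \<in> tangent_space \<A> (act x a)" by (simp add: in_pull_iff)
  let ?w = "push \<A> (\<lambda>y. act y (inv\<^bsub>G\<^esub> a)) v"
  have "?w \<in> pull D x"
    using push_right_translation_inverse(2)[OF vT] push_right_translation(2)[OF vT, of "inv\<^bsub>G\<^esub> a"] v
    by (simp add: in_pull_iff proj_act)
  then show "v \<in> push \<A> (\<lambda>y. act y a) ` pull D x"
    using push_right_translation_inverse(1)[OF vT] by (metis image_eqI)
qed

lemma right_translation_pull_form:
  "pullback_form \<A> (\<lambda>y. act y a) (pull D) (\<lambda>x u v. \<phi> x * pull_form D g x u v) = (\<lambda>x u v. \<phi> (act x a) * pull_form D g x u v)"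
proof (intro ext)
  fix x u v
  show "pullback_form \<A> (\<lambda>y. act y a) (pull D) (\<lambda>x u v. \<phi> x * pull_form D g x u v) x u v = \<phi> (act x a) * pull_form D g x u v"
  proof (cases "u \<in> pull D x \<and> v \<in> pull D x")
    case True
    then have "push \<A> (\<lambda>y. act y a) u \<in> pull D (act x a)" "push \<A> (\<lambda>y. act y a) v \<in> pull D (act x a)"
      using push_right_translation_pull[of a D x] by blast+
    moreover have "u \<in> tangent_space \<A> x" "v \<in> tangent_space \<A> x" using True by (auto simp: in_pull_iff)
    ultimately show ?thesis
      using True push_right_translation(2) by (simp add: pullback_form_def proj_act)
  qed (auto simp: pullback_form_def)
qed

lemma invariant_pullback:
  "invariant_structure \<A> act (pull D, conformal_class \<A> (pull_form D g))"
  unfolding invariant_structure_def prod.case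
proof (intro allI conjI)
  fix a
  show "push \<A> (\<lambda>y. act y a) ` pull D x = pull D (act x a)" for x by (rule push_right_translation_pull)
  have act_smooth: "smooth_fun \<A> (\<lambda>x. \<phi> (act x b))" if "smooth_fun \<A> \<phi>" for \<phi> b
    using smooth_fun_compose[OF cov(1,1) smooth_right_translation that] by (simp add: o_def)
  show "pullback_form \<A> (\<lambda>y. act y a) (pull D) ` conformal_class \<A> (pull_form D g) = conformal_class \<A> (pull_form D g)"
  proof (rule subset_antisym; rule subsetI)
    fix h assume "h \<in> pullback_form \<A> (\<lambda>y. act y a) (pull D) ` conformal_class \<A> (pull_form D g)"
    then obtain h' where h': "h' \<in> conformal_class \<A> (pull_form D g)" "h = pullback_form \<A> (\<lambda>y. act y a) (pull D) h'" by blast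
    obtain \<phi> where \<phi>: "smooth_fun \<A> \<phi>" "\<forall>x. \<phi> x > 0" "h' = (\<lambda>x u v. \<phi> x * pull_form D g x u v)"
      using h'(1) by (rule conformal_classE)
    show "h \<in> conformal_class \<A> (pull_form D g)"
      by (rule conformal_classI[OF act_smooth[OF \<phi>(1)]]) (use \<phi>(2) in \<open>simp_all add: h'(2) \<phi>(3) right_translation_pull_form\<close>)
  next
    fix h assume "h \<in> conformal_class \<A> (pull_form D g)"
    then obtain \<phi> where \<phi>: "smooth_fun \<A> \<phi>" "\<forall>x. \<phi> x > 0" "h = (\<lambda>x u v. \<phi> x * pull_form D g x u v)"
      by (rule conformal_classE)
    have "act (act x a) (inv\<^bsub>G\<^esub> a) = x" for x using group group.r_inv[of G a] by (simp add: act_mult act_one)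
    then have "h = pullback_form \<A> (\<lambda>y. act y a) (pull D) (\<lambda>x u v. \<phi> (act x (inv\<^bsub>G\<^esub> a)) * pull_form D g x u v)"
      by (simp add: \<phi>(3) right_translation_pull_form)
    moreover have "(\<lambda>x u v. \<phi> (act x (inv\<^bsub>G\<^esub> a)) * pull_form D g x u v) \<in> conformal_class \<A> (pull_form D g)"
      by (rule conformal_classI[OF act_smooth[OF \<phi>(1)]]) (use \<phi>(2) in simp_all)
    ultimately show "h \<in> pullback_form \<A> (\<lambda>y. act y a) (pull D) ` conformal_class \<A> (pull_form D g)" by (rule image_eqI)
  qed
qed

lemma rt_structure_pullback:
  assumes D: "codim1_distribution \<S> D" and g: "positive_definite_metric \<S> D g"
  shows "rt_structure \<A> \<S> \<pi> act (rt_pullback \<A> \<S> \<pi> (D, conformal_class \<S> g))"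
  using shearfree_pullback[OF D g] invariant_pullback[of D g] pull_form_kernel[OF D g]
  by (simp add: rt_pullback_conformal rt_structure_def)

end

section \<open>Partitions of unity for convex cones of forms\<close>

lemma smooth_fun_on_prod:
  assumes "covering_atlas \<A>" "open U" "finite I" "\<And>i. i \<in> I \<Longrightarrow> smooth_fun_on \<A> U (f i)"
  shows "smooth_fun_on \<A> U (\<lambda>x. \<Prod>i\<in>I. f i x)"
  using assms(3,4)
  by (induction I rule: finite_induct)
     (auto simp: smooth_fun_on_const[OF assms(1,2)] smooth_fun_on_mult[OF assms(1,2)])

text \<open>A partition of unity, combined with convexity of \<open>Q s\<close>. For bumps \<open>\<beta> n\<close>, equal to \<open>1\<close> on open sets that
  cover \<open>S\<close>, the functions \<open>\<rho> n = \<beta> n * (\<Prod>j<n. 1 - \<beta> j)\<close> are locally finite without any further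
  choice, since \<open>\<rho> n = 0\<close> where an earlier bump is \<open>1\<close>. They serve as weights without normalisation,
  as \<open>Q s\<close> is a cone.\<close>

lemma glue_cone_sections:
  fixes \<S> :: "('s::{t2_space,second_countable_topology}, 'f::euclidean_space) chart set"
    and Q :: "'s \<Rightarrow> ('s tvec \<Rightarrow> 's tvec \<Rightarrow> real) \<Rightarrow> bool"
  assumes S: "smooth_manifold \<S>"
    and Q_add: "\<And>s q q'. Q s q \<Longrightarrow> Q s q' \<Longrightarrow> Q s (\<lambda>u v. q u v + q' u v)"
    and Q_scale: "\<And>s q c. Q s q \<Longrightarrow> c > 0 \<Longrightarrow> Q s (\<lambda>u v. c * q u v)"
    and loc: "\<And>s0. \<exists>U q. open U \<and> s0 \<in> U \<and> (\<forall>s\<in>U. Q s (q s)) \<and>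
      (\<forall>E\<in>vsections \<S> D. \<forall>F\<in>vsections \<S> D. smooth_fun_on \<S> U (\<lambda>s. q s (E s) (F s)))"
  shows "\<exists>g. (\<forall>s. Q s (g s)) \<and> (\<forall>E\<in>vsections \<S> D. \<forall>F\<in>vsections \<S> D. smooth_fun \<S> (\<lambda>s. g s (E s) (F s)))"
proof -
  note cov = smooth_manifold_covering[OF S]
  define good where "good s0 B \<beta> q U K \<longleftrightarrow> open B \<and> s0 \<in> B \<and> smooth_fun \<S> \<beta> \<and> (\<forall>s. 0 \<le> \<beta> s) \<and> (\<forall>s. \<beta> s \<le> 1) \<and>
     (\<forall>s\<in>B. \<beta> s = 1) \<and> closed K \<and> K \<subseteq> U \<and> (\<forall>s. s \<notin> K \<longrightarrow> \<beta> s = 0) \<and> open U \<and> (\<forall>s\<in>U. Q s (q s)) \<and>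
      (\<forall>E\<in>vsections \<S> D. \<forall>F\<in>vsections \<S> D. smooth_fun_on \<S> U (\<lambda>s. q s (E s) (F s)))"
    for s0 :: 's and B \<beta> q U K
  have "\<exists>B \<beta> q U K. good s0 B \<beta> q U K" for s0
  proof -
    obtain U q where U: "open U" "s0 \<in> U" and q: "\<forall>s\<in>U. Q s (q s)"
      "\<forall>E\<in>vsections \<S> D. \<forall>F\<in>vsections \<S> D. smooth_fun_on \<S> U (\<lambda>s. q s (E s) (F s))"
      using loc[of s0] by (elim exE conjE)
    obtain \<beta> B K where b: "smooth_fun \<S> \<beta>" "open B" "s0 \<in> B" "B \<subseteq> K" "closed K" "K \<subseteq> U" and
      b': "\<And>y. 0 \<le> \<beta> y" "\<And>y. \<beta> y \<le> 1" "\<And>y. y \<in> B \<Longrightarrow> \<beta> y = 1" "\<And>y. y \<notin> K \<Longrightarrow> \<beta> y = 0"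
      by (rule smooth_bump_exists[OF S U]) blast
    have "good s0 B \<beta> q U K" unfolding good_def using U q b b' by (intro conjI) auto
    then show ?thesis by blast
  qed
  then have "\<forall>s0. \<exists>B \<beta> q U K. good s0 B \<beta> q U K" by blast
  from choice[OF this] obtain B where "\<forall>s0. \<exists>\<beta> q U K. good s0 (B s0) \<beta> q U K" ..
  from choice[OF this] obtain \<beta> where "\<forall>s0. \<exists>q U K. good s0 (B s0) (\<beta> s0) q U K" ..
  from choice[OF this] obtain q where "\<forall>s0. \<exists>U K. good s0 (B s0) (\<beta> s0) (q s0) U K" ..
  from choice[OF this] obtain U where "\<forall>s0. \<exists>K. good s0 (B s0) (\<beta> s0) (q s0) (U s0) K" ..
  from choice[OF this] obtain K where "\<forall>s0. good s0 (B s0) (\<beta> s0) (q s0) (U s0) (K s0)" ..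
  then have G: "open (B a)" "a \<in> B a" "smooth_fun \<S> (\<beta> a)" "0 \<le> \<beta> a s" "\<beta> a s \<le> 1" "s \<in> B a \<Longrightarrow> \<beta> a s = 1"
    "closed (K a)" "K a \<subseteq> U a" "s \<notin> K a \<Longrightarrow> \<beta> a s = 0" "open (U a)" "s \<in> U a \<Longrightarrow> Q s (q a s)"
    "E \<in> vsections \<S> D \<Longrightarrow> F \<in> vsections \<S> D \<Longrightarrow> smooth_fun_on \<S> (U a) (\<lambda>s. q a s (E s) (F s))" for a s E F
    unfolding good_def by blast+
  obtain \<B> where \<B>: "\<B> \<subseteq> range B" "countable \<B>" "\<Union>\<B> = \<Union>(range B)"
    using Lindelof[of "range B"] G(1) by blast
  then obtain T where T: "countable T" "\<B> = B ` T" using countable_subset_image[of \<B> B UNIV] by blast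
  have cover: "\<Union>(B ` T) = UNIV" using \<B>(3) T(2) G(2) by blast
  then have "T \<noteq> {}" by auto
  define t where "t = from_nat_into T"
  have t: "\<exists>k. s \<in> B (t k)" for s
    using cover range_from_nat_into[OF \<open>T \<noteq> {}\<close> T(1)] unfolding t_def by (metis UNIV_I UN_iff rangeE)
  define \<rho> where "\<rho> n s = \<beta> (t n) s * (\<Prod>j<n. 1 - \<beta> (t j) s)" for n s
  have \<rho>_smooth: "smooth_fun \<S> (\<rho> n)" for n
    unfolding \<rho>_def
    by (intro smooth_fun_on_mult[OF cov open_UNIV] smooth_fun_on_prod[OF cov open_UNIV]
        smooth_fun_on_diff[OF cov open_UNIV] smooth_fun_on_const[OF cov open_UNIV] G(3) finite_lessThan)
  have \<rho>_nonneg: "0 \<le> \<rho> n s" for n s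
    unfolding \<rho>_def using G(4,5) by (intro mult_nonneg_nonneg prod_nonneg) auto
  have \<rho>_outside: "\<rho> n s = 0" if "s \<notin> K (t n)" for n s using G(9)[OF that] by (simp add: \<rho>_def)
  have \<rho>_later: "\<rho> n s = 0" if "s \<in> B (t k)" "k < n" for n k s
  proof -
    have "(\<Prod>j<n. 1 - \<beta> (t j) s) = 0" by (rule prod_zero) (use that G(6) in auto)
    then show ?thesis by (simp add: \<rho>_def)
  qed
  define N where "N s = (LEAST k. s \<in> B (t k))" for s
  have N: "s \<in> B (t (N s))" for s unfolding N_def using t[of s] by (rule LeastI_ex)
  define g where "g s u v = (\<Sum>n\<le>N s. \<rho> n s * q (t n) s u v)" for s u v
  have g_eq: "g s u v = (\<Sum>n\<le>k. \<rho> n s * q (t n) s u v)" if s: "s \<in> B (t k)" for s k u v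
    unfolding g_def
  proof (rule sum.mono_neutral_left)
    have "N s \<le> k" unfolding N_def using s by (rule Least_le)
    then show "{..N s} \<subseteq> {..k}" by auto
    show "\<forall>n\<in>{..k} - {..N s}. \<rho> n s * q (t n) s u v = 0" using \<rho>_later[OF N] by auto
  qed simp
  have Q_sum: "Q s (\<lambda>u v. \<Sum>n\<in>I. \<rho> n s * q (t n) s u v)" if "finite I" "I \<noteq> {}" "\<forall>n\<in>I. \<rho> n s > 0" for I s
    using that
  proof (induction I rule: finite_ne_induct)
    case (singleton n)
    then have "s \<in> U (t n)" using \<rho>_outside[of s n] G(8) by (metis insertI1 less_irrefl subsetD)
    then show ?case using Q_scale[OF G(11)] singleton by simp
  next
    case (insert n I)
    then have "s \<in> U (t n)" using \<rho>_outside[of s n] G(8) by (metis insertI1 less_irrefl subsetD)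
    then have "Q s (\<lambda>u v. \<rho> n s * q (t n) s u v + (\<Sum>n\<in>I. \<rho> n s * q (t n) s u v))"
      using insert by (intro Q_add Q_scale G(11)) auto
    then show ?case using insert(1,3) by simp
  qed
  have "Q s (g s)" for s
  proof -
    let ?I = "{n. n \<le> N s \<and> \<rho> n s > 0}"
    have "\<beta> (t (N s)) s \<noteq> 0" using G(6)[OF N] by simp
    \<comment> \<open>At the first index with \<open>\<beta> (t m) s \<noteq> 0\<close> all factors \<open>1 - \<beta> (t j) s\<close> are \<open>1\<close>, so some weight is positive.\<close>
    define m where "m = (LEAST n. \<beta> (t n) s \<noteq> 0)"
    have m: "\<beta> (t m) s \<noteq> 0" unfolding m_def by (rule LeastI[of _ "N s"]) fact
    have "m \<le> N s" unfolding m_def by (rule Least_le) fact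
    have "\<beta> (t j) s = 0" if "j < m" for j using not_less_Least that unfolding m_def by blast
    then have "\<rho> m s = \<beta> (t m) s" by (simp add: \<rho>_def)
    then have "\<rho> m s > 0" using m G(4)[of "t m" s] by simp
    then have "?I \<noteq> {}" using \<open>m \<le> N s\<close> by auto
    then have "Q s (\<lambda>u v. \<Sum>n\<in>?I. \<rho> n s * q (t n) s u v)" by (intro Q_sum) auto
    moreover have "g s = (\<lambda>u v. \<Sum>n\<in>?I. \<rho> n s * q (t n) s u v)"
    proof (intro ext)
      fix u v
      have "\<rho> n s = 0" if "\<not> 0 < \<rho> n s" for n using that \<rho>_nonneg[of n s] by linarith
      then show "g s u v = (\<Sum>n\<in>?I. \<rho> n s * q (t n) s u v)"
        unfolding g_def by (intro sum.mono_neutral_right) auto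
    qed
    ultimately show ?thesis by simp
  qed
  moreover have "smooth_fun \<S> (\<lambda>s. g s (E s) (F s))" if E: "E \<in> vsections \<S> D" and F: "F \<in> vsections \<S> D" for E F
  proof (rule smooth_fun_on_local[OF cov])
    fix s0
    obtain k where k: "s0 \<in> B (t k)" using t by blast
    have "smooth_fun \<S> (\<lambda>s. \<Sum>n\<le>k. \<rho> n s * q (t n) s (E s) (F s))"
    proof (rule smooth_fun_on_sum[OF cov open_UNIV])
      fix n
      show "smooth_fun \<S> (\<lambda>s. \<rho> n s * q (t n) s (E s) (F s))"
        by (rule smooth_fun_cutoff[OF cov G(10) \<rho>_smooth G(7,8) \<rho>_outside G(12)[OF E F]])
    qed simp
    then have "smooth_fun_on \<S> (B (t k)) (\<lambda>s. \<Sum>n\<le>k. \<rho> n s * q (t n) s (E s) (F s))"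
      by (rule smooth_fun_on_subset) simp
    then have "smooth_fun_on \<S> (B (t k)) (\<lambda>s. g s (E s) (F s))"
      by (rule smooth_fun_on_cong[OF cov G(1)]) (simp add: g_eq)
    then show "\<exists>N. open N \<and> s0 \<in> N \<and> smooth_fun_on \<S> N (\<lambda>s. g s (E s) (F s))" using G(1) k by blast
  qed
  ultimately show ?thesis by blast
qed

section \<open>From the total space to the base\<close>

text \<open>If \<open>h w v \<noteq> 0\<close>, then \<open>h (v + t w) (v + t w) = h v v + 2 t h w v\<close> becomes negative for a suitable \<open>t\<close>.\<close>

lemma semidefinite_null_in_kernel:
  assumes h: "symmetric_form \<A> W h" and sub: "subspace (W x)" and pos: "\<And>u. u \<in> W x \<Longrightarrow> h x u u \<ge> 0"
    and w: "w \<in> W x" "h x w w = 0"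
  shows "w \<in> form_kernel W h x"
proof -
  have "h x w v = 0" if v: "v \<in> W x" for v
  proof (rule ccontr)
    assume b: "h x w v \<noteq> 0"
    \<comment> \<open>Chosen such that \<open>h (v + t w) (v + t w) = - 1\<close>.\<close>
    define t where "t = - (h x v v + 1) / (2 * h x w v)"
    have tw: "t *\<^sub>R w \<in> W x" by (rule subspace_scale[OF sub w(1)])
    have vtw: "v + t *\<^sub>R w \<in> W x" by (rule subspace_add[OF sub v tw])
    note D = symmetric_formD[OF h] and R = symmetric_form_right[OF h sub]
    have 1: "h x (v + t *\<^sub>R w) (v + t *\<^sub>R w) = h x v (v + t *\<^sub>R w) + h x (t *\<^sub>R w) (v + t *\<^sub>R w)"
      by (rule D(2)[OF v tw vtw])
    have 2: "h x v (v + t *\<^sub>R w) = h x v v + t * h x w v"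
      using R(1)[OF v tw v] R(2)[OF w(1) v, of t] D(1)[OF v w(1)] by simp
    have 3: "h x (t *\<^sub>R w) (v + t *\<^sub>R w) = t * h x w v"
      using D(3)[OF w(1) vtw, of t] R(1)[OF v tw w(1)] R(2)[OF w(1) w(1), of t] w(2) by simp
    have 4: "t * h x w v = - (h x v v + 1) / 2" using b by (simp add: t_def)
    have "h x (v + t *\<^sub>R w) (v + t *\<^sub>R w) = - 1" unfolding 1 2 3 4 by (simp add: field_simps)
    then show False using pos[OF vtw] by simp
  qed
  then show ?thesis using w(1) by (simp add: form_kernel_def)
qed

context principal_line_bundle
begin

text \<open>All points of a fibre contribute the same subspace to the projected distribution, because a translation
  along the fibre does not change the image under \<pi>.\<close>

lemma push_distribution_invariant:
  assumes W: "\<And>x. W x \<subseteq> tangent_space \<A> x"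
    and inv: "\<And>a x. push \<A> (\<lambda>y. act y a) ` W x = W (act x a)"
  shows "push_distribution \<S> \<pi> W (\<pi> x) = push \<S> \<pi> ` W x"
proof (rule subset_antisym; rule subsetI)
  fix d assume "d \<in> push_distribution \<S> \<pi> W (\<pi> x)"
  then obtain y v where y: "\<pi> y = \<pi> x" "v \<in> W y" "d = push \<S> \<pi> v" by (auto simp: push_distribution_def)
  obtain a where "y = act x a" using act_transitive[of x y] y(1) by auto
  then obtain u where u: "u \<in> W x" "v = push \<A> (\<lambda>y. act y a) u" using inv[of a x] y(2) by blast
  then have "d = push \<S> \<pi> u" using push_right_translation(2) W y(3) by blast
  then show "d \<in> push \<S> \<pi> ` W x" using u(1) by blast
qed (auto simp: push_distribution_def)

text \<open>The preimage of the image of \<open>W x\<close> is \<open>W x\<close> plus the vertical vectors, which belong to \<open>W x\<close> already.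
  Smooth fields that span the image at \<open>s\<close> are obtained by restricting a frame of \<open>W\<close> to a local section
  of \<pi> and projecting it.\<close>

lemma codim1_push_distribution:
  assumes W: "codim1_distribution \<A> W" and vert: "\<And>x. vertical_space \<A> \<S> \<pi> x \<subseteq> W x"
    and fibre: "\<And>x. push_distribution \<S> \<pi> W (\<pi> x) = push \<S> \<pi> ` W x"
  shows "W = pull (push_distribution \<S> \<pi> W)" and "codim1_distribution \<S> (push_distribution \<S> \<pi> W)"
proof -
  define D where "D = push_distribution \<S> \<pi> W"
  have Df: "D (\<pi> x) = push \<S> \<pi> ` W x" for x unfolding D_def by (rule fibre)
  have W': "subspace (W x)" "W x \<subseteq> tangent_space \<A> x" "dim (W x) + 1 = dim (tangent_space \<A> x)" for x
    using W by (simp_all add: codim1_distribution_def)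
  have Wx: "W x = {v \<in> tangent_space \<A> x. push \<S> \<pi> v \<in> D (\<pi> x)}" for x
  proof (rule subset_antisym; rule subsetI)
    fix v assume "v \<in> W x"
    then show "v \<in> {v \<in> tangent_space \<A> x. push \<S> \<pi> v \<in> D (\<pi> x)}" using W'(2)[of x] Df[of x] by auto
  next
    fix v assume "v \<in> {v \<in> tangent_space \<A> x. push \<S> \<pi> v \<in> D (\<pi> x)}"
    then obtain w where w: "w \<in> W x" "push \<S> \<pi> v = push \<S> \<pi> w" "v \<in> tangent_space \<A> x" using Df[of x] by auto
    have "v - w \<in> vertical_space \<A> \<S> \<pi> x"
      unfolding in_vertical_iff linear_diff[OF linear_push]
      using subspace_diff[OF subspace_tangent_space w(3) subsetD[OF W'(2) w(1)]] w(2) by simp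
    from subspace_add[OF W'(1) subsetD[OF vert this] w(1)] have "(v - w) + w \<in> W x" .
    then show "v \<in> W x" by (simp only: diff_add_cancel)
  qed
  then show "W = pull (push_distribution \<S> \<pi> W)"
    unfolding D_def by (simp add: fun_eq_iff pull_distribution_def)
  have Dsub: "subspace (D s)" and DT: "D s \<subseteq> tangent_space \<S> s" for s
  proof -
    obtain x where x: "\<pi> x = s" using proj_surj by blast
    show "subspace (D s)" using linear_subspace_image[OF linear_push W'(1)[of x], of \<S> \<pi>] Df[of x] x by simp
    have "push \<S> \<pi> v \<in> tangent_space \<S> s" if "v \<in> W x" for v
      using push_proj_in_tangent_space[OF subsetD[OF W'(2) that]] x by simp
    then show "D s \<subseteq> tangent_space \<S> s" using Df[of x] x by auto
  qed
  have Ddim: "dim (D s) + 1 = dim (tangent_space \<S> s)" for s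
  proof -
    obtain x where x: "\<pi> x = s" using proj_surj by blast
    have "dim (W x) = dim (D (\<pi> x)) + 1" unfolding Wx by (rule dim_push_preimage[OF Dsub DT])
    then show ?thesis using W'(3)[of x] dim_tangent_total[of x] x by simp
  qed
  show "codim1_distribution \<S> (push_distribution \<S> \<pi> W)"
    unfolding D_def[symmetric]
  proof (rule codim1_distributionI[OF manifolds(2) Dsub DT Ddim])
    fix s
    obtain x where x: "\<pi> x = s" using proj_surj by blast
    obtain \<sigma> O' where \<sigma>: "open O'" "\<pi> x \<in> O'" "smooth_map_on \<S> \<A> O' \<sigma>" "\<forall>s\<in>O'. \<pi> (\<sigma> s) = s" "\<sigma> (\<pi> x) = x"
      using local_section[of x] by (elim exE conjE)
    obtain U X where X: "open U" "x \<in> U" "\<forall>i<dim (W x). smooth_vector_field_on \<A> U (X i)"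
      "\<forall>y\<in>U. W y = span ((\<lambda>i. X i y) ` {..<dim (W x)})"
      using W unfolding codim1_distribution_def by blast
    define P where "P = O' \<inter> \<sigma> -` U"
    have P: "open P" "s \<in> P"
      unfolding P_def using continuous_on_open_vimage_Int[OF smooth_map_onD(1)[OF \<sigma>(3)] \<sigma>(1) X(1)] \<sigma>(2,5) X(2) x by auto
    define Z where "Z i r = push \<S> \<pi> (X i (\<sigma> r))" for i r
    have XW: "X i y \<in> W y" if "y \<in> U" "i < dim (W x)" for i y
      unfolding X(4)[rule_format, OF that(1)] by (rule span_base) (use that(2) in auto)
    have ZD: "Z i r \<in> D r" if "r \<in> P" "i < dim (W x)" for i r
      using that XW[of "\<sigma> r" i] Df[of "\<sigma> r"] \<sigma>(4) by (auto simp: P_def Z_def)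
    have Zs: "smooth_vector_field_on \<S> P (Z i)" if i: "i < dim (W x)" for i
    proof (rule smooth_vector_field_onI)
      show "Z i r \<in> tangent_space \<S> r" if "r \<in> P" for r by (rule subsetD[OF DT ZD[OF that i]])
      fix f assume f: "smooth_fun \<S> f"
      have Xf: "smooth_fun_on \<A> U (\<lambda>y. X i y (f \<circ> \<pi>))"
        by (rule smooth_vector_field_onD(2)[OF X(3)[rule_format, OF i] smooth_fun_proj[OF f]])
      have "smooth_fun_on \<S> P (\<lambda>r. X i (\<sigma> r) (f \<circ> \<pi>))"
        by (rule smooth_fun_on_compose[OF cov(2,1) P(1) X(1) _ smooth_map_on_subset[OF \<sigma>(3)] Xf]) (auto simp: P_def)
      then show "smooth_fun_on \<S> P (\<lambda>r. Z i r f)" using f by (simp add: Z_def push_def)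
    qed
    have "D s = push \<S> \<pi> ` span ((\<lambda>i. X i x) ` {..<dim (W x)})" 
      using Df[of x] X(4)[rule_format, OF X(2)] x by simp
    also have "\<dots> = span (push \<S> \<pi> ` (\<lambda>i. X i x) ` {..<dim (W x)})" by (rule linear_span_image[OF linear_push, symmetric])
    also have "push \<S> \<pi> ` (\<lambda>i. X i x) ` {..<dim (W x)} = (\<lambda>Y. Y s) ` Z ` {..<dim (W x)}"
      using \<sigma>(5) x by (simp add: image_image Z_def)
    finally show "\<exists>U \<Y>. open U \<and> s \<in> U \<and> finite \<Y> \<and> (\<forall>Y\<in>\<Y>. smooth_vector_field_on \<S> U Y) \<and>
      (\<forall>y\<in>U. \<forall>Y\<in>\<Y>. Y y \<in> D y) \<and> D s = span ((\<lambda>Y. Y s) ` \<Y>)"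
      using P Zs ZD by (intro exI[of _ P] exI[of _ "Z ` {..<dim (W x)}"] conjI) auto
  qed
qed

text \<open>Vectors of the projected distribution are lifted to \<open>W x\<close> by an arbitrary choice; if the vertical vectors
  are in the kernel of \<open>h\<close>, the choice does not affect the value.\<close>

definition induced_form :: "('m \<Rightarrow> 'm tvec set) \<Rightarrow> 'm form \<Rightarrow> 'm \<Rightarrow> 's tvec \<Rightarrow> 's tvec \<Rightarrow> real" where
  "induced_form W h x u v =
     (let lift = (\<lambda>d. SOME w. w \<in> W x \<and> push \<S> \<pi> w = d)
      in if u \<in> push \<S> \<pi> ` W x \<and> v \<in> push \<S> \<pi> ` W x then h x (lift u) (lift v) else 0)"

lemma induced_form_push:
  assumes h: "symmetric_form \<A> W h" and sub: "subspace (W x)" and WT: "W x \<subseteq> tangent_space \<A> x"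
    and ker: "vertical_space \<A> \<S> \<pi> x \<subseteq> form_kernel W h x" and w: "w \<in> W x" "w' \<in> W x"
  shows "induced_form W h x (push \<S> \<pi> w) (push \<S> \<pi> w') = h x w w'"
proof -
  have eq: "h x w1 v = h x w2 v" if w12: "w1 \<in> W x" "w2 \<in> W x" "push \<S> \<pi> w1 = push \<S> \<pi> w2" and v: "v \<in> W x" for w1 w2 v
  proof -
    have d: "w1 - w2 \<in> W x" by (rule subspace_diff[OF sub w12(1,2)])
    then have "w1 - w2 \<in> vertical_space \<A> \<S> \<pi> x"
      using w12(3) WT by (auto simp: in_vertical_iff linear_diff[OF linear_push])
    then have "h x (w1 - w2) v = 0" using ker v by (auto simp: form_kernel_def)
    then have "h x ((w1 - w2) + w2) v = h x w2 v" using symmetric_formD(2)[OF h d w12(2) v] by simp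
    then show ?thesis by (simp only: diff_add_cancel)
  qed
  define lift where "lift d = (SOME w. w \<in> W x \<and> push \<S> \<pi> w = d)" for d
  have l: "lift (push \<S> \<pi> v) \<in> W x \<and> push \<S> \<pi> (lift (push \<S> \<pi> v)) = push \<S> \<pi> v" if "v \<in> W x" for v
  proof -
    have "\<exists>w. w \<in> W x \<and> push \<S> \<pi> w = push \<S> \<pi> v" using that by blast
    then show ?thesis unfolding lift_def by (rule someI_ex)
  qed
  let ?l = "lift (push \<S> \<pi> w)" and ?l' = "lift (push \<S> \<pi> w')"
  have "induced_form W h x (push \<S> \<pi> w) (push \<S> \<pi> w') = h x ?l ?l'"
    using w by (simp add: induced_form_def lift_def[symmetric, abs_def])
  also have "\<dots> = h x w ?l'" by (rule eq) (use l w in auto)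
  also have "\<dots> = h x ?l' w" by (rule symmetric_formD(1)[OF h]) (use l w in auto)
  also have "\<dots> = h x w' w" by (rule eq) (use l w in auto)
  also have "\<dots> = h x w w'" by (rule symmetric_formD(1)[OF h w(2,1)])
  finally show ?thesis .
qed

text \<open>The metric \<open>g\<close> is glued from the forms \<open>H (\<sigma> s)\<close> that \<open>h\<close> induces along local sections \<sigma>. Two forms
  induced from points of the same fibre are proportional because the conformal class of \<open>h\<close> is invariant;
  \<open>Q s\<close> is the set of their common positive multiples.\<close>

lemma rt_structure_is_pullback:
  assumes rt: "rt_structure \<A> \<S> \<pi> act (W, C)"
  obtains D g where "codim1_distribution \<S> D" "positive_definite_metric \<S> D g"
    "(W, C) = rt_pullback \<A> \<S> \<pi> (D, conformal_class \<S> g)"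
proof -
  have cW: "codim1_distribution \<A> W"
    and inv: "\<And>a x. push \<A> (\<lambda>y. act y a) ` W x = W (act x a)"
    and invC: "\<And>a. pullback_form \<A> (\<lambda>y. act y a) W ` C = C"
    and kerC: "\<And>h x. h \<in> C \<Longrightarrow> form_kernel W h x = vertical_space \<A> \<S> \<pi> x"
    using rt by (auto simp: rt_structure_def shearfree_structure_def invariant_structure_def)
  obtain h where h: "semipositive_metric \<A> W h" "C = conformal_class \<A> h"
    using rt by (auto simp: rt_structure_def shearfree_structure_def)
  have sf: "symmetric_form \<A> W h" and pos: "\<And>x u. u \<in> W x \<Longrightarrow> 0 \<le> h x u u"
    using h(1) by (auto simp: semipositive_metric_def)
  have ker: "form_kernel W h x = vertical_space \<A> \<S> \<pi> x" for x
    by (rule kerC) (simp add: h(2) conformal_class_refl[OF cov(1)])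
  have W: "subspace (W x)" "W x \<subseteq> tangent_space \<A> x" for x using cW by (simp_all add: codim1_distribution_def)
  have vert: "vertical_space \<A> \<S> \<pi> x \<subseteq> W x" for x using ker[of x] by (auto simp: form_kernel_def)
  define D where "D = push_distribution \<S> \<pi> W"
  have Df: "D (\<pi> x) = push \<S> \<pi> ` W x" for x
    unfolding D_def by (rule push_distribution_invariant[OF W(2) inv])
  have WD: "W = pull D" and cD: "codim1_distribution \<S> D"
    unfolding D_def using codim1_push_distribution[OF cW vert Df[unfolded D_def]] .
  define H where "H = induced_form W h"
  have H: "H x (push \<S> \<pi> w) (push \<S> \<pi> w') = h x w w'" if "w \<in> W x" "w' \<in> W x" for x w w'
    unfolding H_def by (rule induced_form_push[OF sf W _ that]) (simp add: ker)
  have H_outside: "H x u v = 0" if "u \<notin> D (\<pi> x) \<or> v \<notin> D (\<pi> x)" for x u v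
    using that by (auto simp: H_def induced_form_def Df)
  \<comment> \<open>Translation by \<open>a\<close> carries \<open>W x\<close> to \<open>W y\<close> without changing the projections of vectors, and it
    multiplies \<open>h\<close> by a function \<phi>, so the factor is \<open>\<phi> x\<close>.\<close>
  have H_translate: "\<exists>c>0. \<forall>u v. H y u v = c * H x u v" if xy: "\<pi> x = \<pi> y" for x y
  proof -
    obtain a where a: "y = act x a" using act_transitive[OF xy] by blast
    have "pullback_form \<A> (\<lambda>y. act y a) W h \<in> conformal_class \<A> h"
      using invC[of a] conformal_class_refl[OF cov(1), of h] unfolding h(2) by blast
    then obtain \<phi> where \<phi>: "\<forall>x. \<phi> x > 0" "pullback_form \<A> (\<lambda>y. act y a) W h = (\<lambda>x u v. \<phi> x * h x u v)"
      by (rule conformal_classE)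
    have "H y u v = \<phi> x * H x u v" for u v
    proof (cases "u \<in> D (\<pi> x) \<and> v \<in> D (\<pi> x)")
      case True
      then obtain w w' where w: "w \<in> W x" "u = push \<S> \<pi> w" "w' \<in> W x" "v = push \<S> \<pi> w'" unfolding Df by blast
      let ?R = "push \<A> (\<lambda>y. act y a)"
      have R: "?R w \<in> W y" "?R w' \<in> W y" using inv[of a x] w a by auto
      have "push \<S> \<pi> (?R w) = u" "push \<S> \<pi> (?R w') = v"
        using push_right_translation(2) W(2) w by blast+
      then have "H y u v = h y (?R w) (?R w')" using H[OF R] by (simp only:)
      also have "\<dots> = \<phi> x * h x w w'"
        using fun_cong[OF fun_cong[OF fun_cong[OF \<phi>(2), of x], of w], of w'] w a by (simp add: pullback_form_def)
      also have "h x w w' = H x u v" using H[OF w(1,3)] w by simp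
      finally show ?thesis .
    next
      case False
      then show ?thesis using H_outside[of u x v] H_outside[of u y v] xy by auto
    qed
    then show ?thesis using \<phi>(1) by blast
  qed
  define Q where "Q s q \<longleftrightarrow> (\<forall>x. \<pi> x = s \<longrightarrow> (\<exists>c>0. \<forall>u v. q u v = c * H x u v))" for s q
  have QH: "Q (\<pi> y) (H y)" for y unfolding Q_def using H_translate by blast
  have "\<exists>g. (\<forall>s. Q s (g s)) \<and> (\<forall>E\<in>vsections \<S> D. \<forall>F\<in>vsections \<S> D. smooth_fun \<S> (\<lambda>s. g s (E s) (F s)))"
  proof (rule glue_cone_sections[OF manifolds(2)])
    fix s q q' assume q: "Q s q" "Q s q'"
    show "Q s (\<lambda>u v. q u v + q' u v)"
      unfolding Q_def
    proof (intro allI impI)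
      fix x assume "\<pi> x = s"
      then obtain c c' where "c > 0" "\<forall>u v. q u v = c * H x u v" "c' > 0" "\<forall>u v. q' u v = c' * H x u v"
        using q unfolding Q_def by blast
      then show "\<exists>c>0. \<forall>u v. q u v + q' u v = c * H x u v"
        by (intro exI[of _ "c + c'"]) (simp add: algebra_simps)
    qed
  next
    fix s q and c :: real assume q: "Q s q" and c: "c > 0"
    show "Q s (\<lambda>u v. c * q u v)"
      unfolding Q_def
    proof (intro allI impI)
      fix x assume "\<pi> x = s"
      then obtain c' where "c' > 0" "\<forall>u v. q u v = c' * H x u v" using q unfolding Q_def by blast
      then show "\<exists>c'>0. \<forall>u v. c * q u v = c' * H x u v" using c by (intro exI[of _ "c * c'"]) simp
    qed
  next
    fix s0
    obtain x0 where x0: "\<pi> x0 = s0" using proj_surj by blast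
    obtain \<sigma> O' where \<sigma>: "open O'" "\<pi> x0 \<in> O'" "smooth_map_on \<S> \<A> O' \<sigma>" "\<forall>s\<in>O'. \<pi> (\<sigma> s) = s"
      using local_section[of x0] by (elim exE conjE)
    have "smooth_fun_on \<S> O' (\<lambda>s. H (\<sigma> s) (E s) (F s))" if E: "E \<in> vsections \<S> D" and F: "F \<in> vsections \<S> D" for E F
    proof (rule smooth_fun_on_local[OF cov(2)])
      fix s1 assume s1: "s1 \<in> O'"
      have sub: "\<And>s. subspace (D s)" using codim1_distribution_dim[OF manifolds(2) cD] by blast
      \<comment> \<open>Near \<open>\<sigma> s1\<close> the sections \<open>X\<close> and \<open>Y\<close> of \<open>W\<close> lift \<open>E\<close> and \<open>F\<close>, so \<open>h (X, Y)\<close> computes the induced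
        form along \<sigma>.\<close>
      obtain X N where X: "X \<in> vsections \<A> W" "open N" "\<sigma> s1 \<in> N" "\<forall>x\<in>N. push \<S> \<pi> (X x) = E (\<pi> x)"
        using pull_lift[OF sub E, of "\<sigma> s1"] unfolding WD[symmetric] by blast
      obtain Y N' where Y: "Y \<in> vsections \<A> W" "open N'" "\<sigma> s1 \<in> N'" "\<forall>x\<in>N'. push \<S> \<pi> (Y x) = F (\<pi> x)"
        using pull_lift[OF sub F, of "\<sigma> s1"] unfolding WD[symmetric] by blast
      define P where "P = O' \<inter> \<sigma> -` (N \<inter> N')"
      have P: "open P" "s1 \<in> P" unfolding P_def
        using continuous_on_open_vimage_Int[OF smooth_map_onD(1)[OF \<sigma>(3)] \<sigma>(1) open_Int[OF X(2) Y(2)]] s1 X(3) Y(3) by auto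
      have "smooth_fun_on \<S> P (\<lambda>s. h (\<sigma> s) (X (\<sigma> s)) (Y (\<sigma> s)))"
        by (rule smooth_fun_on_compose[OF cov(2,1) P(1) open_UNIV _ smooth_map_on_subset[OF \<sigma>(3)] symmetric_formD(5)[OF sf X(1) Y(1)]])
           (auto simp: P_def)
      then have "smooth_fun_on \<S> P (\<lambda>s. H (\<sigma> s) (E s) (F s))"
      proof (rule smooth_fun_on_cong[OF cov(2) P(1)])
        fix s assume "s \<in> P"
        then have "push \<S> \<pi> (X (\<sigma> s)) = E s" "push \<S> \<pi> (Y (\<sigma> s)) = F s" using X(4) Y(4) \<sigma>(4) by (auto simp: P_def)
        then show "h (\<sigma> s) (X (\<sigma> s)) (Y (\<sigma> s)) = H (\<sigma> s) (E s) (F s)"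
          using H[OF vsectionsD(2)[OF X(1)] vsectionsD(2)[OF Y(1)], of "\<sigma> s"] by simp
      qed
      then show "\<exists>N. open N \<and> s1 \<in> N \<and> smooth_fun_on \<S> N (\<lambda>s. H (\<sigma> s) (E s) (F s))" using P by blast
    qed
    moreover have "\<forall>s\<in>O'. Q s (H (\<sigma> s))" using QH \<sigma>(4) by metis
    ultimately show "\<exists>U q. open U \<and> s0 \<in> U \<and> (\<forall>s\<in>U. Q s (q s)) \<and>
      (\<forall>E\<in>vsections \<S> D. \<forall>F\<in>vsections \<S> D. smooth_fun_on \<S> U (\<lambda>s. q s (E s) (F s)))"
      using \<sigma>(1,2) x0 by (intro exI[of _ O'] exI[of _ "\<lambda>s. H (\<sigma> s)"]) auto
  qed
  then obtain g where gQ: "\<And>s. Q s (g s)"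
    and gs: "\<forall>E\<in>vsections \<S> D. \<forall>F\<in>vsections \<S> D. smooth_fun \<S> (\<lambda>s. g s (E s) (F s))" by blast
  have gH: "\<exists>c>0. \<forall>u v. g (\<pi> x) u v = c * H x u v" for x using gQ[of "\<pi> x"] unfolding Q_def by blast
  have g_push: "\<exists>c>0. (\<forall>u v. g (\<pi> x) u v = c * H x u v) \<and> (\<forall>w\<in>W x. \<forall>w'\<in>W x. g (\<pi> x) (push \<S> \<pi> w) (push \<S> \<pi> w') = c * h x w w')" for x
  proof -
    obtain c where "c > 0" "\<forall>u v. g (\<pi> x) u v = c * H x u v" using gH by blast
    then show ?thesis using H by (intro exI[of _ c]) simp
  qed
  have g_sym: "symmetric_form \<S> D g"
    unfolding symmetric_form_def
  proof (intro conjI)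
    show "\<forall>X\<in>vsections \<S> D. \<forall>Y\<in>vsections \<S> D. smooth_fun \<S> (\<lambda>x. g x (X x) (Y x))" by (rule gs)
    have *: "(u \<in> D s \<longrightarrow> v \<in> D s \<longrightarrow> g s u v = g s v u \<and> (\<forall>k. g s (k *\<^sub>R u) v = k * g s u v) \<and>
        (\<forall>z\<in>D s. g s (u + v) z = g s u z + g s v z)) \<and> (u \<notin> D s \<or> v \<notin> D s \<longrightarrow> g s u v = 0)" for s u v
    proof -
      obtain x where x: "\<pi> x = s" using proj_surj by blast
      obtain c where c: "\<forall>u v. g s u v = c * H x u v"
        "\<forall>w\<in>W x. \<forall>w'\<in>W x. g s (push \<S> \<pi> w) (push \<S> \<pi> w') = c * h x w w'" using g_push[of x] x by blast
      have Ds: "D s = push \<S> \<pi> ` W x" using Df[of x] x by simp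
      note hD = symmetric_formD[OF sf]
      show ?thesis
      proof (intro conjI impI allI ballI)
        show "g s u v = 0" if "u \<notin> D s \<or> v \<notin> D s" using c(1) H_outside[of u x v] that x by simp
        assume "u \<in> D s" "v \<in> D s"
        then obtain w w' where w: "w \<in> W x" "u = push \<S> \<pi> w" "w' \<in> W x" "v = push \<S> \<pi> w'" unfolding Ds by blast
        show "g s u v = g s v u" using c(2) w hD(1)[OF w(1,3)] by simp
        show "g s (k *\<^sub>R u) v = k * g s u v" for k
          using c(2)[rule_format, OF subspace_scale[OF W(1) w(1)] w(3), of k] c(2)[rule_format, OF w(1,3)] hD(3)[OF w(1,3), of k]
          by (simp add: w linear_scale[OF linear_push])
        fix z assume "z \<in> D s"
        then obtain y where y: "y \<in> W x" "z = push \<S> \<pi> y" unfolding Ds by blast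
        have "g s (push \<S> \<pi> (w + w')) z = c * h x (w + w') y"
          unfolding y(2) by (rule c(2)[rule_format, OF subspace_add[OF W(1) w(1,3)] y(1)])
        also have "\<dots> = g s u z + g s v z"
          using c(2) w y hD(2)[OF w(1,3) y(1)] by (simp add: distrib_left)
        finally show "g s (u + v) z = g s u z + g s v z" by (simp only: w linear_add[OF linear_push])
      qed
    qed
    show "\<forall>s. \<forall>u\<in>D s. \<forall>v\<in>D s. g s u v = g s v u"
      "\<forall>s. \<forall>u\<in>D s. \<forall>v\<in>D s. \<forall>w\<in>D s. g s (u + v) w = g s u w + g s v w"
      "\<forall>s c. \<forall>u\<in>D s. \<forall>v\<in>D s. g s (c *\<^sub>R u) v = c * g s u v"
      "\<forall>s u v. u \<notin> D s \<or> v \<notin> D s \<longrightarrow> g s u v = 0" using * by blast+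
  qed
  have g_pos: "positive_definite_metric \<S> D g"
    unfolding positive_definite_metric_def
  proof (intro conjI g_sym allI ballI impI)
    fix s u assume u: "u \<in> D s" "u \<noteq> 0"
    obtain x where x: "\<pi> x = s" using proj_surj by blast
    obtain c where c: "c > 0" "\<forall>w\<in>W x. \<forall>w'\<in>W x. g s (push \<S> \<pi> w) (push \<S> \<pi> w') = c * h x w w'"
      using g_push[of x] x by blast
    obtain w where w: "w \<in> W x" "u = push \<S> \<pi> w" using u(1) Df[of x] x by auto
    have "h x w w \<noteq> 0"
    proof
      assume null: "h x w w = 0"
      have "w \<in> form_kernel W h x"
      proof (rule semidefinite_null_in_kernel[of \<A> W h x w])
        show "symmetric_form \<A> W h" by (rule sf)
        show "subspace (W x)" by (rule W(1))
        show "0 \<le> h x v v" if "v \<in> W x" for v by (rule pos[OF that])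
        show "w \<in> W x" "h x w w = 0" by fact+
      qed
      then show False using ker[of x] w(2) u(2) by (simp add: in_vertical_iff)
    qed
    then show "0 < g s u u" using pos[OF w(1)] c w by simp
  qed
  have "pull_form D g \<in> conformal_class \<A> h"
  proof (rule pointwise_proportional_conformal[OF manifolds(1) cW sf])
    show "symmetric_form \<A> W (pull_form D g)" unfolding WD by (rule pull_form_symmetric[OF cD g_sym])
    have apply': "pull_form D g x u v = (if u \<in> W x \<and> v \<in> W x then g (\<pi> x) (push \<S> \<pi> u) (push \<S> \<pi> v) else 0)" for x u v
      by (simp add: pullback_form_def WD[symmetric])
    show "\<exists>c>0. \<forall>u v. pull_form D g x u v = c * h x u v" for x
    proof -
      obtain c where c: "c > 0" "\<forall>w\<in>W x. \<forall>w'\<in>W x. g (\<pi> x) (push \<S> \<pi> w) (push \<S> \<pi> w') = c * h x w w'"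
        using g_push[of x] by blast
      have "pull_form D g x u v = c * h x u v" for u v
      proof (cases "u \<in> W x \<and> v \<in> W x")
        case True
        then show ?thesis using c(2) by (simp add: apply')
      next
        case False
        then show ?thesis using symmetric_formD(4)[OF sf, of u x v] unfolding apply' by auto
      qed
      then show ?thesis using c(1) by blast
    qed
    from positive_definite_nondegenerate[OF manifolds(2) cD g_pos]
    show "(\<forall>x. \<exists>u\<in>W x. h x u u \<noteq> 0) \<or> (\<forall>x u v. h x u v = 0)"
    proof
      assume nz: "\<forall>s. \<exists>u\<in>D s. g s u u \<noteq> 0"
      have "\<exists>u\<in>W x. h x u u \<noteq> 0" for x
      proof -
        obtain c where c: "\<forall>w\<in>W x. \<forall>w'\<in>W x. g (\<pi> x) (push \<S> \<pi> w) (push \<S> \<pi> w') = c * h x w w'"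
          using g_push[of x] by blast
        obtain u where "u \<in> D (\<pi> x)" "g (\<pi> x) u u \<noteq> 0" using nz by blast
        then obtain w where w: "w \<in> W x" "g (\<pi> x) (push \<S> \<pi> w) (push \<S> \<pi> w) \<noteq> 0" unfolding Df by blast
        then have "h x w w \<noteq> 0" using c[rule_format, OF w(1) w(1)] by simp
        then show ?thesis using w(1) by blast
      qed
      then show ?thesis by blast
    next
      assume z: "\<forall>s u v. g s u v = 0"
      have "h x u v = 0" for x u v
      proof (cases "u \<in> W x \<and> v \<in> W x")
        case True
        obtain c where c: "c > 0" "\<forall>w\<in>W x. \<forall>w'\<in>W x. g (\<pi> x) (push \<S> \<pi> w) (push \<S> \<pi> w') = c * h x w w'"
          using g_push[of x] by blast
        have "c * h x u v = 0" using c(2) True z by metis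
        then show ?thesis using c(1) by simp
      next
        case False
        then show ?thesis using symmetric_formD(4)[OF sf, of u x v] by blast
      qed
      then show ?thesis by blast
    qed
  qed
  then have "C = conformal_class \<A> (pull_form D g)" using conformal_class_eq[OF cov(1)] h(2) by blast
  then have "(W, C) = (pull D, conformal_class \<A> (pull_form D g))" by (rule arg_cong2[where f = Pair, OF WD])
  then have "(W, C) = rt_pullback \<A> \<S> \<pi> (D, conformal_class \<S> g)" by (simp only: rt_pullback_conformal)
  then show thesis by (rule that[OF cD g_pos])
qed

end

section \<open>The correspondence\<close>

theorem proposition3p6:
  fixes \<A> :: "('m::{t2_space,second_countable_topology}, 'e::euclidean_space) chart set"
    and \<S> :: "('s::{t2_space,second_countable_topology}, 'f::euclidean_space) chart set"
    and G :: "'g::{t2_space,second_countable_topology} monoid"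
    and \<G> :: "('g, real) chart set"
    and \<pi> :: "'m \<Rightarrow> 's"
    and act :: "'m \<Rightarrow> 'g \<Rightarrow> 'm"
  assumes "principal_bundle \<A> \<S> G \<G> \<pi> act"
    and "lie_group_isomorphic G \<G> real_group euclidean_atlas \<or>
         lie_group_isomorphic G \<G> circle_group circle_atlas"
  shows "bij_betw (rt_projection \<S> \<pi>)
           {P. rt_structure \<A> \<S> \<pi> act P} {Q. subconformal_structure \<S> Q} \<and>
         bij_betw (rt_pullback \<A> \<S> \<pi>)
           {Q. subconformal_structure \<S> Q} {P. rt_structure \<A> \<S> \<pi> act P} \<and>
         (\<forall>P. rt_structure \<A> \<S> \<pi> act P \<longrightarrow> rt_pullback \<A> \<S> \<pi> (rt_projection \<S> \<pi> P) = P) \<and>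
         (\<forall>Q. subconformal_structure \<S> Q \<longrightarrow> rt_projection \<S> \<pi> (rt_pullback \<A> \<S> \<pi> Q) = Q)"
proof -
  interpret principal_line_bundle \<A> \<S> G \<G> \<pi> act by standard (rule assms(1))
  let ?pull = "rt_pullback \<A> \<S> \<pi>" and ?proj = "rt_projection \<S> \<pi>"
  have sub: "\<exists>D g. codim1_distribution \<S> D \<and> positive_definite_metric \<S> D g \<and> Q = (D, conformal_class \<S> g)"
    if "subconformal_structure \<S> Q" for Q
    using that by (auto simp: subconformal_structure_def)
  have rt_pull: "rt_structure \<A> \<S> \<pi> act (?pull Q)" and proj_pull: "?proj (?pull Q) = Q"
    if "subconformal_structure \<S> Q" for Q
    using sub[OF that] rt_structure_pullback rt_projection_pullback by auto
  have is_pull: "\<exists>Q. subconformal_structure \<S> Q \<and> P = ?pull Q" if rt: "rt_structure \<A> \<S> \<pi> act P" for P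
  proof -
    obtain W C where P: "P = (W, C)" by fastforce
    obtain D g where "codim1_distribution \<S> D" "positive_definite_metric \<S> D g" "P = ?pull (D, conformal_class \<S> g)"
      using rt_structure_is_pullback[of W C] rt unfolding P by blast
    then show ?thesis by (intro exI[of _ "(D, conformal_class \<S> g)"]) (auto simp: subconformal_structure_def)
  qed
  have pull_proj: "?pull (?proj P) = P" and sub_proj: "subconformal_structure \<S> (?proj P)"
    if "rt_structure \<A> \<S> \<pi> act P" for P
    using is_pull[OF that] proj_pull by auto
  show ?thesis
    using rt_pull proj_pull pull_proj sub_proj
    by (intro conjI bij_betw_byWitness[of _ ?pull ?proj] bij_betw_byWitness[of _ ?proj ?pull]) auto
qed

end
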